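(* Let $n\ge3$, $\boldsymbol\gamma=(\gamma_1,\dots,\gamma_n)\in\mathbb{C}^n$ with $\Re\gamma_j>0$ for all $j$, and $\mathbf d=(d_1,\dots,d_n)\in\mathbb{N}^n$. Assume that for $j=1,\dots,n$ and $\varepsilon_{j+1},\dots,\varepsilon_n\in\{0,1\}$: $$\frac1{d_j}+\sum_{k=j+1}^n\frac{\varepsilon_k}{d_k}\in\mathbb{N}\iff j=2\text{ and }\varepsilon_3=\dots=\varepsilon_n=1.$$ Put $b:=\sum_{k=2}^n d_k^{-1}$ (so $b\in\mathbb{N}$). Let $\mathbf N=(N_1,\dots,N_n)\in\mathbb{N}_0^n$ and $\boldsymbol\theta=(\theta_1,\dots,\theta_n)\in\mathbb{C}^n$ with $\theta_2+\dots+\theta_n\ne0$ and $\theta_n\ne0$. Then the directional limit $\zeta^{\boldsymbol\theta}_{n,\mathbf d,\boldsymbol\gamma}(-\mathbf N):=\lim_{t\to0,\,t\in\mathbb{C}\setminus\{0\}}\zeta_{n,\mathbf d,\boldsymbol\gamma}(-\mathbf N+t\boldsymbol\theta)$ exists and $$\zeta^{\boldsymbol\theta}_{n,\mathbf d,\boldsymbol\gamma}(-\mathbf N)=C(\mathbf N,\mathbf d)\,B_{d_1(|\mathbf N|+b)+1}\Big(\gamma_1^{|\mathbf N|+b}\prod_{j=2}^n\gamma_j^{-1/d_j}\Big)\Big(\frac{\theta_n}{\theta_2+\dots+\theta_n}\Big)\prod_{j=2}^n\Gamma\Big(\frac1{d_j}\Big)+H_{n,\mathbf d,\boldsymbol\gamma}(\mathbf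 N),$$ where $$C(\mathbf N,\mathbf d):=\prod_{j=3}^n\Big(\prod_{u=-N_{j-1}-\dots-N_n}^{-N_j-\dots-N_n-1}\Big(u-\sum_{k=j}^n\frac1{d_k}\Big)\Big)\cdot\frac{(-1)^{N_2+\dots+N_{n-1}+b+d_1(|\mathbf N|+b)}N_n!}{(N_2+\dots+N_n+b)!\,(\prod_{j=2}^nd_j)\,(d_1(|\mathbf N|+b)+1)}\in\mathbb{Q}\setminus\{0\},$$ $$H_{n,\mathbf d,\boldsymbol\gamma}(\mathbf N):=-\frac12\zeta_{n-1,\mathbf d',\boldsymbol\gamma'}(-N_1,\dots,-N_{n-2},-N_{n-1}-N_n)-\sum_{\substack{k=1\\ d_n\mid 2k-1}}^{[(1+d_nN_n)/2]}\frac{B_{2k}}{2k}\binom{N_n}{(2k-1)/d_n}\gamma_n^{(2k-1)/d_n}\zeta_{n-1,\mathbf d',\boldsymbol\gamma'}\Big(-N_1,\dots,-N_{n-2},-N_{n-1}-N_n+\tfrac{2k-1}{d_n}\Big)\in\mathbb{Q}(\gamma_1,\dots,\gamma_n),$$ with $\mathbf d'=(d_1,\dots,d_{n-1})$, $\boldsymbol\gamma'=(\gamma_1,\dots,\gamma_{n-1})$.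
   Context: For $m\in\mathbb{N}$, $\mathbf e\in\mathbb{N}^m$, $\boldsymbol\eta\in\mathbb{C}^m$ with $\Re\eta_j>0$, $\zeta_{m,\mathbf e,\boldsymbol\eta}(\mathbf s)$ denotes the meromorphic continuation to $\mathbb{C}^m$ of $\sum_{m_1,\dots,m_m\ge1}\prod_{j=1}^m(\eta_1m_1^{e_1}+\dots+\eta_jm_j^{e_j})^{-s_j}$ (principal branch of powers). $|\mathbf N|=N_1+\dots+N_n$. $B_k$ are the Bernoulli numbers defined by $X/(e^X-1)=\sum_{k\ge0}B_kX^k/k!$; $\Gamma$ is Euler's gamma function; $[x]$ the integer part. *)

theory Defs
  imports "HOL-Analysis.Analysis" "HOL-Computational_Algebra.Formal_Power_Series"
begin

text \<open>
  Points of \<open>\<complex>\<^sup>m\<close> are represented by functions \<open>nat \<Rightarrow> complex\<close> of which only the coordinates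
  \<open>1, \<dots>, m\<close> matter. A function that is complex differentiable at a point in the sense below does
  not depend on the remaining coordinates there, because the increment is measured in the
  coordinates \<open>1, \<dots>, m\<close> only.
\<close>

definition polydisc :: "nat \<Rightarrow> (nat \<Rightarrow> complex) \<Rightarrow> real \<Rightarrow> (nat \<Rightarrow> complex) set" where
  "polydisc m p r = {z. \<forall>i\<in>{1..m}. norm (z i - p i) < r}"

definition complex_differentiable_at ::
    "nat \<Rightarrow> ((nat \<Rightarrow> complex) \<Rightarrow> complex) \<Rightarrow> (nat \<Rightarrow> complex) \<Rightarrow> bool" where
  "complex_differentiable_at m f z \<longleftrightarrow>
     (\<exists>a :: nat \<Rightarrow> complex. \<forall>\<epsilon>>0. \<exists>\<delta>>0. \<forall>w\<in>polydisc m z \<delta>.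
        norm (f w - f z - (\<Sum>i=1..m. a i * (w i - z i))) \<le> \<epsilon> * (\<Sum>i=1..m. norm (w i - z i)))"

definition holomorphic_on_polydisc ::
    "nat \<Rightarrow> ((nat \<Rightarrow> complex) \<Rightarrow> complex) \<Rightarrow> (nat \<Rightarrow> complex) \<Rightarrow> real \<Rightarrow> bool" where
  "holomorphic_on_polydisc m f p r \<longleftrightarrow> (\<forall>z\<in>polydisc m p r. complex_differentiable_at m f z)"

definition regular_at ::
    "nat \<Rightarrow> ((nat \<Rightarrow> complex) \<Rightarrow> complex) \<Rightarrow> (nat \<Rightarrow> complex) \<Rightarrow> bool" where
  "regular_at m f p \<longleftrightarrow> (\<exists>r>0. holomorphic_on_polydisc m f p r)"

text \<open>
  Meromorphic on \<open>\<complex>\<^sup>m\<close>: locally a quotient of holomorphic functions whose denominator does not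
  vanish identically. Nothing is required of the values of \<open>f\<close> on the zero set of the denominator,
  so they are meaningful only at points where \<open>f\<close> is regular.
\<close>

definition meromorphic_Cm :: "nat \<Rightarrow> ((nat \<Rightarrow> complex) \<Rightarrow> complex) \<Rightarrow> bool" where
  "meromorphic_Cm m f \<longleftrightarrow>
     (\<forall>p. \<exists>r>0. \<exists>g h. holomorphic_on_polydisc m g p r \<and> holomorphic_on_polydisc m h p r \<and>
        (\<exists>z\<in>polydisc m p r. h z \<noteq> 0) \<and>
        (\<forall>z\<in>polydisc m p r. h z \<noteq> 0 \<longrightarrow> f z = g z / h z))"

definition mzeta_term ::
    "nat \<Rightarrow> (nat \<Rightarrow> nat) \<Rightarrow> (nat \<Rightarrow> complex) \<Rightarrow> (nat \<Rightarrow> complex) \<Rightarrow> (nat \<Rightarrow> nat) \<Rightarrow> complex" where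
  "mzeta_term m e \<eta> s x = (\<Prod>j=1..m. (\<Sum>k=1..j. \<eta> k * of_nat (x k ^ e k)) powr (- s j))"

definition mzeta_indices :: "nat \<Rightarrow> (nat \<Rightarrow> nat) set" where
  "mzeta_indices m = PiE {1..m} (\<lambda>_. {1..})"

definition mzeta_domain ::
    "nat \<Rightarrow> (nat \<Rightarrow> nat) \<Rightarrow> (nat \<Rightarrow> complex) \<Rightarrow> (nat \<Rightarrow> complex) set" where
  \<comment> \<open>the interior of the domain of absolute convergence\<close>
  "mzeta_domain m e \<eta> =
     {s. \<exists>r>0. \<forall>z\<in>polydisc m s r. (\<lambda>x. norm (mzeta_term m e \<eta> z x)) summable_on mzeta_indices m}"

definition is_mzeta_continuation ::
    "nat \<Rightarrow> (nat \<Rightarrow> nat) \<Rightarrow> (nat \<Rightarrow> complex) \<Rightarrow> ((nat \<Rightarrow> complex) \<Rightarrow> complex) \<Rightarrow> bool" where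
  "is_mzeta_continuation m e \<eta> f \<longleftrightarrow>
     meromorphic_Cm m f \<and>
     (\<forall>s\<in>mzeta_domain m e \<eta>. f s = infsum (mzeta_term m e \<eta> s) (mzeta_indices m))"

definition mzeta_regular ::
    "nat \<Rightarrow> (nat \<Rightarrow> nat) \<Rightarrow> (nat \<Rightarrow> complex) \<Rightarrow> (nat \<Rightarrow> complex) \<Rightarrow> bool" where
  "mzeta_regular m e \<eta> s \<longleftrightarrow> (\<exists>f. is_mzeta_continuation m e \<eta> f \<and> regular_at m f s)"

text \<open>
  The value of the meromorphic continuation at a regular point. By the identity theorem two
  continuations that are both regular at \<open>s\<close> have the same value there. At a non-regular point
  the value is unspecified.
\<close>

definition mzeta ::
    "nat \<Rightarrow> (nat \<Rightarrow> nat) \<Rightarrow> (nat \<Rightarrow> complex) \<Rightarrow> (nat \<Rightarrow> complex) \<Rightarrow> complex" where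
  "mzeta m e \<eta> s = (THE v. \<exists>f. is_mzeta_continuation m e \<eta> f \<and> regular_at m f s \<and> f s = v)"

definition bernoulli :: "nat \<Rightarrow> complex" where
  "bernoulli k = fact k * fps_nth (fps_X / (fps_exp 1 - 1)) k"

text \<open>The subfield of \<open>\<complex>\<close> generated over \<open>\<rat>\<close> by a set (every subfield contains \<open>\<rat>\<close>).\<close>

definition is_subfield :: "complex set \<Rightarrow> bool" where
  "is_subfield K \<longleftrightarrow> 1 \<in> K \<and>
     (\<forall>x\<in>K. \<forall>y\<in>K. x - y \<in> K \<and> x * y \<in> K \<and> (y \<noteq> 0 \<longrightarrow> x / y \<in> K))"

definition rat_adjoin :: "complex set \<Rightarrow> complex set" where
  "rat_adjoin S = \<Inter>{K. is_subfield K \<and> S \<subseteq> K}"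

definition C_coeff :: "nat \<Rightarrow> (nat \<Rightarrow> nat) \<Rightarrow> nat \<Rightarrow> (nat \<Rightarrow> nat) \<Rightarrow> complex" where
  "C_coeff n d b N =
     (\<Prod>j=3..n. \<Prod>u\<in>{- (\<Sum>k=j-1..n. int (N k)) .. - (\<Sum>k=j..n. int (N k)) - 1}.
        of_int u - (\<Sum>k=j..n. 1 / of_nat (d k))) *
     ((-1) ^ ((\<Sum>k=2..n-1. N k) + b + d 1 * ((\<Sum>k=1..n. N k) + b)) * fact (N n) /
      (fact ((\<Sum>k=2..n. N k) + b) * of_nat (\<Prod>j=2..n. d j) *
       of_nat (d 1 * ((\<Sum>k=1..n. N k) + b) + 1)))"

definition H_indices :: "nat \<Rightarrow> (nat \<Rightarrow> nat) \<Rightarrow> (nat \<Rightarrow> nat) \<Rightarrow> nat set" where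
  "H_indices n d N = {k \<in> {1 .. (1 + d n * N n) div 2}. d n dvd 2 * k - 1}"

definition H_point :: "nat \<Rightarrow> (nat \<Rightarrow> nat) \<Rightarrow> nat \<Rightarrow> nat \<Rightarrow> complex" where
  "H_point n N l = (\<lambda>j. if j = n - 1 then - of_nat (N (n - 1)) - of_nat (N n) + of_nat l
                         else - of_nat (N j))"

text \<open>
  The tuples \<open>(d\<^sub>1, \<dots>, d\<^sub>n\<^sub>-\<^sub>1)\<close> and \<open>(\<gamma>\<^sub>1, \<dots>, \<gamma>\<^sub>n\<^sub>-\<^sub>1)\<close> are represented by \<open>d\<close> and \<open>\<gamma>\<close>
  themselves, since \<open>mzeta (n - 1)\<close> only reads the coordinates \<open>1, \<dots>, n - 1\<close>.
\<close>

definition H_term ::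
    "nat \<Rightarrow> (nat \<Rightarrow> nat) \<Rightarrow> (nat \<Rightarrow> complex) \<Rightarrow> (nat \<Rightarrow> nat) \<Rightarrow> complex" where
  "H_term n d \<gamma> N =
     - (1 / 2) * mzeta (n - 1) d \<gamma> (H_point n N 0) -
     (\<Sum>k\<in>H_indices n d N.
        bernoulli (2 * k) / of_nat (2 * k) *
        of_nat (N n choose ((2 * k - 1) div d n)) * \<gamma> n ^ ((2 * k - 1) div d n) *
        mzeta (n - 1) d \<gamma> (H_point n N ((2 * k - 1) div d n)))"

end

(* Applying the Euler-Maclaurin formula to the innermost sum, f(x) = (A + \<gamma> x^d)^(-s) over k >= 1, gives
   Gamma(1/d) Gamma(s - 1/d) / (d Gamma(s)) \<gamma>^(-1/d) A^(1/d - s), a linear combination of A^(-s - i) for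
   i < J, and a remainder which is O(|A|^(2 - Re s - J)) and vanishes at s = -N for N < J. Summing over
   the outer variables expresses the m+1-fold zeta function through the m-fold one at the points
   (..., s_m + s_(m+1) - 1/d) and (..., s_m + s_(m+1) + i), up to a function holomorphic on a region growing
   with J. Inductively, a product of factors 1/Gamma times the zeta function is entire, which gives the
   continuation and its polar hyperplanes. At -N + t \<theta> the factor 1/Gamma(s_n) kills everything that
   stays bounded as t tends to 0; only the main terms, iterated down to the two-fold zeta function, contain
   the pole Gamma(s_2 + ... + s_n - b) that compensates it. In the first step the terms with i <= N_n survive
   without the iteration, and they form H. *)
theory Submission
  imports Defs "HOL-Complex_Analysis.Complex_Analysis"
begin

section \<open>Functions of several complex variables\<close>

text \<open>Why a single compensating pole occurs: by the arithmetic hypothesis, the only polar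
  hyperplane that can pass through -N belongs to j = 2 with the main term selected in every step,
  where the reciprocals of the d_k add up to b. Leaving the main branch at step k drops 1/d_k from
  that sum, so every other branch is regular at -N. On the main branch the limit is that of a
  quotient of two simple zeros of 1/Gamma, with slopes \<theta>_n and \<theta>_2 + ... + \<theta>_n;
  this yields the direction-dependent factor and the factorials. The other Gamma factors have
  arguments differing by natural numbers and collapse to the products in C; the one-fold zeta value
  at -(|N| + b) supplies the Bernoulli number. Two obstacles shape the rest. The value is defined by
  uniqueness among all meromorphic continuations, hence an identity theorem in several variables is
  required. And the recursion shifts the last variable by arbitrarily large i as the region grows;
  the identity rGamma z = pochhammer z i * rGamma (z + i) keeps all these shifts under one
  denominator, fixed in advance.\<close>

definition nbh :: "nat \<Rightarrow> (nat \<Rightarrow> complex) \<Rightarrow> (nat \<Rightarrow> complex) filter" where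
  "nbh m p = (INF r\<in>{0<..}. principal (polydisc m p r))"

lemma polydisc_mono: "r \<le> r' \<Longrightarrow> polydisc m p r \<subseteq> polydisc m p r'"
  by (force simp: polydisc_def)

lemma centre_in_polydisc [simp]: "r > 0 \<Longrightarrow> p \<in> polydisc m p r"
  by (auto simp: polydisc_def)

lemma eventually_nbh: "eventually P (nbh m p) \<longleftrightarrow> (\<exists>r>0. \<forall>w\<in>polydisc m p r. P w)"
  unfolding nbh_def
proof (subst eventually_INF_base)
  show "\<exists>x\<in>{0<..}. principal (polydisc m p x) \<le> inf (principal (polydisc m p a)) (principal (polydisc m p b))"
    if "a \<in> {0<..}" "b \<in> {0<..}" for a b :: real
    using that polydisc_mono[of "min a b" a m p] polydisc_mono[of "min a b" b m p]
    by (intro bexI[of _ "min a b"]) auto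
qed (auto simp: eventually_principal)

lemma eventually_nbh_self: "eventually P (nbh m p) \<Longrightarrow> P p"
  by (auto simp: eventually_nbh)

lemma tendsto_coord_nbh: "i \<in> {1..m} \<Longrightarrow> ((\<lambda>w. w i) \<longlongrightarrow> p i) (nbh m p)"
  by (auto simp: tendsto_iff eventually_nbh dist_norm polydisc_def)

text \<open>A polydisc constrains finitely many coordinates, so the conditions can be combined one
  by one; coordinates beyond m stay arbitrary.\<close>

lemma filterlim_nbh:
  assumes "\<And>i. i \<in> {1..m} \<Longrightarrow> ((\<lambda>x. g x i) \<longlongrightarrow> p i) F"
  shows "filterlim g (nbh m p) F"
  unfolding nbh_def filterlim_INF filterlim_principal polydisc_def mem_Collect_eq
  using assms by (intro ballI eventually_ball_finite) (auto simp: tendsto_iff dist_norm)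

lemma eventually_polydisc_nbh:
  assumes "w \<in> polydisc m p r"
  shows "eventually (\<lambda>w'. w' \<in> polydisc m p r) (nbh m w)"
  unfolding polydisc_def mem_Collect_eq
proof (intro eventually_ball_finite ballI)
  fix i assume i: "i \<in> {1..m}"
  have "((\<lambda>w'. norm (w' i - p i)) \<longlongrightarrow> norm (w i - p i)) (nbh m w)"
    by (intro tendsto_intros tendsto_coord_nbh i)
  then show "\<forall>\<^sub>F w' in nbh m w. norm (w' i - p i) < r"
    by (rule order_tendstoD) (use assms i in \<open>auto simp: polydisc_def\<close>)
qed auto

text \<open>Caratheodory's form of differentiability, in which the product and chain rules are immediate.\<close>

definition caratheodory_at :: "nat \<Rightarrow> ((nat \<Rightarrow> complex) \<Rightarrow> complex) \<Rightarrow> (nat \<Rightarrow> complex) \<Rightarrow> bool" where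
  "caratheodory_at m f z \<longleftrightarrow> (\<exists>\<phi>. (\<forall>i\<in>{1..m}. (\<phi> i \<longlongrightarrow> \<phi> i z) (nbh m z)) \<and>
     (\<forall>\<^sub>F w in nbh m z. f w = f z + (\<Sum>i=1..m. \<phi> i w * (w i - z i))))"

lemma caratheodory_imp_differentiable:
  assumes "caratheodory_at m f z"
  shows "complex_differentiable_at m f z"
proof -
  from assms obtain \<phi> where \<phi>: "\<forall>i\<in>{1..m}. (\<phi> i \<longlongrightarrow> \<phi> i z) (nbh m z)"
    and f: "\<forall>\<^sub>F w in nbh m z. f w = f z + (\<Sum>i=1..m. \<phi> i w * (w i - z i))"
    unfolding caratheodory_at_def by blast
  show ?thesis
    unfolding complex_differentiable_at_def
  proof (intro exI[of _ "\<lambda>i. \<phi> i z"] allI impI)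
    fix e :: real assume "e > 0"
    then have "\<forall>\<^sub>F w in nbh m z. \<forall>i\<in>{1..m}. norm (\<phi> i w - \<phi> i z) < e"
      using \<phi> by (intro eventually_ball_finite) (auto simp: tendsto_iff dist_norm)
    with f have "\<forall>\<^sub>F w in nbh m z. norm (f w - f z - (\<Sum>i=1..m. \<phi> i z * (w i - z i)))
        \<le> e * (\<Sum>i=1..m. norm (w i - z i))"
    proof eventually_elim
      case (elim w)
      have "f w - f z - (\<Sum>i=1..m. \<phi> i z * (w i - z i)) = (\<Sum>i=1..m. (\<phi> i w - \<phi> i z) * (w i - z i))"
        unfolding left_diff_distrib[of "\<phi> _ _"] sum_subtractf using elim(1) by simp
      also have "norm \<dots> \<le> (\<Sum>i=1..m. e * norm (w i - z i))"
        using elim(2) by (intro sum_norm_le) (simp add: norm_mult mult_right_mono less_imp_le)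
      finally show ?case by (simp add: sum_distrib_left)
    qed
    then show "\<exists>\<delta>>0. \<forall>w\<in>polydisc m z \<delta>. norm (f w - f z - (\<Sum>i=1..m. \<phi> i z * (w i - z i)))
        \<le> e * (\<Sum>i=1..m. norm (w i - z i))"
      by (simp add: eventually_nbh)
  qed
qed

text \<open>The error E of the linear approximation is distributed over the coordinates with weights
  \<open>cnj (sgn (w i - z i)) / S w\<close>: multiplied by the increments these weights sum to 1,
  since the conjugate sign of x times x is its modulus. Continuity of the resulting slopes is the
  statement that E / S tends to 0.\<close>

lemma differentiable_imp_caratheodory:
  assumes "complex_differentiable_at m f z"
  shows "caratheodory_at m f z"
proof -
  from assms obtain a where a: "\<And>\<epsilon>. \<epsilon> > 0 \<Longrightarrow> \<forall>\<^sub>F w in nbh m z.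
      norm (f w - f z - (\<Sum>i=1..m. a i * (w i - z i))) \<le> \<epsilon> * (\<Sum>i=1..m. norm (w i - z i))"
    unfolding complex_differentiable_at_def eventually_nbh by metis
  define E where "E w = f w - f z - (\<Sum>i=1..m. a i * (w i - z i))" for w
  define S where "S w = (\<Sum>i=1..m. norm (w i - z i))" for w
  define \<phi> where "\<phi> i w = a i + E w * cnj (sgn (w i - z i)) / of_real (S w)" for i w
  have Ez: "E z = 0" by (simp add: E_def)
  have S0: "S w \<ge> 0" for w by (auto simp: S_def intro: sum_nonneg)
  have lim: "(\<phi> i \<longlongrightarrow> \<phi> i z) (nbh m z)" for i
  proof (rule tendstoI)
    fix e :: real assume e: "e > 0"
    have "\<forall>\<^sub>F w in nbh m z. norm (E w) \<le> e/2 * S w"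
      using a[of "e/2"] e by (simp add: E_def S_def)
    then show "\<forall>\<^sub>F w in nbh m z. dist (\<phi> i w) (\<phi> i z) < e"
    proof eventually_elim
      case (elim w)
      have "dist (\<phi> i w) (\<phi> i z) = norm (E w * cnj (sgn (w i - z i)) / of_real (S w))"
        by (simp add: \<phi>_def Ez dist_norm)
      also have "\<dots> = norm (E w) * norm (sgn (w i - z i)) / S w"
        using S0[of w] by (simp add: norm_mult norm_divide)
      also have "\<dots> \<le> norm (E w) * 1 / S w"
        using S0[of w] by (intro divide_right_mono mult_left_mono) (auto simp: norm_sgn)
      also have "\<dots> \<le> e / 2"
        using elim S0[of w] e by (cases "S w = 0") (auto simp: field_simps)
      finally show ?case using e by simp
    qed
  qed
  have "\<forall>\<^sub>F w in nbh m z. norm (E w) \<le> 1 * S w"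
    using a[of 1] by (simp add: E_def S_def)
  then have "\<forall>\<^sub>F w in nbh m z. f w = f z + (\<Sum>i=1..m. \<phi> i w * (w i - z i))"
  proof eventually_elim
    case (elim w)
    have sg: "cnj (sgn x) * x = of_real (norm x)" for x :: complex
      using complex_norm_square[of x]
      by (cases "x = 0") (auto simp: sgn_div_norm scaleR_conv_of_real divide_simps power2_eq_square mult_ac)
    have "(\<Sum>i=1..m. \<phi> i w * (w i - z i)) = (\<Sum>i=1..m. a i * (w i - z i)) +
        E w / of_real (S w) * (\<Sum>i=1..m. cnj (sgn (w i - z i)) * (w i - z i))"
      unfolding \<phi>_def distrib_right sum.distrib sum_distrib_left by (simp add: mult_ac)
    also have "(\<Sum>i=1..m. cnj (sgn (w i - z i)) * (w i - z i)) = of_real (S w)"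
      by (simp add: sg S_def)
    also have "E w / of_real (S w) * of_real (S w) = E w"
      \<comment> \<open>For S w = 0 the quotient is 0 by convention, and the bound of E w by S w
        gives E w = 0 as well.\<close>
      using elim by (cases "S w = 0") auto
    finally show ?case by (simp add: E_def)
  qed
  with lim show ?thesis unfolding caratheodory_at_def by blast
qed

lemma differentiable_iff_caratheodory: "complex_differentiable_at m f z \<longleftrightarrow> caratheodory_at m f z"
  using caratheodory_imp_differentiable differentiable_imp_caratheodory by blast

lemma cd_E:
  assumes "complex_differentiable_at m f z"
  obtains \<phi> where "\<And>i. i\<in>{1..m} \<Longrightarrow> (\<phi> i \<longlongrightarrow> \<phi> i z) (nbh m z)"
    "\<forall>\<^sub>F w in nbh m z. f w = f z + (\<Sum>i=1..m. \<phi> i w * (w i - z i))"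
  using assms unfolding differentiable_iff_caratheodory caratheodory_at_def by blast

lemma cd_I:
  assumes "\<And>i. i\<in>{1..m} \<Longrightarrow> (\<phi> i \<longlongrightarrow> \<phi> i z) (nbh m z)"
    "\<forall>\<^sub>F w in nbh m z. f w = f z + (\<Sum>i=1..m. \<phi> i w * (w i - z i))"
  shows "complex_differentiable_at m f z"
  using assms unfolding differentiable_iff_caratheodory caratheodory_at_def by blast

lemma cd_tendsto:
  assumes "complex_differentiable_at m f z"
  shows "(f \<longlongrightarrow> f z) (nbh m z)"
proof -
  obtain \<phi> where \<phi>: "\<And>i. i\<in>{1..m} \<Longrightarrow> (\<phi> i \<longlongrightarrow> \<phi> i z) (nbh m z)"
    "\<forall>\<^sub>F w in nbh m z. f w = f z + (\<Sum>i=1..m. \<phi> i w * (w i - z i))"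
    by (rule cd_E[OF assms]) blast
  have "((\<lambda>w. f z + (\<Sum>i=1..m. \<phi> i w * (w i - z i))) \<longlongrightarrow> f z + (\<Sum>i=1..m. \<phi> i z * (z i - z i))) (nbh m z)"
    by (intro tendsto_intros \<phi>(1) tendsto_coord_nbh)
  then show ?thesis
    using \<phi>(2) by (subst tendsto_cong[OF \<phi>(2)]) simp
qed

lemma cd_cong:
  assumes "complex_differentiable_at m f z" "\<forall>\<^sub>F w in nbh m z. f w = g w"
  shows "complex_differentiable_at m g z"
proof -
  obtain \<phi> where \<phi>: "\<And>i. i\<in>{1..m} \<Longrightarrow> (\<phi> i \<longlongrightarrow> \<phi> i z) (nbh m z)"
    "\<forall>\<^sub>F w in nbh m z. f w = f z + (\<Sum>i=1..m. \<phi> i w * (w i - z i))"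
    by (rule cd_E[OF assms(1)]) blast
  have "f z = g z" using eventually_nbh_self[OF assms(2)] .
  have "\<forall>\<^sub>F w in nbh m z. g w = g z + (\<Sum>i=1..m. \<phi> i w * (w i - z i))"
    using \<phi>(2) assms(2) by eventually_elim (use \<open>f z = g z\<close> in simp)
  with \<phi>(1) show ?thesis by (rule cd_I)
qed

section \<open>Closure rules for complex differentiability\<close>

named_theorems cd_intros

lemma cd_const [cd_intros]: "complex_differentiable_at m (\<lambda>_. c) z"
  by (rule cd_I[of _ "\<lambda>_ _. 0"]) auto

lemma cd_coord [cd_intros]: "i \<in> {1..m} \<Longrightarrow> complex_differentiable_at m (\<lambda>w. w i) z"
proof (rule cd_I[of _ "\<lambda>k _. if k = i then 1 else 0"])
  assume i: "i \<in> {1..m}"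
  have "(\<Sum>k=1..m. (if k = i then 1 else 0) * (w k - z k)) = w i - z i" for w
    using sum.delta[of "{1..m}" i "\<lambda>k. w k - z k"] i
    by (simp add: if_distrib[of "\<lambda>x. x * _"] cong: if_cong)
  then show "\<forall>\<^sub>F w in nbh m z. w i = z i + (\<Sum>k=1..m. (if k = i then 1 else 0) * (w k - z k))"
    by simp
qed auto

lemma cd_add [cd_intros]:
  assumes "complex_differentiable_at m f z" "complex_differentiable_at m g z"
  shows "complex_differentiable_at m (\<lambda>w. f w + g w) z"
proof -
  obtain \<phi> where \<phi>: "\<And>i. i\<in>{1..m} \<Longrightarrow> (\<phi> i \<longlongrightarrow> \<phi> i z) (nbh m z)"
    "\<forall>\<^sub>F w in nbh m z. f w = f z + (\<Sum>i=1..m. \<phi> i w * (w i - z i))"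
    by (rule cd_E[OF assms(1)]) blast
  obtain \<psi> where \<psi>: "\<And>i. i\<in>{1..m} \<Longrightarrow> (\<psi> i \<longlongrightarrow> \<psi> i z) (nbh m z)"
    "\<forall>\<^sub>F w in nbh m z. g w = g z + (\<Sum>i=1..m. \<psi> i w * (w i - z i))"
    by (rule cd_E[OF assms(2)]) blast
  show ?thesis
  proof (rule cd_I[of _ "\<lambda>i w. \<phi> i w + \<psi> i w"])
    show "\<forall>\<^sub>F w in nbh m z. f w + g w = f z + g z + (\<Sum>i=1..m. (\<phi> i w + \<psi> i w) * (w i - z i))"
      using \<phi>(2) \<psi>(2)
    proof eventually_elim
      case (elim w)
      have "(\<Sum>i=1..m. (\<phi> i w + \<psi> i w) * (w i - z i)) =
          (\<Sum>i=1..m. \<phi> i w * (w i - z i)) + (\<Sum>i=1..m. \<psi> i w * (w i - z i))"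
        by (simp add: distrib_right sum.distrib)
      then show ?case using elim by simp
    qed
  qed (intro tendsto_intros \<phi> \<psi>)
qed

lemma cd_mult [cd_intros]:
  assumes "complex_differentiable_at m f z" "complex_differentiable_at m g z"
  shows "complex_differentiable_at m (\<lambda>w. f w * g w) z"
proof -
  obtain \<phi> where \<phi>: "\<And>i. i\<in>{1..m} \<Longrightarrow> (\<phi> i \<longlongrightarrow> \<phi> i z) (nbh m z)"
    "\<forall>\<^sub>F w in nbh m z. f w = f z + (\<Sum>i=1..m. \<phi> i w * (w i - z i))"
    by (rule cd_E[OF assms(1)]) blast
  obtain \<psi> where \<psi>: "\<And>i. i\<in>{1..m} \<Longrightarrow> (\<psi> i \<longlongrightarrow> \<psi> i z) (nbh m z)"
    "\<forall>\<^sub>F w in nbh m z. g w = g z + (\<Sum>i=1..m. \<psi> i w * (w i - z i))"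
    by (rule cd_E[OF assms(2)]) blast
  show ?thesis
  proof (rule cd_I[of _ "\<lambda>i w. \<phi> i w * g w + f z * \<psi> i w"])
    show "\<forall>\<^sub>F w in nbh m z. f w * g w = f z * g z + (\<Sum>i=1..m. (\<phi> i w * g w + f z * \<psi> i w) * (w i - z i))"
      using \<phi>(2) \<psi>(2)
    proof eventually_elim
      case (elim w)
      have "(\<Sum>i=1..m. (\<phi> i w * g w + f z * \<psi> i w) * (w i - z i)) =
          (\<Sum>i=1..m. \<phi> i w * (w i - z i)) * g w + f z * (\<Sum>i=1..m. \<psi> i w * (w i - z i))"
        by (simp add: ring_distribs sum.distrib sum_distrib_left sum_distrib_right mult_ac)
      also have "\<dots> = (f w - f z) * g w + f z * (g w - g z)"
        using elim by simp
      finally show ?case by (simp add: algebra_simps)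
    qed
  qed (intro tendsto_intros \<phi> \<psi> cd_tendsto assms)
qed

lemma cd_compose:
  assumes "complex_differentiable_at m f z" "g field_differentiable at (f z)"
  shows "complex_differentiable_at m (\<lambda>w. g (f w)) z"
proof -
  obtain \<phi> where \<phi>: "\<And>i. i\<in>{1..m} \<Longrightarrow> (\<phi> i \<longlongrightarrow> \<phi> i z) (nbh m z)"
    "\<forall>\<^sub>F w in nbh m z. f w = f z + (\<Sum>i=1..m. \<phi> i w * (w i - z i))"
    by (rule cd_E[OF assms(1)]) blast
  obtain l where "DERIV g (f z) :> l"
    using assms(2) by (auto simp: field_differentiable_def)
  then obtain q where q: "\<And>y. g y - g (f z) = q y * (y - f z)" "isCont q (f z)"
    by (auto simp: CARAT_DERIV)
  have ql: "((\<lambda>w. q (f w)) \<longlongrightarrow> q (f z)) (nbh m z)"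
    using q(2) cd_tendsto[OF assms(1)] by (rule isCont_tendsto_compose)
  show ?thesis
  proof (rule cd_I[of _ "\<lambda>i w. q (f w) * \<phi> i w"])
    show "\<forall>\<^sub>F w in nbh m z. g (f w) = g (f z) + (\<Sum>i=1..m. (q (f w) * \<phi> i w) * (w i - z i))"
      using \<phi>(2)
    proof eventually_elim
      case (elim w)
      have "(\<Sum>i=1..m. (q (f w) * \<phi> i w) * (w i - z i)) = q (f w) * (f w - f z)"
        using elim by (metis (no_types, lifting) add_diff_cancel_left' mult.assoc sum.cong sum_distrib_left)
      then show ?case using q(1)[of "f w"] by (metis add.commute diff_add_cancel)
    qed
  qed (intro tendsto_intros \<phi> ql)
qed

lemma cd_minus [cd_intros]:
  "complex_differentiable_at m f z \<Longrightarrow> complex_differentiable_at m (\<lambda>w. - f w) z"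
  using cd_mult[OF cd_const[of m "-1" z], of f] by simp

lemma cd_diff [cd_intros]:
  "complex_differentiable_at m f z \<Longrightarrow> complex_differentiable_at m g z \<Longrightarrow>
     complex_differentiable_at m (\<lambda>w. f w - g w) z"
  using cd_add[OF _ cd_minus, of m f z g] by simp

lemma cd_divide:
  "complex_differentiable_at m f z \<Longrightarrow> complex_differentiable_at m g z \<Longrightarrow> g z \<noteq> 0 \<Longrightarrow>
     complex_differentiable_at m (\<lambda>w. f w / g w) z"
  unfolding divide_inverse
  by (intro cd_mult cd_compose[of m g z inverse]) (auto simp: field_differentiable_def intro: DERIV_inverse)

lemma cd_sum [cd_intros]:
  "(\<And>i. i \<in> I \<Longrightarrow> complex_differentiable_at m (f i) z) \<Longrightarrow>
     complex_differentiable_at m (\<lambda>w. \<Sum>i\<in>I. f i w) z"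
  by (induction I rule: infinite_finite_induct) (simp_all add: cd_const cd_add)

lemma cd_prod [cd_intros]:
  "(\<And>i. i \<in> I \<Longrightarrow> complex_differentiable_at m (f i) z) \<Longrightarrow>
     complex_differentiable_at m (\<lambda>w. \<Prod>i\<in>I. f i w) z"
  by (induction I rule: infinite_finite_induct) (simp_all add: cd_const cd_mult)

lemma cd_entire:
  assumes "complex_differentiable_at m f z" "g holomorphic_on UNIV"
  shows "complex_differentiable_at m (\<lambda>w. g (f w)) z"
  using assms(2) by (intro cd_compose[OF assms(1), of g]) (simp add: holomorphic_on_def)

text \<open>Reduces questions in several variables to one: along a complex line the difference
  quotient is the sum of the Caratheodory slopes times the direction, which is continuous.\<close>

lemma field_differentiable_line:
  assumes "complex_differentiable_at m f (\<lambda>i. p i + \<tau> * v i)"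
  shows "(\<lambda>t. f (\<lambda>i. p i + t * v i)) field_differentiable at \<tau>"
proof -
  define q where "q t = (\<lambda>i. p i + t * v i)" for t
  have "complex_differentiable_at m f (q \<tau>)"
    using assms by (simp add: q_def)
  then obtain \<phi> where \<phi>: "\<And>i. i\<in>{1..m} \<Longrightarrow> (\<phi> i \<longlongrightarrow> \<phi> i (q \<tau>)) (nbh m (q \<tau>))"
    "\<forall>\<^sub>F w in nbh m (q \<tau>). f w = f (q \<tau>) + (\<Sum>i=1..m. \<phi> i w * (w i - q \<tau> i))"
    by (rule cd_E) blast
  have q: "filterlim q (nbh m (q \<tau>)) (at \<tau>)"
    by (rule filterlim_nbh) (auto simp: q_def intro!: tendsto_eq_intros)
  have "\<forall>\<^sub>F t in at \<tau>. f (q t) = f (q \<tau>) + (\<Sum>i=1..m. \<phi> i (q t) * (q t i - q \<tau> i))"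
    using \<phi>(2) q by (rule eventually_compose_filterlim)
  moreover have "\<forall>\<^sub>F t in at \<tau>. t \<noteq> \<tau>"
    by (simp add: eventually_at_filter)
  ultimately have ev: "\<forall>\<^sub>F t in at \<tau>. (\<Sum>i=1..m. \<phi> i (q t) * v i) = (f (q t) - f (q \<tau>)) / (t - \<tau>)"
  proof eventually_elim
    case (elim t)
    have "(\<Sum>i=1..m. \<phi> i (q t) * (q t i - q \<tau> i)) = (\<Sum>i=1..m. \<phi> i (q t) * v i) * (t - \<tau>)"
      unfolding sum_distrib_right by (intro sum.cong) (auto simp: q_def algebra_simps)
    then show ?case using elim by (simp add: field_simps)
  qed
  have "((\<lambda>t. \<Sum>i=1..m. \<phi> i (q t) * v i) \<longlongrightarrow> (\<Sum>i=1..m. \<phi> i (q \<tau>) * v i)) (at \<tau>)"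
    by (intro tendsto_intros filterlim_compose[OF \<phi>(1) q])
  then have "((\<lambda>t. (f (q t) - f (q \<tau>)) / (t - \<tau>)) \<longlongrightarrow> (\<Sum>i=1..m. \<phi> i (q \<tau>) * v i)) (at \<tau>)"
    using ev by (rule Lim_transform_eventually)
  then show ?thesis
    unfolding field_differentiable_def has_field_derivative_iff q_def by blast
qed

section \<open>Separate holomorphy\<close>

text \<open>Circles of radius r about points of the smaller ball stay in the larger one, so Cauchy's
  inequality bounds the derivative by M / r.\<close>

lemma holomorphic_Lipschitz_bound:
  assumes "g holomorphic_on ball p (2 * r)" "\<And>x. x \<in> ball p (2 * r) \<Longrightarrow> norm (g x) \<le> M" "r > 0"
    and "u \<in> ball p r" "v \<in> ball p r"
  shows "norm (g u - g v) \<le> M / r * norm (u - v)"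
proof (rule field_differentiable_bound[OF convex_ball _ _ assms(4,5)])
  fix x assume x: "x \<in> ball p r"
  have sub: "cball x r \<subseteq> ball p (2 * r)"
  proof
    fix y assume "y \<in> cball x r"
    then show "y \<in> ball p (2 * r)" using x dist_triangle[of p y x] by auto
  qed
  have "x \<in> ball p (2 * r)" using x assms(3) by auto
  then show "(g has_field_derivative deriv g x) (at x within ball p r)"
    using assms(1) by (meson holomorphic_derivI has_field_derivative_at_within open_ball)
  have "norm ((deriv ^^ 1) g x) \<le> fact 1 * M / r ^ 1"
  proof (rule Cauchy_inequality)
    show "g holomorphic_on ball x r" "continuous_on (cball x r) g"
      using assms(1) sub ball_subset_cball holomorphic_on_imp_continuous_on
      by (blast intro: holomorphic_on_subset continuous_on_subset)+
    show "norm (g y) \<le> M" if "norm (x - y) = r" for y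
      using that sub by (intro assms(2)) (auto simp: dist_norm subset_iff)
  qed (use assms in auto)
  then show "norm (deriv g x) \<le> M / r" by simp
qed

text \<open>Osgood's lemma. It lets the holomorphy of the remainder series be checked one variable at a time.\<close>

lemma separately_holomorphic_imp_differentiable:
  assumes dep: "\<And>w w'. (\<And>i. i \<in> {1..m} \<Longrightarrow> w i = w' i) \<Longrightarrow> f w = f w'"
    and r: "r > 0"
    and bd: "\<And>w. w \<in> polydisc m p (2 * r) \<Longrightarrow> norm (f w) \<le> M"
    and sep: "\<And>w i. w \<in> polydisc m p (2 * r) \<Longrightarrow> i \<in> {1..m} \<Longrightarrow>
        (\<lambda>u. f (w(i := u))) holomorphic_on ball (p i) (2 * r)"
  shows "complex_differentiable_at m f p"
proof -
  have pin: "p \<in> polydisc m p (2 * r)" using r by simp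
  have M: "M \<ge> 0" using bd[OF pin] norm_ge_zero order_trans by blast
  have upd: "w(i := u) \<in> polydisc m p (2 * r)" if "w \<in> polydisc m p (2 * r)" "u \<in> ball (p i) (2 * r)" for w i u
    using that by (auto simp: polydisc_def dist_norm norm_minus_commute)
  define mix where "mix j w = (\<lambda>k. if k \<le> j then w k else p k)" for j :: nat and w :: "nat \<Rightarrow> complex"
  define S where "S w = (\<Sum>i=1..m. norm (w i - p i))" for w
  have mixin: "mix j w \<in> polydisc m p (2 * r)" if "w \<in> polydisc m p r" for j w
    using that r by (force simp: polydisc_def mix_def)
  \<comment> \<open>Coordinate i has the value u on both sides; the coordinates 1, ..., j are moved
    from p to w one at a time, each move costing at most M / r times its length.\<close>
  have step: "norm (f ((mix j w)(i := u)) - f (p(i := u))) \<le> M / r * (\<Sum>k=1..j. norm (w k - p k))"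
    if w: "w \<in> polydisc m p r" and u: "u \<in> ball (p i) (2 * r)" and i: "i \<in> {1..m}" and "j < i" for w u i j
    using \<open>j < i\<close>
  proof (induction j)
    case 0
    have "f ((mix 0 w)(i := u)) = f (p(i := u))"
      by (rule dep) (auto simp: mix_def)
    then show ?case by (simp del: fun_upd_apply)
  next
    case (Suc j)
    define q where "q = (mix j w)(i := u)"
    have q: "q \<in> polydisc m p (2 * r)" unfolding q_def by (intro upd mixin w u)
    have Sj: "Suc j \<in> {1..m}" using Suc.prems i by auto
    have 1: "(mix (Suc j) w)(i := u) = q(Suc j := w (Suc j))" "q = q(Suc j := p (Suc j))"
      using Suc.prems by (auto simp: q_def mix_def fun_eq_iff)
    have "norm (f (q(Suc j := w (Suc j))) - f (q(Suc j := p (Suc j)))) \<le> M / r * norm (w (Suc j) - p (Suc j))"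
      by (rule holomorphic_Lipschitz_bound[OF sep[OF q Sj] _ r]) 
         (use w Sj r in \<open>auto intro!: bd upd q simp: polydisc_def dist_norm norm_minus_commute\<close>)
    then have "norm (f ((mix (Suc j) w)(i := u)) - f q) \<le> M / r * norm (w (Suc j) - p (Suc j))"
      using 1 by simp
    moreover have "norm (f q - f (p(i := u))) \<le> M / r * (\<Sum>k=1..j. norm (w k - p k))"
      using Suc.IH Suc.prems unfolding q_def by (simp del: fun_upd_apply)
    ultimately show ?case
      using norm_triangle_ineq[of "f ((mix (Suc j) w)(i := u)) - f q" "f q - f (p(i := u))"]
      by (simp add: ring_distribs del: fun_upd_apply)
  qed
  define a where "a i = deriv (\<lambda>u. f (p(i := u))) (p i)" for i
  have main: "norm (f w - f p - (\<Sum>i=1..m. a i * (w i - p i))) \<le> (\<Sum>i=1..m. (M / r * S w) / r * norm (w i - p i)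
      + norm (f (p(i := w i)) - f p - a i * (w i - p i)))" if w: "w \<in> polydisc m p r" for w
  proof -
    have "f w - f p = f (mix m w) - f (mix 0 w)"
      by (intro arg_cong2[of _ _ _ _ "(-)"] dep) (auto simp: mix_def)
    also have "\<dots> = (\<Sum>i=1..m. f (mix i w) - f (mix (i-1) w))"
      using sum_telescope''[of 0 m "\<lambda>i. f (mix i w)"] by simp
    finally have eq: "f w - f p - (\<Sum>i=1..m. a i * (w i - p i)) =
      (\<Sum>i=1..m. (f (mix i w) - f (mix (i-1) w) - (f (p(i := w i)) - f p)) + (f (p(i := w i)) - f p - a i * (w i - p i)))"
      by (simp add: sum_subtractf [symmetric] algebra_simps)
    show ?thesis unfolding eq
    proof (intro sum_norm_le order_trans[OF norm_triangle_ineq] add_right_mono)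
      fix i assume i: "i \<in> {1..m}"
      \<comment> \<open>D compares the change in coordinate i at the mixed base point with the
        change at p. It is itself bounded by M / r * S w, so a second use of the Lipschitz bound
        makes its increment of second order.\<close>
      define D where "D u = f ((mix (i-1) w)(i := u)) - f (p(i := u))" for u
      have Dw: "f (mix i w) - f (mix (i-1) w) - (f (p(i := w i)) - f p) = D (w i) - D (p i)"
      proof -
        have "(mix (i-1) w)(i := w i) = mix i w" "(mix (i-1) w)(i := p i) = mix (i-1) w"
          using i by (auto simp: mix_def fun_eq_iff)
        then show ?thesis by (simp add: D_def)
      qed
      have "norm (D (w i) - D (p i)) \<le> (M / r * S w) / r * norm (w i - p i)"
      proof (rule holomorphic_Lipschitz_bound)
        show "D holomorphic_on ball (p i) (2 * r)"
          unfolding D_def by (intro holomorphic_intros sep i mixin w pin)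
        show "norm (D u) \<le> M / r * S w" if "u \<in> ball (p i) (2 * r)" for u
        proof -
          have "norm (D u) \<le> M / r * (\<Sum>k=1..i-1. norm (w k - p k))"
            unfolding D_def using i by (intro step w that) auto
          also have "\<dots> \<le> M / r * S w"
            unfolding S_def using i M r by (intro mult_left_mono sum_mono2) auto
          finally show ?thesis .
        qed
      qed (use w i r in \<open>auto simp: polydisc_def dist_norm norm_minus_commute\<close>)
      then show "norm (f (mix i w) - f (mix (i-1) w) - (f (p(i := w i)) - f p)) \<le> (M / r * S w) / r * norm (w i - p i)"
        unfolding Dw .
    qed
  qed
  show ?thesis unfolding complex_differentiable_at_def
  proof (intro exI[of _ a] allI impI)
    fix e :: real assume e: "e > 0"
    have "\<forall>\<^sub>F w in nbh m p. w \<in> polydisc m p r" using r by (auto simp: eventually_nbh)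
    moreover have "\<forall>\<^sub>F w in nbh m p. (M / r * S w) / r < e / 2"
    proof -
      have "((\<lambda>w. (M / r * S w) / r) \<longlongrightarrow> (M / r * S p) / r) (nbh m p)"
        unfolding S_def using r by (intro tendsto_intros tendsto_coord_nbh) auto
      then show ?thesis by (rule order_tendstoD) (use e in \<open>simp add: S_def\<close>)
    qed
    moreover have "\<forall>\<^sub>F w in nbh m p. \<forall>i\<in>{1..m}. norm (f (p(i := w i)) - f p - a i * (w i - p i)) \<le> e / 2 * norm (w i - p i)"
    proof (intro eventually_ball_finite ballI)
      fix i assume i: "i \<in> {1..m}"
      have "((\<lambda>u. f (p(i := u))) has_field_derivative a i) (at (p i))"
        unfolding a_def using r by (intro holomorphic_derivI[OF sep[OF pin i]]) auto
      then have "((\<lambda>u. f (p(i := u))) has_derivative (*) (a i)) (at (p i))"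
        by (simp add: has_field_derivative_def)
      then obtain \<delta> where \<delta>: "\<delta> > 0" "\<And>u. norm (u - p i) < \<delta> \<Longrightarrow>
          norm (f (p(i := u)) - f (p(i := p i)) - a i * (u - p i)) \<le> e / 2 * norm (u - p i)"
        using e unfolding has_derivative_at_alt by (metis half_gt_zero)
      show "\<forall>\<^sub>F w in nbh m p. norm (f (p(i := w i)) - f p - a i * (w i - p i)) \<le> e / 2 * norm (w i - p i)"
        unfolding eventually_nbh using \<delta> i by (intro exI[of _ \<delta>]) (auto simp: polydisc_def)
    qed simp
    ultimately have "\<forall>\<^sub>F w in nbh m p. norm (f w - f p - (\<Sum>i=1..m. a i * (w i - p i))) \<le> e * (\<Sum>i=1..m. norm (w i - p i))"
    proof eventually_elim
      case (elim w)
      note main[OF elim(1)]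
      also have "(\<Sum>i=1..m. (M / r * S w) / r * norm (w i - p i) + norm (f (p(i := w i)) - f p - a i * (w i - p i)))
          \<le> (\<Sum>i=1..m. e / 2 * norm (w i - p i) + e / 2 * norm (w i - p i))"
        using elim(2,3) by (intro sum_mono add_mono mult_right_mono) auto
      also have "\<dots> = e * (\<Sum>i=1..m. norm (w i - p i))"
        by (simp add: sum_distrib_left)
      finally show ?case .
    qed
    then show "\<exists>\<delta>>0. \<forall>w\<in>polydisc m p \<delta>. norm (f w - f p - (\<Sum>i=1..m. a i * (w i - p i)))
        \<le> e * (\<Sum>i=1..m. norm (w i - p i))"
      by (simp add: eventually_nbh)
  qed
qed

section \<open>Identity theorems\<close>

text \<open>The complex line through q and z meets the polydisc in an open convex set containing the
  parameters 0 and 1; the one-variable identity theorem on this set carries the zero from q to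
  z.\<close>

lemma polydisc_identity:
  assumes f: "holomorphic_on_polydisc m f p r" and q: "q \<in> polydisc m p r"
    and zero: "\<forall>\<^sub>F w in nbh m q. f w = 0" and z: "z \<in> polydisc m p r"
  shows "f z = 0"
proof -
  define L where "L t = (\<lambda>i. q i + t * (z i - q i))" for t :: complex
  define S where "S = {t. L t \<in> polydisc m p r}"
  have S: "S = (\<Inter>i\<in>{1..m}. (\<lambda>t. t * (z i - q i)) -` ball (p i - q i) r)"
    by (auto simp: S_def L_def polydisc_def dist_norm algebra_simps norm_minus_commute)
  have lin: "linear (\<lambda>t. t * c)" for c :: complex
    by (intro linearI) (auto simp: algebra_simps)
  have "convex S"
    unfolding S by (intro convex_INT convex_linear_vimage lin) auto
  have "open S"
    unfolding S by (intro open_INT ballI finite_atLeastAtMost open_vimage continuous_intros) auto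
  have hol: "(\<lambda>t. f (L t)) holomorphic_on S"
    unfolding holomorphic_on_def
  proof
    fix t assume "t \<in> S"
    then have "complex_differentiable_at m f (L t)"
      using f by (auto simp: S_def holomorphic_on_polydisc_def)
    then show "(\<lambda>t. f (L t)) field_differentiable at t within S"
      using field_differentiable_line[of m f q t "\<lambda>i. z i - q i"]
      by (simp add: L_def field_differentiable_at_within)
  qed
  have S01: "0 \<in> S" "1 \<in> S" using q z by (auto simp: S_def L_def)
  have "filterlim L (nbh m (L 0)) (nhds 0)"
    unfolding L_def by (rule filterlim_nbh) (auto intro!: tendsto_eq_intros filterlim_ident)
  then have "\<forall>\<^sub>F t in nhds 0. f (L t) = 0"
    using eventually_compose_filterlim[OF zero, of L "nhds 0"] by (simp add: L_def)
  moreover have "\<forall>\<^sub>F t in nhds 0. t \<in> S"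
    using S01 \<open>open S\<close> by (auto simp: eventually_nhds)
  ultimately have "\<forall>\<^sub>F t in nhds 0. t \<in> S \<and> f (L t) = 0"
    by eventually_elim auto
  then obtain U where U: "open U" "0 \<in> U" "\<forall>t\<in>U. t \<in> S \<and> f (L t) = 0"
    by (auto simp: eventually_nhds)
  have "f (L 1) = 0"
  proof (rule analytic_continuation[OF hol \<open>open S\<close> convex_connected[OF \<open>convex S\<close>]])
    show "U \<subseteq> S" "0 \<in> S" "0 islimpt U" "1 \<in> S"
      using U S01 interior_limit_point[of 0 U] by (auto simp: interior_open)
  qed (use U in auto)
  then show ?thesis by (simp add: L_def)
qed

text \<open>Otherwise f would vanish near q and hence on the whole polydisc. This is what permits
  moving off the zero set of a denominator without losing a property that holds near q.\<close>

lemma polydisc_nonzero_dense: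
  assumes f: "holomorphic_on_polydisc m f p r" and "z \<in> polydisc m p r" "f z \<noteq> 0"
    and q: "q \<in> polydisc m p r" "\<forall>\<^sub>F w in nbh m q. P w"
  shows "\<exists>w\<in>polydisc m p r. P w \<and> f w \<noteq> 0"
proof (rule ccontr)
  assume neg: "\<not> ?thesis"
  have "\<forall>\<^sub>F w in nbh m q. f w = 0"
    using q(2) eventually_polydisc_nbh[OF q(1)] by eventually_elim (use neg in auto)
  from polydisc_identity[OF f q(1) this assms(2)] assms(3) show False by simp
qed

lemma eventually_eventually_nbh:
  "\<forall>\<^sub>F w in nbh m p. P w \<Longrightarrow> \<forall>\<^sub>F w in nbh m p. \<forall>\<^sub>F v in nbh m w. P v"
proof -
  assume "\<forall>\<^sub>F w in nbh m p. P w"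
  then obtain r where "r > 0" and r: "\<forall>w\<in>polydisc m p r. P w" by (auto simp: eventually_nbh)
  then have "\<forall>w\<in>polydisc m p r. \<forall>\<^sub>F v in nbh m w. P v"
    by (auto intro: eventually_mono[OF eventually_polydisc_nbh])
  then show ?thesis using \<open>r > 0\<close> by (auto simp: eventually_nbh)
qed

lemma holomorphic_on_polydisc_subset:
  "holomorphic_on_polydisc m f p r \<Longrightarrow> r' \<le> r \<Longrightarrow> holomorphic_on_polydisc m f p r'"
  using polydisc_mono[of r' r m p] by (auto simp: holomorphic_on_polydisc_def)

lemma holomorphic_on_polydisc_nonzero:
  assumes "holomorphic_on_polydisc m f p r" "f z \<noteq> 0" "z \<in> polydisc m p r"
  shows "\<forall>\<^sub>F w in nbh m z. f w \<noteq> 0"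
  using assms by (intro tendsto_imp_eventually_ne[OF cd_tendsto]) (auto simp: holomorphic_on_polydisc_def)

text \<open>Clopen argument along the segment from \<open>p0\<close> to \<open>s\<close>: the closure of the interior of the set where the
  two functions agree is open, because of the local quotient representations.\<close>

lemma meromorphic_identity:
  assumes f1: "meromorphic_Cm m f1" and f2: "meromorphic_Cm m f2"
    and p0: "\<forall>\<^sub>F w in nbh m p0. f1 w = f2 w"
    and s: "regular_at m f1 s" "regular_at m f2 s"
  shows "f1 s = f2 s"
proof -
  define K where "K z \<longleftrightarrow> (\<forall>r>0. \<exists>q\<in>polydisc m z r. \<forall>\<^sub>F w in nbh m q. f1 w = f2 w)" for z
  have K_open: "\<forall>\<^sub>F z' in nbh m z. K z'" if "K z" for z
  proof -
    obtain r1 g1 h1 where 1: "r1 > 0" "holomorphic_on_polydisc m g1 z r1" "holomorphic_on_polydisc m h1 z r1"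
      "\<exists>w\<in>polydisc m z r1. h1 w \<noteq> 0" "\<And>w. w\<in>polydisc m z r1 \<Longrightarrow> h1 w \<noteq> 0 \<Longrightarrow> f1 w = g1 w / h1 w"
      using f1 unfolding meromorphic_Cm_def by metis
    obtain r2 g2 h2 where 2: "r2 > 0" "holomorphic_on_polydisc m g2 z r2" "holomorphic_on_polydisc m h2 z r2"
      "\<exists>w\<in>polydisc m z r2. h2 w \<noteq> 0" "\<And>w. w\<in>polydisc m z r2 \<Longrightarrow> h2 w \<noteq> 0 \<Longrightarrow> f2 w = g2 w / h2 w"
      using f2 unfolding meromorphic_Cm_def by metis
    define r where "r = min r1 r2"
    have r: "r > 0" "r \<le> r1" "r \<le> r2" using 1 2 by (auto simp: r_def)
    have hol: "holomorphic_on_polydisc m g1 z r" "holomorphic_on_polydisc m h1 z r"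
      "holomorphic_on_polydisc m g2 z r" "holomorphic_on_polydisc m h2 z r"
      using 1 2 r holomorphic_on_polydisc_subset by blast+
    have sub: "w \<in> polydisc m z r1" "w \<in> polydisc m z r2" if "w \<in> polydisc m z r" for w
      using that r polydisc_mono[of r r1] polydisc_mono[of r r2] by blast+
    \<comment> \<open>The zeros of h1 and h2 are avoided one after the other; the first nonvanishing
      persists nearby while the second denominator is treated.\<close>
    have dense: "\<exists>w\<in>polydisc m z r. P w \<and> h1 w \<noteq> 0 \<and> h2 w \<noteq> 0"
      if q: "q \<in> polydisc m z r" "\<forall>\<^sub>F w in nbh m q. P w" for q P
    proof -
      have "\<forall>\<^sub>F w in nbh m q. w \<in> polydisc m z r \<and> (\<forall>\<^sub>F v in nbh m w. P v)"
        using eventually_polydisc_nbh[OF q(1)] eventually_eventually_nbh[OF q(2)] by eventually_elim auto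
      from polydisc_nonzero_dense[OF 1(3) _ _ sub(1)[OF q(1)] this] 1(4) obtain w where
        w: "w \<in> polydisc m z r" "\<forall>\<^sub>F v in nbh m w. P v" "h1 w \<noteq> 0" by auto
      have "\<forall>\<^sub>F v in nbh m w. v \<in> polydisc m z r \<and> P v \<and> h1 v \<noteq> 0"
        using eventually_polydisc_nbh[OF w(1)] w(2) holomorphic_on_polydisc_nonzero[OF hol(2) w(3) w(1)]
        by eventually_elim auto
      from polydisc_nonzero_dense[OF 2(3) _ _ sub(2)[OF w(1)] this] 2(4) show ?thesis by auto
    qed
    have quot: "\<forall>\<^sub>F v in nbh m w. f1 v = g1 v / h1 v \<and> f2 v = g2 v / h2 v \<and> h1 v \<noteq> 0 \<and> h2 v \<noteq> 0"
      if "w \<in> polydisc m z r" "h1 w \<noteq> 0" "h2 w \<noteq> 0" for w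
      using eventually_polydisc_nbh[OF that(1)] holomorphic_on_polydisc_nonzero[OF hol(2) that(2,1)]
        holomorphic_on_polydisc_nonzero[OF hol(4) that(3,1)]
      by eventually_elim (use 1(5) 2(5) sub in auto)
    \<comment> \<open>The cross-multiplied difference is holomorphic on the whole polydisc, zeros of
      the denominators included, so the identity theorem applies to it rather than to f1 -
      f2.\<close>
    define u where "u w = g1 w * h2 w - g2 w * h1 w" for w
    have hu: "holomorphic_on_polydisc m u z r"
      using hol unfolding holomorphic_on_polydisc_def u_def by (auto intro!: cd_intros)
    obtain q where "q \<in> polydisc m z r" "\<forall>\<^sub>F w in nbh m q. f1 w = f2 w"
      using \<open>K z\<close> r unfolding K_def by blast
    from dense[OF this(1) eventually_eventually_nbh[OF this(2)]] obtain w where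
      w: "w \<in> polydisc m z r" "\<forall>\<^sub>F v in nbh m w. f1 v = f2 v" "h1 w \<noteq> 0" "h2 w \<noteq> 0" by blast
    have "\<forall>\<^sub>F v in nbh m w. u v = 0"
      using w(2) quot[OF w(1,3,4)] by eventually_elim (auto simp: u_def field_simps)
    from polydisc_identity[OF hu w(1) this] have u0: "u v = 0" if "v \<in> polydisc m z r" for v using that .
    have "K q" if q: "q \<in> polydisc m z r" for q
      unfolding K_def
    proof (intro allI impI)
      fix \<rho> :: real assume "\<rho> > 0"
      then have "\<forall>\<^sub>F w in nbh m q. w \<in> polydisc m q \<rho>" by (auto simp: eventually_nbh)
      from dense[OF q this] obtain w where w: "w \<in> polydisc m z r" "w \<in> polydisc m q \<rho>" "h1 w \<noteq> 0" "h2 w \<noteq> 0"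
        by blast
      have "\<forall>\<^sub>F v in nbh m w. f1 v = f2 v"
        using quot[OF w(1,3,4)] eventually_polydisc_nbh[OF w(1)]
        by eventually_elim (use u0 in \<open>auto simp: u_def field_simps\<close>)
      then show "\<exists>q'\<in>polydisc m q \<rho>. \<forall>\<^sub>F w in nbh m q'. f1 w = f2 w" using w(2) by blast
    qed
    then show ?thesis using r(1) by (auto simp: eventually_nbh)
  qed
  define L where "L t = (\<lambda>i. p0 i + of_real t * (s i - p0 i))" for t :: real
  define T where "T = {t. K (L t)}"
  have L: "filterlim L (nbh m (L t)) (nhds t)" for t
    unfolding L_def by (rule filterlim_nbh) (auto intro!: tendsto_eq_intros filterlim_ident)
  have "open T"
    unfolding open_subopen[of T]
  proof
    fix t assume "t \<in> T"
    then have "\<forall>\<^sub>F t' in nhds t. K (L t')"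
      using eventually_compose_filterlim[OF K_open L] by (simp add: T_def)
    then show "\<exists>U. open U \<and> t \<in> U \<and> U \<subseteq> T" by (auto simp: eventually_nhds T_def)
  qed
  moreover have "closed T"
    unfolding closed_limpt
  proof (intro allI impI)
    fix t assume t: "t islimpt T"
    have "K (L t)" unfolding K_def
    proof (intro allI impI)
      fix r :: real assume "r > 0"
      then have "\<forall>\<^sub>F t' in nhds t. L t' \<in> polydisc m (L t) r"
        using eventually_compose_filterlim[OF _ L[of t], of "\<lambda>v. v \<in> polydisc m (L t) r"]
        by (auto simp: eventually_nbh)
      then obtain U where "open U" "t \<in> U" "\<forall>t'\<in>U. L t' \<in> polydisc m (L t) r" by (auto simp: eventually_nhds)
      then obtain t' where t': "t' \<in> T" "L t' \<in> polydisc m (L t) r"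
        using t unfolding islimpt_def by blast
      obtain r' where r': "r' > 0" "polydisc m (L t') r' \<subseteq> polydisc m (L t) r"
        using eventually_polydisc_nbh[OF t'(2)] by (auto simp: eventually_nbh)
      then show "\<exists>q\<in>polydisc m (L t) r. \<forall>\<^sub>F w in nbh m q. f1 w = f2 w"
        using t'(1) unfolding T_def K_def by blast
    qed
    then show "t \<in> T" by (simp add: T_def)
  qed
  moreover have "0 \<in> T"
    using p0 by (auto simp: T_def K_def L_def intro!: bexI[of _ p0])
  ultimately have "T = UNIV" using clopen[of T] by blast
  then have "1 \<in> T" by blast
  then have "K s" by (simp add: T_def L_def)
  obtain a1 a2 where a: "a1 > 0" "holomorphic_on_polydisc m f1 s a1" "a2 > 0" "holomorphic_on_polydisc m f2 s a2"
    using s by (auto simp: regular_at_def)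
  define r where "r = min a1 a2"
  have "r > 0" using a by (simp add: r_def)
  have "holomorphic_on_polydisc m f1 s r" "holomorphic_on_polydisc m f2 s r"
    by (auto intro: holomorphic_on_polydisc_subset a simp: r_def)
  then have hol: "holomorphic_on_polydisc m (\<lambda>w. f1 w - f2 w) s r"
    by (auto simp: holomorphic_on_polydisc_def intro!: cd_intros)
  obtain q where "q \<in> polydisc m s r" "\<forall>\<^sub>F w in nbh m q. f1 w = f2 w"
    using \<open>K s\<close> \<open>r > 0\<close> unfolding K_def by blast
  then have "f1 s - f2 s = 0"
    using \<open>r > 0\<close> by (intro polydisc_identity[OF hol, of q]) (auto elim: eventually_mono)
  then show ?thesis by simp
qed

section \<open>Bernoulli numbers and the Euler-Maclaurin formula\<close>

lemma bernoulli_fps: "fps_X / (fps_exp 1 - 1) * (fps_exp 1 - 1 :: complex fps) = fps_X"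
proof -
  have 1: "(fps_exp 1 - 1 :: complex fps) $ 1 \<noteq> 0" by simp
  have "subdegree (fps_exp 1 - 1 :: complex fps) \<le> subdegree (fps_X :: complex fps)"
    using subdegree_leI[OF 1] by simp
  then have "(fps_exp 1 - 1 :: complex fps) dvd fps_X"
    by (subst fps_dvd_iff) auto
  then show ?thesis by (rule dvd_div_mult_self)
qed

text \<open>The coefficient of X^k in F * (e^X - 1) = X, multiplied by k!.\<close>

lemma sum_choose_bernoulli:
  assumes "k \<ge> 1"
  shows "(\<Sum>i<k. of_nat (k choose i) * bernoulli i) = (if k = 1 then 1 else 0)"
proof -
  define F :: "complex fps" where "F = fps_X / (fps_exp 1 - 1)"
  have "(F * (fps_exp 1 - 1)) $ k = (if k = 1 then 1 else 0)"
    unfolding F_def bernoulli_fps by (simp add: fps_X_nth)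
  then have "(if k = 1 then 1 else 0) = (\<Sum>i=0..k. F $ i * (fps_exp 1 - 1) $ (k - i))"
    by (simp add: fps_mult_nth)
  also have "\<dots> = (\<Sum>i<k. F $ i * (fps_exp 1 - 1) $ (k - i))"
    by (simp add: atLeast0AtMost flip: lessThan_Suc_atMost)
  also have "\<dots> = (\<Sum>i<k. F $ i / fact (k - i))"
    by (intro sum.cong) auto
  finally have eq: "(if k = 1 then 1 else 0) = (\<Sum>i<k. F $ i / fact (k - i))" .
  have "(\<Sum>i<k. of_nat (k choose i) * bernoulli i) = (\<Sum>i<k. fact k * (F $ i / fact (k - i)))"
    by (intro sum.cong) (auto simp: bernoulli_def F_def binomial_fact)
  also have "\<dots> = fact k * (if k = 1 then 1 else 0)"
    unfolding eq by (simp add: sum_distrib_left)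
  finally show ?thesis by simp
qed

lemma bernoulli_0 [simp]: "bernoulli 0 = 1"
  using sum_choose_bernoulli[of 1] by simp

lemma bernoulli_1 [simp]: "bernoulli (Suc 0) = -1/2"
  using sum_choose_bernoulli[of 2] by (simp add: numeral_2_eq_2 field_simps add_eq_0_iff)

text \<open>The substitution of -X for X in the generating function F gives F(-X) = X + F(X), so
  beyond degree 1 the odd coefficients equal their own negatives.\<close>

lemma bernoulli_odd_eq_0:
  assumes "odd k" "k \<ge> 3"
  shows "bernoulli k = 0"
proof -
  define F :: "complex fps" where "F = fps_X / (fps_exp 1 - 1)"
  define c :: "complex fps" where "c = fps_const (-1) * fps_X"
  have c0: "c $ 0 = 0" by (simp add: c_def)
  have FE: "F * (fps_exp 1 - 1) = fps_X" unfolding F_def by (rule bernoulli_fps)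
  have Ec: "fps_exp 1 oo c = fps_exp (-1)"
    by (simp add: c_def fps_compose_linear fps_eq_iff)
  have "(F oo c) * (fps_exp 1 - 1 oo c) = fps_X oo c"
    using FE by (simp add: fps_compose_mult_distrib[OF c0, symmetric])
  then have "(F oo c) * (fps_exp (-1) - 1) = - fps_X"
    using c0 by (simp add: fps_compose_sub_distrib Ec) (simp add: c_def)
  then have "(F oo c) * (fps_exp (-1) - 1) * fps_exp 1 = - fps_X * fps_exp 1"
    by simp
  also have "(F oo c) * (fps_exp (-1) - 1) * fps_exp 1 = (F oo c) * (fps_exp 1 * fps_exp (-1) - fps_exp 1)"
    by (simp add: algebra_simps)
  also have "fps_exp 1 * fps_exp (-1) = (1 :: complex fps)"
    using fps_exp_add_mult[of "1::complex" "-1"] by simp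
  finally have "(F oo c) * (fps_exp 1 - 1) = fps_X * (fps_exp 1 - 1) + F * (fps_exp 1 - 1)"
    unfolding FE by (simp add: algebra_simps)
  then have "(F oo c) * (fps_exp 1 - 1) = (fps_X + F) * (fps_exp 1 - 1)"
    by (simp add: ring_distribs)
  moreover have "(fps_exp 1 - 1 :: complex fps) \<noteq> 0"
  proof
    assume "(fps_exp 1 - 1 :: complex fps) = 0"
    then have "(fps_exp 1 - 1 :: complex fps) $ 1 = 0" by simp
    then show False by simp
  qed
  ultimately have "F oo c = fps_X + F" by simp
  then have "(F oo c) $ k = (fps_X + F) $ k" by simp
  then have "- (F $ k) = F $ k"
    using assms by (simp add: c_def fps_compose_linear fps_X_nth)
  then show ?thesis by (simp add: bernoulli_def F_def)
qed

lemma bernoulli_in_Rats: "bernoulli k \<in> \<rat>"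
proof (induction k rule: less_induct)
  case (less k)
  have "(\<Sum>i<Suc k. of_nat (Suc k choose i) * bernoulli i) \<in> \<rat>"
    by (subst sum_choose_bernoulli) auto
  moreover have "(\<Sum>i<k. of_nat (Suc k choose i) * bernoulli i) \<in> \<rat>"
    by (intro Rats_sum Rats_mult less) auto
  ultimately have "of_nat (Suc k choose k) * bernoulli k \<in> \<rat>"
    by (metis Rats_diff add_diff_cancel_left' sum.lessThan_Suc)
  then have "of_nat (Suc k) * bernoulli k / of_nat (Suc k) \<in> \<rat>"
    by (intro Rats_divide) auto
  then show ?case by (metis nonzero_mult_div_cancel_left of_nat_neq_0)
qed

text \<open>The other convention for the Bernoulli numbers, with \<open>B\<^sub>1 = 1/2\<close>: it is the one that makes the
  boundary terms of the Euler-Maclaurin formula uniform.\<close>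

definition bernoulli_plus :: "nat \<Rightarrow> complex" where
  "bernoulli_plus k = (if k = 1 then 1 / 2 else bernoulli k)"

lemma bernoulli_plus_odd: "odd k \<Longrightarrow> k \<noteq> 1 \<Longrightarrow> bernoulli_plus k = 0"
  using bernoulli_odd_eq_0[of k] by (cases "k \<ge> 3") (auto simp: bernoulli_plus_def elim!: oddE)

section \<open>Bernoulli polynomials and integration by parts on the unit interval\<close>

definition bernpoly :: "nat \<Rightarrow> complex \<Rightarrow> complex" where
  "bernpoly k x = (\<Sum>i\<le>k. of_nat (k choose i) * bernoulli i * x ^ (k - i))"

lemma continuous_on_bernpoly [continuous_intros]:
  "continuous_on S f \<Longrightarrow> continuous_on S (\<lambda>x. bernpoly k (f x))"
  unfolding bernpoly_def by (intro continuous_intros)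

lemma DERIV_bernpoly: "(bernpoly (Suc k) has_field_derivative of_nat (Suc k) * bernpoly k x) (at x)"
proof -
  have c: "of_nat (Suc k choose i) * of_nat (Suc k - i) = (of_nat (Suc k) * of_nat (k choose i) :: complex)" for i
    using binomial_absorb_comp[of "Suc k" i] by (metis diff_Suc_1 mult.commute of_nat_mult)
  have "(bernpoly (Suc k) has_field_derivative
     (\<Sum>i\<le>Suc k. of_nat (Suc k choose i) * bernoulli i * (of_nat (Suc k - i) * x ^ (Suc k - i - 1)))) (at x)"
    unfolding bernpoly_def by (auto intro!: derivative_eq_intros sum.cong simp: mult_ac)
  also have "(\<Sum>i\<le>Suc k. of_nat (Suc k choose i) * bernoulli i * (of_nat (Suc k - i) * x ^ (Suc k - i - 1)))
     = (\<Sum>i\<le>k. of_nat (Suc k choose i) * bernoulli i * (of_nat (Suc k - i) * x ^ (Suc k - i - 1)))"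
    by simp
  also have "\<dots> = (\<Sum>i\<le>k. of_nat (Suc k) * (of_nat (k choose i) * bernoulli i * x ^ (k - i)))"
  proof (intro sum.cong refl)
    fix i assume "i \<in> {..k}"
    have "of_nat (Suc k choose i) * bernoulli i * (of_nat (Suc k - i) * x ^ (Suc k - i - 1))
      = (of_nat (Suc k choose i) * of_nat (Suc k - i)) * (bernoulli i * x ^ (Suc k - i - 1))"
      by (simp add: mult_ac)
    then show "of_nat (Suc k choose i) * bernoulli i * (of_nat (Suc k - i) * x ^ (Suc k - i - 1))
      = of_nat (Suc k) * (of_nat (k choose i) * bernoulli i * x ^ (k - i))"
      unfolding c by (simp add: mult_ac)
  qed
  finally show ?thesis by (simp only: bernpoly_def[of k] sum_distrib_left)
qed

lemma bernpoly_at_0: "bernpoly k 0 = bernoulli k"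
proof -
  have "bernpoly k 0 = (\<Sum>i\<le>k. if i = k then bernoulli k else 0)"
    unfolding bernpoly_def by (intro sum.cong) auto
  then show ?thesis by simp
qed

lemma bernpoly_at_1: "k \<ge> 1 \<Longrightarrow> bernpoly k 1 = bernoulli_plus k"
  using sum_choose_bernoulli[of k]
  by (auto simp: bernpoly_def bernoulli_plus_def simp flip: lessThan_Suc_atMost)

text \<open>Repeated integration by parts against the Bernoulli polynomials.\<close>

lemma Euler_Maclaurin_unit_aux:
  fixes g :: "nat \<Rightarrow> real \<Rightarrow> complex"
  assumes g: "\<And>k x. x \<in> {0..1} \<Longrightarrow> (g k has_vector_derivative g (Suc k) x) (at x within {0..1})"
  shows "integral {0..1} (g 0) = (\<Sum>k<K. (-1) ^ k / fact (Suc k) *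
           (bernpoly (Suc k) 1 * g k 1 - bernpoly (Suc k) 0 * g k 0)) +
         (-1) ^ K / fact K * integral {0..1} (\<lambda>x. bernpoly K (of_real x) * g K x)"
proof (induction K)
  case 0
  show ?case by (simp add: bernpoly_def)
next
  case (Suc K)
  have cont: "continuous_on {0..1} (g k)" for k
    using g by (meson continuous_on_vector_derivative)
  let ?P = "\<lambda>x. bernpoly (Suc K) (of_real x)"
  have int: "(\<lambda>x. bernpoly k (of_real x) * g l x) integrable_on {0..1}" for k l
    by (intro integrable_continuous_real continuous_intros cont)
  have "((\<lambda>x. ?P x * g (Suc K) x + (of_nat (Suc K) * bernpoly K (of_real x)) * g K x) has_integral
      (?P 1 * g K 1 - ?P 0 * g K 0)) {0..1}"
    by (intro fundamental_theorem_of_calculus has_vector_derivative_mult g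
          has_vector_derivative_real_field DERIV_bernpoly) auto
  moreover have "((\<lambda>x. ?P x * g (Suc K) x + (of_nat (Suc K) * bernpoly K (of_real x)) * g K x) has_integral
      (integral {0..1} (\<lambda>x. ?P x * g (Suc K) x) + of_nat (Suc K) * integral {0..1} (\<lambda>x. bernpoly K (of_real x) * g K x))) {0..1}"
    using has_integral_mult_right[OF integrable_integral[OF int[of K K]], of "of_nat (Suc K)"]
    by (intro has_integral_add integrable_integral int) (simp add: mult_ac)
  ultimately have "?P 1 * g K 1 - ?P 0 * g K 0 =
      integral {0..1} (\<lambda>x. ?P x * g (Suc K) x) + of_nat (Suc K) * integral {0..1} (\<lambda>x. bernpoly K (of_real x) * g K x)"
    by (rule has_integral_unique)
  then have I: "integral {0..1} (\<lambda>x. bernpoly K (of_real x) * g K x) =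
      (?P 1 * g K 1 - ?P 0 * g K 0 - integral {0..1} (\<lambda>x. ?P x * g (Suc K) x)) / of_nat (Suc K)"
    by (simp add: field_simps del: of_nat_Suc)
  show ?case
    unfolding Suc.IH I by (simp add: field_simps del: of_nat_Suc)
qed

text \<open>For k = 0 the boundary term is the mean of g at the end points, that is g(1) - (g(1) -
  g(0)) / 2, which isolates g(1). For even k > 0 the Bernoulli number of index k + 1 vanishes, so
  the alternating sign may be replaced by -1 throughout.\<close>

lemma Euler_Maclaurin_unit:
  fixes g :: "nat \<Rightarrow> real \<Rightarrow> complex"
  assumes g: "\<And>k x. x \<in> {0..1} \<Longrightarrow> (g k has_vector_derivative g (Suc k) x) (at x within {0..1})"
    and K: "K \<ge> 1"
  shows "g 0 1 = integral {0..1} (g 0) + (\<Sum>k<K. bernoulli_plus (Suc k) / fact (Suc k) * (g k 1 - g k 0)) +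
         (- ((-1) ^ K / fact K) * integral {0..1} (\<lambda>x. bernpoly K (of_real x) * g K x))"
proof -
  have tm: "(-1) ^ k / fact (Suc k) * (bernpoly (Suc k) 1 * g k 1 - bernpoly (Suc k) 0 * g k 0) =
     (if k = 0 then g 0 1 else 0) - bernoulli_plus (Suc k) / fact (Suc k) * (g k 1 - g k 0)" for k
  proof (cases "k = 0")
    case True
    then show ?thesis by (simp add: bernpoly_at_0 bernpoly_at_1 bernoulli_plus_def field_simps)
  next
    case False
    have b: "bernpoly (Suc k) 1 = bernoulli_plus (Suc k)" "bernpoly (Suc k) 0 = bernoulli_plus (Suc k)"
      using False by (simp_all add: bernpoly_at_0 bernpoly_at_1 bernoulli_plus_def)
    show ?thesis
    proof (cases "even k")
      case True
      then show ?thesis using False b bernoulli_plus_odd[of "Suc k"] by simp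
    next
      case odd: False
      then have "(-1) ^ k = (-1 :: complex)" by simp
      then show ?thesis using False unfolding b by (simp add: right_diff_distrib del: fact_Suc)
    qed
  qed
  have "(\<Sum>k<K. if k = 0 then g 0 1 else 0) = g 0 1" using K by (simp add: sum.delta)
  then show ?thesis
    using Euler_Maclaurin_unit_aux[of g K, OF g] unfolding tm sum_subtractf by (simp add: algebra_simps)
qed

section \<open>Derivatives of powers of a polynomial in z^d\<close>

text \<open>Coefficients of the derivatives of a function of \<open>x\<^sup>d\<close>: the K-th derivative of \<open>h (x\<^sup>d)\<close> is
  \<open>\<Sum>i. faa_coeff d K i * x\<^sup>d\<^sup>i\<^sup>-\<^sup>K * h\<^sup>(\<^sup>i\<^sup>) (x\<^sup>d)\<close>.\<close>

definition faa_coeff :: "nat \<Rightarrow> nat \<Rightarrow> nat \<Rightarrow> complex" where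
  "faa_coeff d K i = (\<Sum>r\<le>i. (-1) ^ (i - r) * of_nat (i choose r) * (\<Prod>k<K. of_nat (d * r) - of_nat k)) / fact i"

lemma faa_coeff_0: "faa_coeff d 0 i = (if i = 0 then 1 else 0)"
proof (cases "i = 0")
  case False
  have "(\<Sum>r\<le>i. (-1) ^ (i - r) * of_nat (i choose r) :: complex) =
        (\<Sum>r\<le>i. of_nat (i choose r) * 1 ^ r * (-1) ^ (i - r))"
    by (simp add: mult_ac)
  also have "\<dots> = (1 + (-1)) ^ i" by (rule binomial_ring[symmetric])
  finally show ?thesis using False by (simp add: faa_coeff_def)
qed (simp add: faa_coeff_def)

text \<open>This is the product and chain rule for the derivatives of h(x^d), but obtained from the
  explicit formula: \<open>faa_coeff\<close> is an i-th finite difference of falling factorials of d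
  * r, and the factor d * r - K of the longer factorial is treated with r * (i choose r) = i * (i
  choose r) - i * (i - 1 choose r).\<close>

lemma faa_coeff_Suc:
  "faa_coeff d (Suc K) i = (of_nat (d * i) - of_nat K) * faa_coeff d K i +
     (if i = 0 then 0 else of_nat d * faa_coeff d K (i - 1))"
proof (cases i)
  case 0
  then show ?thesis by (simp add: faa_coeff_def)
next
  case (Suc j)
  define p where "p r = (\<Prod>k<K. of_nat (d * r) - of_nat k :: complex)" for r
  have tm: "(-1) ^ (i - r) * of_nat (i choose r) * (\<Prod>k<Suc K. of_nat (d * r) - of_nat k :: complex) =
     (of_nat (d * i) - of_nat K) * ((-1) ^ (i - r) * of_nat (i choose r) * p r)
     + of_nat d * of_nat i * (if r = i then 0 else (-1) ^ (j - r) * of_nat (j choose r) * p r)" if "r \<le> i" for r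
  proof (cases "r = i")
    case False
    then have r: "r \<le> j" "i - r = Suc (j - r)" using that Suc by auto
    have "of_nat (i - r) * of_nat (i choose r) = (of_nat i * of_nat (j choose r) :: complex)"
      using binomial_absorb_comp[of i r] Suc by (metis diff_Suc_1 of_nat_mult)
    then have "(of_nat i - of_nat r) * of_nat (i choose r) = (of_nat i * of_nat (j choose r) :: complex)"
      using that by (simp add: of_nat_diff)
    then have *: "of_nat r * of_nat (i choose r) = (of_nat i * of_nat (i choose r) - of_nat i * of_nat (j choose r) :: complex)"
      by (simp add: algebra_simps)
    have "(-1) ^ (i - r) * of_nat (i choose r) * (p r * (of_nat (d * r) - of_nat K)) =
      (-1) ^ (i - r) * p r * (of_nat d * (of_nat r * of_nat (i choose r)) - of_nat K * of_nat (i choose r))"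
      by (simp add: algebra_simps)
    also have "\<dots> = (of_nat (d * i) - of_nat K) * ((-1) ^ (i - r) * of_nat (i choose r) * p r)
        + of_nat d * of_nat i * ((-1) ^ (j - r) * of_nat (j choose r) * p r)"
      unfolding * r(2) by (simp add: algebra_simps)
    finally show ?thesis using False by (simp add: p_def)
  qed (simp add: p_def)
  have "fact i * faa_coeff d (Suc K) i =
     (\<Sum>r\<le>i. (-1) ^ (i - r) * of_nat (i choose r) * (\<Prod>k<Suc K. of_nat (d * r) - of_nat k :: complex))"
    by (simp add: faa_coeff_def)
  also have "\<dots> = (\<Sum>r\<le>i. (of_nat (d * i) - of_nat K) * ((-1) ^ (i - r) * of_nat (i choose r) * p r)
     + of_nat d * of_nat i * (if r = i then 0 else (-1) ^ (j - r) * of_nat (j choose r) * p r))"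
    by (intro sum.cong refl tm) auto
  also have "\<dots> = (of_nat (d * i) - of_nat K) * (\<Sum>r\<le>i. (-1) ^ (i - r) * of_nat (i choose r) * p r)
     + of_nat d * of_nat i * (\<Sum>r\<le>i. if r = i then 0 else (-1) ^ (j - r) * of_nat (j choose r) * p r)"
    by (simp add: sum.distrib sum_distrib_left)
  also have "(\<Sum>r\<le>i. if r = i then 0 else (-1) ^ (j - r) * of_nat (j choose r) * p r)
     = (\<Sum>r\<le>j. (-1) ^ (j - r) * of_nat (j choose r) * p r)"
    unfolding Suc by simp
  also have "(\<Sum>r\<le>i. (-1) ^ (i - r) * of_nat (i choose r) * p r) = fact i * faa_coeff d K i"
    by (simp add: faa_coeff_def p_def)
  also have "(\<Sum>r\<le>j. (-1) ^ (j - r) * of_nat (j choose r) * p r) = fact j * faa_coeff d K j"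
    by (simp add: faa_coeff_def p_def)
  also have "of_nat d * of_nat i * (fact j * faa_coeff d K j) = fact i * (of_nat d * faa_coeff d K j)"
    using Suc by simp
  finally have "fact i * faa_coeff d (Suc K) i =
     fact i * ((of_nat (d * i) - of_nat K) * faa_coeff d K i + of_nat d * faa_coeff d K j)"
    by (simp add: algebra_simps)
  then have "faa_coeff d (Suc K) i = (of_nat (d * i) - of_nat K) * faa_coeff d K i + of_nat d * faa_coeff d K j"
    using fact_nonzero mult_left_cancel by blast
  then show ?thesis using Suc by simp
qed

text \<open>A falling factorial of d * r with more than d * r factors contains 0. The truncated
  exponent d * i - K in \<open>pow_deriv\<close> is harmless for this reason.\<close>

lemma faa_coeff_eq_0:
  assumes "d * i < K"
  shows "faa_coeff d K i = 0"
proof -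
  have "(\<Prod>k<K. of_nat (d * r) - of_nat k :: complex) = 0" if "r \<le> i" for r
  proof (rule prod_zero)
    have "d * r < K" using assms that by (meson le_less_trans mult_le_mono2)
    then show "\<exists>k\<in>{..<K}. of_nat (d * r) - of_nat k = (0::complex)"
      by (intro bexI[of _ "d * r"]) auto
  qed simp
  then have "(\<Sum>r\<le>i. (-1) ^ (i - r) * of_nat (i choose r) * (\<Prod>k<K. of_nat (d * r) - of_nat k :: complex)) = 0"
    by (intro sum.neutral ballI) (metis atMost_iff mult_zero_right)
  then show ?thesis by (simp add: faa_coeff_def)
qed

text \<open>Only the summand r = i survives, the shorter falling factorials being 0. It is the
  coefficient that is left at z = 0.\<close>

lemma faa_coeff_diag:
  assumes "d \<ge> 1"
  shows "faa_coeff d (d * i) i = fact (d * i) / fact i"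
proof -
  have z: "(\<Prod>k<d*i. of_nat (d * r) - of_nat k :: complex) = 0" if "r < i" for r
  proof (rule prod_zero)
    show "\<exists>k\<in>{..<d*i}. of_nat (d * r) - of_nat k = (0::complex)"
      using that assms by (intro bexI[of _ "d * r"]) auto
  qed simp
  have f: "(\<Prod>k<n. of_nat n - of_nat k :: complex) = fact n" for n
  proof -
    have "(\<Prod>k<n. of_nat n - of_nat k :: complex) = (\<Prod>k<n. of_nat (n - k))"
      by (intro prod.cong) (auto simp: of_nat_diff)
    then show ?thesis by (simp add: fact_prod_rev atLeast0LessThan)
  qed
  have "(\<Sum>r\<le>i. (-1) ^ (i - r) * of_nat (i choose r) * (\<Prod>k<d*i. of_nat (d * r) - of_nat k :: complex))
     = (\<Sum>r\<le>i. if r = i then fact (d * i) else 0)"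
    by (intro sum.cong refl) (use z f[of "d * i"] in auto)
  then show ?thesis by (simp add: faa_coeff_def)
qed

lemma faa_coeff_top: "i > K \<Longrightarrow> faa_coeff d K i = 0"
proof (induction K arbitrary: i)
  case 0
  then show ?case by (simp add: faa_coeff_0)
next
  case (Suc K)
  then show ?case by (simp add: faa_coeff_Suc)
qed

text \<open>The K-th derivative with respect to \<open>z\<close> of \<open>(A + \<gamma> z\<^sup>d)\<^sup>-\<^sup>s\<close>.\<close>

definition pow_deriv :: "nat \<Rightarrow> complex \<Rightarrow> complex \<Rightarrow> complex \<Rightarrow> nat \<Rightarrow> complex \<Rightarrow> complex" where
  "pow_deriv d \<gamma> A s K z = (\<Sum>i\<le>K. faa_coeff d K i * (\<Prod>l<i. - s - of_nat l) * \<gamma> ^ i * z ^ (d * i - K) *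
     (A + \<gamma> * z ^ d) powr (- s - of_nat i))"

lemma pow_deriv_0: "pow_deriv d \<gamma> A s 0 z = (A + \<gamma> * z ^ d) powr (- s)"
  by (simp add: pow_deriv_def faa_coeff_0)

text \<open>Differentiating one summand gives the two contributions of \<open>faa_coeff_Suc\<close>;
  where the truncated exponent would be wrong, for d * i < K, the coefficient vanishes.\<close>

lemma pow_deriv_has_derivative:
  assumes "A + \<gamma> * z ^ d \<notin> \<real>\<^sub>\<le>\<^sub>0" "d \<ge> 1"
  shows "(pow_deriv d \<gamma> A s K has_field_derivative pow_deriv d \<gamma> A s (Suc K) z) (at z)"
proof -
  define b where "b = A + \<gamma> * z ^ d"
  define q where "q i = (\<Prod>l<i. - s - of_nat l) * \<gamma> ^ i" for i
  have qS: "q (Suc i) = q i * (- s - of_nat i) * \<gamma>" for i by (simp add: q_def)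
  define T where "T i = q i * z ^ (d * i - Suc K) * b powr (- s - of_nat i)" for i
  have db: "((\<lambda>z. (A + \<gamma> * z ^ d) powr w) has_field_derivative
      w * b powr (w - 1) * (\<gamma> * (of_nat d * z ^ (d - 1)))) (at z)" for w
    unfolding b_def
    by (rule DERIV_chain2[where f = "\<lambda>x. x powr w" and g = "\<lambda>z. A + \<gamma> * z ^ d", OF has_field_derivative_powr[OF assms(1)]])
       (auto intro!: derivative_eq_intros)
  have "(pow_deriv d \<gamma> A s K has_field_derivative
     (\<Sum>i\<le>K. faa_coeff d K i * q i * (of_nat (d * i - K) * z ^ (d * i - K - 1) * b powr (- s - of_nat i) +
         z ^ (d * i - K) * ((- s - of_nat i) * b powr (- s - of_nat i - 1) * (\<gamma> * (of_nat d * z ^ (d - 1))))))) (at z)"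
    unfolding pow_deriv_def
    by (rule derivative_eq_intros DERIV_sum db refl)+ (auto simp: q_def b_def algebra_simps)
  also have "(\<Sum>i\<le>K. faa_coeff d K i * q i * (of_nat (d * i - K) * z ^ (d * i - K - 1) * b powr (- s - of_nat i) +
         z ^ (d * i - K) * ((- s - of_nat i) * b powr (- s - of_nat i - 1) * (\<gamma> * (of_nat d * z ^ (d - 1))))))
    = (\<Sum>i\<le>K. (of_nat (d * i) - of_nat K) * faa_coeff d K i * T i + of_nat d * faa_coeff d K i * T (Suc i))"
  proof (intro sum.cong refl)
    fix i
    show "faa_coeff d K i * q i * (of_nat (d * i - K) * z ^ (d * i - K - 1) * b powr (- s - of_nat i) +
         z ^ (d * i - K) * ((- s - of_nat i) * b powr (- s - of_nat i - 1) * (\<gamma> * (of_nat d * z ^ (d - 1)))))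
      = (of_nat (d * i) - of_nat K) * faa_coeff d K i * T i + of_nat d * faa_coeff d K i * T (Suc i)"
    proof (cases "d * i < K")
      case True
      then show ?thesis by (simp add: faa_coeff_eq_0)
    next
      case False
      then have le: "K \<le> d * i" by simp
      have e: "z ^ (d * i - K) * z ^ (d - 1) = z ^ (d * Suc i - Suc K)"
        using le assms(2) by (simp add: add.commute flip: power_add)
      have p: "- s - of_nat i - 1 = - s - of_nat (Suc i)" by simp
      have o: "of_nat (d * i - K) = (of_nat (d * i) - of_nat K :: complex)"
        using le by (rule of_nat_diff)
      have TS: "T (Suc i) = q i * (- s - of_nat i) * \<gamma> * (z ^ (d * i - K) * z ^ (d - 1)) * b powr (- s - of_nat i - 1)"
        unfolding T_def qS e p ..
      then show ?thesis
        unfolding o T_def[of i] TS by (simp add: algebra_simps)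
    qed
  qed
  also have "\<dots> = (\<Sum>i\<le>K. (of_nat (d * i) - of_nat K) * faa_coeff d K i * T i) + (\<Sum>i\<le>K. of_nat d * faa_coeff d K i * T (Suc i))"
    by (rule sum.distrib)
  also have "(\<Sum>i\<le>K. (of_nat (d * i) - of_nat K) * faa_coeff d K i * T i) =
      (\<Sum>i\<le>Suc K. (of_nat (d * i) - of_nat K) * faa_coeff d K i * T i)"
    by (simp add: faa_coeff_top)
  also have "(\<Sum>i\<le>K. of_nat d * faa_coeff d K i * T (Suc i)) =
      (\<Sum>i\<le>Suc K. (if i = 0 then 0 else of_nat d * faa_coeff d K (i - 1)) * T i)"
    by (subst sum.atMost_Suc_shift) simp
  also have "(\<Sum>i\<le>Suc K. (of_nat (d * i) - of_nat K) * faa_coeff d K i * T i) + \<dots> =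
      (\<Sum>i\<le>Suc K. faa_coeff d (Suc K) i * T i)"
    unfolding sum.distrib[symmetric] faa_coeff_Suc by (intro sum.cong) (auto simp: algebra_simps)
  also have "\<dots> = pow_deriv d \<gamma> A s (Suc K) z"
    unfolding pow_deriv_def T_def q_def b_def by (intro sum.cong) (auto simp: mult_ac)
  finally show ?thesis .
qed

text \<open>At z = 0 only the summand with d * i = K is left: below it the coefficient vanishes,
  above it the power of z.\<close>

lemma pow_deriv_at_0:
  assumes "d \<ge> 1"
  shows "pow_deriv d \<gamma> A s K 0 =
    (if d dvd K then fact K * ((- s) gchoose (K div d)) * \<gamma> ^ (K div d) * A powr (- s - of_nat (K div d)) else 0)"
proof -
  have zero: "faa_coeff d K i * (\<Prod>l<i. - s - of_nat l) * \<gamma> ^ i * 0 ^ (d * i - K) *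
     (A + \<gamma> * 0 ^ d) powr (- s - of_nat i) = 0" if "d * i \<noteq> K" for i
    using that faa_coeff_eq_0[of d i K] by (cases "d * i < K") (auto simp: power_0_left)
  show ?thesis
  proof (cases "d dvd K")
    case False
    then have "d * i \<noteq> K" for i by auto
    then show ?thesis using False zero by (auto simp: pow_deriv_def intro!: sum.neutral)
  next
    case True
    then obtain j where j: "K = d * j" by auto
    have jK: "j \<le> K" using assms j by simp
    have "pow_deriv d \<gamma> A s K 0 = (\<Sum>i\<in>{j}. faa_coeff d K i * (\<Prod>l<i. - s - of_nat l) * \<gamma> ^ i * 0 ^ (d * i - K) *
         (A + \<gamma> * 0 ^ d) powr (- s - of_nat i))"
      unfolding pow_deriv_def
    proof (intro sum.mono_neutral_right ballI)
      fix i assume "i \<in> {..K} - {j}"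
      then have "d * i \<noteq> K" using j assms by auto
      then show "faa_coeff d K i * (\<Prod>l<i. - s - of_nat l) * \<gamma> ^ i * 0 ^ (d * i - K) *
        (A + \<gamma> * 0 ^ d) powr (- s - of_nat i) = 0" by (rule zero)
    qed (use jK in auto)
    then show ?thesis
      using j assms by (simp add: faa_coeff_diag gbinomial_prod_rev atLeast0LessThan power_0_left)
  qed
qed

text \<open>For s = -N the function is a polynomial of degree at most d * N in z. This makes the
  remainder vanish at nonpositive integers.\<close>

lemma pow_deriv_eq_0:
  assumes "d * N < K" "d \<ge> 1"
  shows "pow_deriv d \<gamma> A (- of_nat N) K z = 0"
  unfolding pow_deriv_def
proof (intro sum.neutral ballI)
  fix i
  show "faa_coeff d K i * (\<Prod>l<i. - (- of_nat N) - of_nat l) * \<gamma> ^ i * z ^ (d * i - K) *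
         (A + \<gamma> * z ^ d) powr (- (- of_nat N) - of_nat i) = 0"
  proof (cases "i \<le> N")
    case True
    then have "d * i < K" using assms by (meson le_less_trans mult_le_mono2)
    then show ?thesis by (simp add: faa_coeff_eq_0)
  next
    case False
    then have "(\<Prod>l<i. of_nat N - of_nat l :: complex) = 0"
      by (intro prod_zero bexI[of _ N]) auto
    then show ?thesis by simp
  qed
qed

section \<open>The remainder of the expansion\<close>

definition powr_const :: "real \<Rightarrow> real \<Rightarrow> real \<Rightarrow> real" where
  "powr_const g G B = exp (B * (ln (max (1 / g) G) + pi))"

text \<open>The modulus is exp of - Re w * ln |z| + Im w * arg z. In the cone ln |z| differs from ln
  Y by at most ln (max (1/g) G) and |arg z| is at most pi, which is how \<open>powr_const\<close>
  arises.\<close>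

lemma norm_powr_bound:
  fixes z w :: complex
  assumes "g > 0" "Y > 0" "g * Y \<le> Re z" "norm z \<le> G * Y" "norm w \<le> B"
  shows "norm (z powr (- w)) \<le> powr_const g G B * Y powr (- Re w)"
proof -
  have Rz: "Re z > 0" using assms by (meson less_le_trans mult_pos_pos)
  then have z: "z \<noteq> 0" by auto
  have nz: "norm z \<ge> g * Y" using assms(3) complex_Re_le_cmod order_trans by blast
  have "G * Y > 0" using assms nz by (meson less_le_trans mult_pos_pos)
  then have G: "G > 0" using assms by (simp add: zero_less_mult_iff)
  define q where "q = max (1 / g) G"
  have q: "1 / g \<le> q" "G \<le> q" "q > 0" using assms G by (auto simp: q_def)
  have "ln (norm z) \<le> ln (G * Y)" using assms z \<open>G * Y > 0\<close> by (subst ln_le_cancel_iff) auto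
  also have "\<dots> = ln G + ln Y" using G assms by (simp add: ln_mult)
  also have "\<dots> \<le> ln q + ln Y" using G q by simp
  finally have 1: "ln (norm z) - ln Y \<le> ln q" by simp
  have "ln (g * Y) \<le> ln (norm z)" using nz assms z by (subst ln_le_cancel_iff) auto
  moreover have "ln (g * Y) = ln g + ln Y" using assms by (simp add: ln_mult)
  moreover have "ln (1 / g) \<le> ln q" using q assms by (subst ln_le_cancel_iff) auto
  moreover have "ln (1 / g) = - ln g" using assms by (simp add: ln_div)
  ultimately have "\<bar>ln (norm z) - ln Y\<bar> \<le> ln q" using 1 by linarith
  have B: "\<bar>Re w\<bar> \<le> B" "\<bar>Im w\<bar> \<le> B" "B \<ge> 0"
    using assms(5) abs_Re_le_cmod[of w] abs_Im_le_cmod[of w] norm_ge_zero[of w] by linarith+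
  have "\<bar>Re w * (ln (norm z) - ln Y)\<bar> \<le> B * ln q"
    unfolding abs_mult using B \<open>\<bar>ln (norm z) - ln Y\<bar> \<le> ln q\<close> by (intro mult_mono) auto
  moreover have "\<bar>Im w * Im (Ln z)\<bar> \<le> B * pi"
    unfolding abs_mult using B mpi_less_Im_Ln[OF z] Im_Ln_le_pi[OF z] by (intro mult_mono) auto
  moreover have "Re (- w * Ln z) = - Re w * ln Y - Re w * (ln (norm z) - ln Y) + Im w * Im (Ln z)"
    using z by (simp add: algebra_simps)
  ultimately have "Re (- w * Ln z) \<le> - Re w * ln Y + B * ln q + B * pi"
    by (simp only: abs_le_iff) linarith
  then have "Re (- w * Ln z) \<le> B * (ln q + pi) + - Re w * ln Y"
    by (simp add: distrib_left)
  then have "exp (Re (- w * Ln z)) \<le> exp (B * (ln q + pi) + - Re w * ln Y)" by simp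
  moreover have "norm (z powr (- w)) = exp (Re (- w * Ln z))"
    using z by (simp add: powr_def norm_exp_eq_Re)
  moreover have "exp (B * (ln q + pi) + - Re w * ln Y) = powr_const g G B * Y powr (- Re w)"
    using assms by (simp add: powr_const_def q_def mult_exp_exp powr_def)
  ultimately show ?thesis by linarith
qed

lemma powr_const_nonneg [simp]: "powr_const g G B \<ge> 0" "powr_const g G B > 0"
  by (auto simp: powr_const_def)

text \<open>The cone conditions are additive: the scale y of A and the scale x^d of the added term
  simply add up.\<close>

lemma base_bounds:
  fixes A \<gamma> :: complex
  assumes "g * y \<le> Re A" "norm A \<le> G * y" "g \<le> Re \<gamma>" "norm \<gamma> \<le> G" "x \<ge> 0"
  shows "g * (y + x ^ d) \<le> Re (A + \<gamma> * of_real x ^ d)" "norm (A + \<gamma> * of_real x ^ d) \<le> G * (y + x ^ d)"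
proof -
  have "Re (A + \<gamma> * of_real x ^ d) = Re A + Re \<gamma> * x ^ d"
    by (simp flip: of_real_power)
  moreover have "g * x ^ d \<le> Re \<gamma> * x ^ d" using assms by (intro mult_right_mono) auto
  ultimately show "g * (y + x ^ d) \<le> Re (A + \<gamma> * of_real x ^ d)" using assms by (simp add: ring_distribs)
  have "norm (A + \<gamma> * of_real x ^ d) \<le> norm A + norm \<gamma> * x ^ d"
    using norm_triangle_ineq[of A "\<gamma> * of_real x ^ d"] assms(5) by (simp add: norm_mult norm_power)
  moreover have "norm \<gamma> * x ^ d \<le> G * x ^ d" using assms by (intro mult_right_mono) auto
  ultimately show "norm (A + \<gamma> * of_real x ^ d) \<le> G * (y + x ^ d)" using assms by (simp add: ring_distribs)
qed

text \<open>With Y = y + x^d, summand i has size x^(d i - K) * Y^(- Re s - i) and vanishes unless i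
  >= J; bounding the power of x by (x^d)^(i - J), hence by Y^(i - J), leaves the exponent - Re s -
  J. The first of these bounds is where x >= 1 or K = d * J enters.\<close>

lemma pow_deriv_bound:
  fixes \<gamma> :: complex and B g G :: real
  assumes "g > 0" "g \<le> Re \<gamma>" "norm \<gamma> \<le> G" "d \<ge> 1" "d * J \<le> K" "B \<ge> 0"
  obtains C where "C \<ge> 0" "\<And>A y s x. y \<ge> 1 \<Longrightarrow> g * y \<le> Re A \<Longrightarrow> norm A \<le> G * y \<Longrightarrow> norm s \<le> B \<Longrightarrow>
     x \<ge> 0 \<Longrightarrow> x \<ge> 1 \<or> K = d * J \<Longrightarrow>
     norm (pow_deriv d \<gamma> A s K (of_real x)) \<le> C * (y + x ^ d) powr (- Re s - real J)"
proof
  define c where "c i = norm (faa_coeff d K i) * (\<Prod>l<i. B + real l) * G ^ i * powr_const g G (B + real i)" for i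
  have G: "G \<ge> 0" using assms(3) norm_ge_zero order_trans by blast
  have c0: "c i \<ge> 0" for i unfolding c_def using assms G
    by (intro mult_nonneg_nonneg prod_nonneg) auto
  show "(\<Sum>i\<le>K. c i) \<ge> 0" using c0 by (intro sum_nonneg) auto
  fix A s :: complex and y x :: real
  assume y: "y \<ge> 1" "g * y \<le> Re A" "norm A \<le> G * y" and s: "norm s \<le> B" and x: "x \<ge> 0" "x \<ge> 1 \<or> K = d * J"
  define Y where "Y = y + x ^ d"
  have "x ^ d \<ge> 0" using x by simp
  then have Y: "Y \<ge> 1" "x ^ d \<le> Y" using y unfolding Y_def by linarith+
  note bb = base_bounds[OF y(2,3) assms(2,3) x(1), of d, folded Y_def]
  have "norm (pow_deriv d \<gamma> A s K (of_real x)) \<le> (\<Sum>i\<le>K. c i * Y powr (- Re s - real J))"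
    unfolding pow_deriv_def
  proof (intro sum_norm_le)
    fix i assume i: "i \<in> {..K}"
    show "norm (faa_coeff d K i * (\<Prod>l<i. - s - of_nat l) * \<gamma> ^ i * of_real x ^ (d * i - K) *
         (A + \<gamma> * of_real x ^ d) powr (- s - of_nat i)) \<le> c i * Y powr (- Re s - real J)"
    proof (cases "d * i < K")
      case True
      then show ?thesis using c0[of i] by (simp add: faa_coeff_eq_0)
    next
      case False
      then have "d * J \<le> d * i" using assms(5) by linarith
      then have Ji: "J \<le> i" using assms(4) by simp
      have "x ^ (d * i - K) \<le> x ^ (d * (i - J))"
        using x(2)
      proof
        assume "x \<ge> 1"
        then show ?thesis using assms(5) by (intro power_increasing) (auto simp: right_diff_distrib' diff_le_mono2)
      qed (simp add: right_diff_distrib')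
      also have "\<dots> = (x ^ d) ^ (i - J)" by (rule power_mult)
      also have "\<dots> \<le> Y ^ (i - J)" using x Y by (intro power_mono) auto
      finally have xp: "x ^ (d * i - K) \<le> Y ^ (i - J)" .
      have "- s - of_nat i = - (s + of_nat i)" by simp
      moreover have "norm ((A + \<gamma> * of_real x ^ d) powr (- (s + of_nat i))) \<le>
          powr_const g G (B + real i) * Y powr (- Re (s + of_nat i))"
        using bb Y s assms(1) norm_triangle_ineq[of s "of_nat i"]
        by (intro norm_powr_bound) auto
      ultimately have pw: "norm ((A + \<gamma> * of_real x ^ d) powr (- s - of_nat i)) \<le>
          powr_const g G (B + real i) * Y powr (- Re s - real i)"
        by simp
      have pr: "norm (\<Prod>l<i. - s - of_nat l) \<le> (\<Prod>l<i. B + real l)"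
        unfolding prod_norm[symmetric]
      proof (intro prod_mono conjI)
        fix l
        show "norm (- s - of_nat l) \<le> B + real l"
          using norm_triangle_ineq4[of "-s" "of_nat l"] s by simp
      qed simp
      have "norm (faa_coeff d K i * (\<Prod>l<i. - s - of_nat l) * \<gamma> ^ i * of_real x ^ (d * i - K) *
         (A + \<gamma> * of_real x ^ d) powr (- s - of_nat i)) =
         norm (faa_coeff d K i) * norm (\<Prod>l<i. - s - of_nat l) * norm \<gamma> ^ i * x ^ (d * i - K) *
         norm ((A + \<gamma> * of_real x ^ d) powr (- s - of_nat i))"
        using x by (simp add: norm_mult norm_power)
      also have "\<dots> \<le> norm (faa_coeff d K i) * (\<Prod>l<i. B + real l) * G ^ i * Y ^ (i - J) *
         (powr_const g G (B + real i) * Y powr (- Re s - real i))"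
        using assms G Y x
        by (intro mult_mono pw pr xp power_mono mult_nonneg_nonneg prod_nonneg order_refl) auto
      also have "\<dots> = c i * (Y ^ (i - J) * Y powr (- Re s - real i))"
        by (simp add: c_def mult_ac)
      also have "Y ^ (i - J) * Y powr (- Re s - real i) = Y powr (- Re s - real J)"
        using Y Ji by (simp add: powr_realpow[symmetric] of_nat_diff add.commute flip: powr_add)
      finally show ?thesis .
    qed
  qed
  also have "\<dots> = (\<Sum>i\<le>K. c i) * (y + x ^ d) powr (- Re s - real J)"
    by (simp add: Y_def sum_distrib_right)
  finally show "norm (pow_deriv d \<gamma> A s K (of_real x)) \<le> (\<Sum>i\<le>K. c i) * (y + x ^ d) powr (- Re s - real J)" .
qed

text \<open>The exponent -\<tau> is split into 2 - \<tau>, which keeps the decay in y, and -2, which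
  pays for the summation over m because Y >= (1 + m) / 2.\<close>

lemma powr_decay_bound:
  fixes x y \<tau> :: real
  assumes "y \<ge> 1" "x \<ge> real m" "d \<ge> 1" "\<tau> \<ge> 2"
  shows "(y + x ^ d) powr (- \<tau>) \<le> y powr (2 - \<tau>) * (4 / (1 + real m)\<^sup>2)"
proof -
  have x0: "x \<ge> 0" using assms(2) of_nat_0_le_iff[of m] by linarith
  define Y where "Y = y + x ^ d"
  have xd: "x ^ d \<ge> 0" using x0 by simp
  have Yy: "Y \<ge> y" using xd by (simp add: Y_def)
  have "(1 + x) / 2 \<le> 1 + x ^ d"
  proof (cases "x \<le> 1")
    case True
    then show ?thesis using xd by simp
  next
    case False
    then have "x ^ 1 \<le> x ^ d" using assms by (intro power_increasing) auto
    then show ?thesis using False by simp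
  qed
  also have "\<dots> \<le> Y" using assms by (simp add: Y_def)
  finally have Ym: "(1 + real m) / 2 \<le> Y" using assms(2) by simp
  have "Y powr (- \<tau>) = Y powr (2 - \<tau>) * Y powr (-2)"
    by (simp flip: powr_add)
  also have "Y powr (2 - \<tau>) \<le> y powr (2 - \<tau>)"
    using assms Yy by (intro powr_mono2') auto
  also have "Y powr (-2) = 1 / Y\<^sup>2"
    using Yy assms by (simp add: powr_minus_divide powr_numeral)
  also have "1 / Y\<^sup>2 \<le> 1 / ((1 + real m) / 2)\<^sup>2"
    using Ym Yy assms by (intro divide_left_mono power_mono mult_pos_pos) auto
  also have "1 / ((1 + real m) / 2)\<^sup>2 = 4 / (1 + real m)\<^sup>2"
    by (simp add: power_divide)
  finally show ?thesis unfolding Y_def by (simp add: mult_left_mono mult_right_mono)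
qed

lemma summable_on_inverse_square: "(\<lambda>m. c / (1 + real m)\<^sup>2) summable_on UNIV"
proof (rule norm_summable_imp_summable_on)
  have "summable (\<lambda>m. 1 / (real m)\<^sup>2)"
    using inverse_power_summable[of 2, where 'a = real] by (simp add: inverse_eq_divide)
  then have "summable (\<lambda>m. 1 / (real (Suc m))\<^sup>2)"
    by (subst summable_Suc_iff)
  then have "summable (\<lambda>m. \<bar>c\<bar> * (1 / (real (Suc m))\<^sup>2))" by (rule summable_mult)
  then show "summable (\<lambda>m. norm (c / (1 + real m)\<^sup>2))"
    by (simp add: abs_divide)
qed

section \<open>Holomorphy of series and of parameter integrals\<close>

lemma norm_infsum_le_infsum:
  fixes f :: "'a \<Rightarrow> complex"
  assumes "M summable_on X" "\<And>x. x \<in> X \<Longrightarrow> norm (f x) \<le> M x"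
  shows "f summable_on X" "norm (infsum f X) \<le> infsum M X"
proof -
  have *: "(\<lambda>x. norm (f x)) summable_on X"
    by (rule Infinite_Sum.abs_summable_on_comparison_test'[OF assms])
  then show "f summable_on X" by (rule abs_summable_summable)
  have "norm (infsum f X) \<le> infsum (\<lambda>x. norm (f x)) X" using * by (rule norm_infsum_bound)
  also have "\<dots> \<le> infsum M X" using * assms by (intro infsum_mono)
  finally show "norm (infsum f X) \<le> infsum M X" .
qed

text \<open>Weierstrass: near each point a summable majorant makes the finite partial sums converge
  uniformly on a closed disc, and uniform limits of holomorphic functions are holomorphic.\<close>

lemma holomorphic_on_infsum:
  fixes f :: "'a \<Rightarrow> complex \<Rightarrow> complex"
  assumes "open S" "\<And>x. x \<in> X \<Longrightarrow> f x holomorphic_on S"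
    and "\<And>z. z \<in> S \<Longrightarrow> \<exists>M. M summable_on X \<and> (\<forall>\<^sub>F w in nhds z. \<forall>x\<in>X. norm (f x w) \<le> M x)"
  shows "(\<lambda>z. \<Sum>\<^sub>\<infinity>x\<in>X. f x z) holomorphic_on S"
  unfolding holomorphic_on_def
proof
  fix z assume z: "z \<in> S"
  from assms(3)[OF z] obtain M where M: "M summable_on X" "\<forall>\<^sub>F w in nhds z. \<forall>x\<in>X. norm (f x w) \<le> M x"
    by blast
  have "\<forall>\<^sub>F w in nhds z. w \<in> S" using \<open>open S\<close> z by (rule eventually_nhds_in_open)
  with M(2) have "\<forall>\<^sub>F w in nhds z. w \<in> S \<and> (\<forall>x\<in>X. norm (f x w) \<le> M x)" by eventually_elim auto
  then obtain e where e: "e > 0" "\<And>w. dist w z < e \<Longrightarrow> w \<in> S \<and> (\<forall>x\<in>X. norm (f x w) \<le> M x)"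
    by (auto simp: eventually_nhds_metric)
  define r where "r = e / 2"
  have r: "r > 0" "cball z r \<subseteq> S" "\<And>w x. w \<in> cball z r \<Longrightarrow> x \<in> X \<Longrightarrow> norm (f x w) \<le> M x"
    using e by (auto simp: r_def dist_commute)
  have hol: "(\<lambda>w. \<Sum>x\<in>Y. f x w) holomorphic_on S" if "Y \<subseteq> X" for Y
    using that assms(2) by (intro holomorphic_on_sum) auto
  have ul: "uniform_limit (cball z r) (\<lambda>Y w. \<Sum>x\<in>Y. f x w) (\<lambda>w. \<Sum>\<^sub>\<infinity>x\<in>X. f x w) (finite_subsets_at_top X)"
    using r M by (intro Weierstrass_m_test_general) auto
  have ev: "\<forall>\<^sub>F Y in finite_subsets_at_top X. continuous_on (cball z r) (\<lambda>w. \<Sum>x\<in>Y. f x w) \<and>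
      (\<lambda>w. \<Sum>x\<in>Y. f x w) holomorphic_on ball z r"
  proof (rule eventually_finite_subsets_at_top_weakI)
    fix Y assume "finite Y" "Y \<subseteq> X"
    then show "continuous_on (cball z r) (\<lambda>w. \<Sum>x\<in>Y. f x w) \<and> (\<lambda>w. \<Sum>x\<in>Y. f x w) holomorphic_on ball z r"
      using hol r(2) ball_subset_cball[of z r]
      by (blast intro: holomorphic_on_subset holomorphic_on_imp_continuous_on)
  qed
  have "(\<lambda>w. \<Sum>\<^sub>\<infinity>x\<in>X. f x w) holomorphic_on ball z r"
    by (rule holomorphic_uniform_limit[OF ev ul]) auto
  then show "(\<lambda>w. \<Sum>\<^sub>\<infinity>x\<in>X. f x w) field_differentiable at z within S"
    using r(1) by (meson centre_in_ball field_differentiable_at_within holomorphic_on_imp_differentiable_at open_ball)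
qed

text \<open>Differentiation under the integral; positivity of the real part keeps the base off the
  branch cut. Here h stands for the power (m + x)^d and W for the polynomial factor of the
  integrand.\<close>

lemma holomorphic_on_unit_integral:
  fixes W h :: "real \<Rightarrow> complex" and a0 a1 g0 g1 s0 s1 :: complex
  assumes W: "continuous_on {0..1} W" and h: "continuous_on {0..1} h" and U: "convex U"
    and Re: "\<And>z x. z \<in> U \<Longrightarrow> x \<in> {0..1} \<Longrightarrow> Re (a0 + a1 * z + (g0 + g1 * z) * h x) > 0"
  shows "(\<lambda>z. integral {0..1} (\<lambda>x. W x * (a0 + a1 * z + (g0 + g1 * z) * h x) powr (- (s0 + s1 * z)))) holomorphic_on U"
proof -
  define b where "b z x = a0 + a1 * z + (g0 + g1 * z) * h x" for z x
  have bn: "b z x \<notin> \<real>\<^sub>\<le>\<^sub>0" "b z x \<noteq> 0" if "z \<in> U" "x \<in> {0..1}" for z x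
    using Re[OF that] by (auto simp: b_def complex_nonpos_Reals_iff complex_eq_iff)
  define f where "f z x = W x * exp (- (s0 + s1 * z) * Ln (b z x))" for z x
  define fx where "fx z x = W x * (exp (- (s0 + s1 * z) * Ln (b z x)) *
     (- s1 * Ln (b z x) - (s0 + s1 * z) * ((a1 + g1 * h x) / b z x)))" for z x
  have "(\<lambda>z. integral (cbox 0 1) (f z)) holomorphic_on U"
  proof (rule leibniz_rule_holomorphic[OF _ _ _ U])
    fix z x assume zx: "z \<in> U" "x \<in> cbox 0 (1::real)"
    have "((\<lambda>z. b z x) has_field_derivative (a1 + g1 * h x)) (at z within U)"
      unfolding b_def by (auto intro!: derivative_eq_intros)
    then have "((\<lambda>z. Ln (b z x)) has_field_derivative ((a1 + g1 * h x) / b z x)) (at z within U)"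
      using bn[of z x] zx by (auto intro!: derivative_eq_intros simp: field_simps)
    moreover have "((\<lambda>z. W x * exp (- (s0 + s1 * z) * L z)) has_field_derivative
        W x * (exp (- (s0 + s1 * z) * L z) * (- s1 * L z - (s0 + s1 * z) * L'))) (at z within U)"
      if "(L has_field_derivative L') (at z within U)" for L L'
      using that by (auto intro!: derivative_eq_intros simp: algebra_simps)
    ultimately show "((\<lambda>z. f z x) has_field_derivative fx z x) (at z within U)"
      unfolding f_def fx_def by blast
  next
    fix z assume z: "z \<in> U"
    show "f z integrable_on cbox 0 1"
      unfolding f_def using bn[OF z]
      by (intro integrable_continuous continuous_intros) (auto simp: b_def intro!: continuous_intros W h)
  next
    have pr: "continuous_on (U \<times> cbox 0 1) (\<lambda>p. W (snd p))" "continuous_on (U \<times> cbox 0 1) (\<lambda>p. h (snd p))"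
      using W h by (auto intro!: continuous_on_compose2[OF _ continuous_on_snd])
    then have "continuous_on (U \<times> cbox 0 1) (\<lambda>p. b (fst p) (snd p))"
      unfolding b_def by (intro continuous_intros)
    then have "continuous_on (U \<times> cbox 0 1) (\<lambda>p. fx (fst p) (snd p))"
      unfolding fx_def using bn by (intro continuous_intros pr) auto
    then show "continuous_on (U \<times> cbox 0 1) (\<lambda>(x, t). fx x t)"
      by (simp add: case_prod_beta')
  qed
  moreover have "f z x = W x * b z x powr (- (s0 + s1 * z))" if "z \<in> U" "x \<in> {0..1}" for z x
    using bn[OF that] by (simp add: f_def powr_def)
  then have "integral (cbox 0 1) (f z) = integral {0..1} (\<lambda>x. W x * b z x powr (- (s0 + s1 * z)))" if "z \<in> U" for z
    using that by (auto intro: integral_cong)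
  ultimately show ?thesis
    unfolding b_def by (simp cong: holomorphic_cong)
qed

section \<open>The Euler-Maclaurin remainder\<close>

definition em_unit :: "nat \<Rightarrow> complex \<Rightarrow> complex \<Rightarrow> complex \<Rightarrow> nat \<Rightarrow> nat \<Rightarrow> complex" where
  "em_unit d \<gamma> A s K m = - ((-1) ^ K / fact K) *
     integral {0..1} (\<lambda>x. bernpoly K (of_real x) * pow_deriv d \<gamma> A s K (of_real (real m + x)))"

text \<open>The order d * J is chosen so that the surviving boundary terms at 0 are those of the J
  powers A^(-s - i) with i < J, and so that each unit of J gains one power of A.\<close>

definition em_rem :: "nat \<Rightarrow> complex \<Rightarrow> complex \<Rightarrow> complex \<Rightarrow> nat \<Rightarrow> complex" where
  "em_rem d \<gamma> A s J = (\<Sum>\<^sub>\<infinity>m. em_unit d \<gamma> A s (d * J) m)"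

lemma Re_base_pos:
  assumes "Re A > 0" "Re \<gamma> > 0" "x \<ge> 0"
  shows "Re (A + \<gamma> * of_real x ^ d) > 0"
proof -
  have "Re (A + \<gamma> * of_real x ^ d) = Re A + Re \<gamma> * x ^ d"
    by (simp flip: of_real_power)
  moreover have "Re \<gamma> * x ^ d \<ge> 0" using assms by (intro mult_nonneg_nonneg) auto
  ultimately show ?thesis using assms by linarith
qed

lemma base_nonpos:
  assumes "Re A > 0" "Re \<gamma> > 0" "x \<ge> 0"
  shows "A + \<gamma> * of_real x ^ d \<notin> \<real>\<^sub>\<le>\<^sub>0"
  using Re_base_pos[OF assms, of d] by (simp only: complex_nonpos_Reals_iff) linarith

lemma continuous_on_pow_deriv:
  assumes "Re A > 0" "Re \<gamma> > 0" "d \<ge> 1"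
  shows "continuous_on {0..1} (\<lambda>x. pow_deriv d \<gamma> A s K (of_real (real m + x)))"
proof -
  have "continuous_on {of_real x | x. x \<ge> 0} (pow_deriv d \<gamma> A s K)"
  proof (rule continuous_at_imp_continuous_on, safe)
    fix x :: real assume "x \<ge> 0"
    from pow_deriv_has_derivative[OF base_nonpos[OF assms(1,2) this] assms(3)]
    show "isCont (pow_deriv d \<gamma> A s K) (of_real x)" by (rule DERIV_isCont)
  qed
  then show ?thesis
    by (rule continuous_on_compose2) (auto intro!: continuous_intros simp del: of_real_add)
qed

lemma norm_integral_unit_le:
  fixes f :: "real \<Rightarrow> complex"
  assumes "continuous_on {0..1} f" "\<And>x. x \<in> {0..1} \<Longrightarrow> norm (f x) \<le> C"
  shows "norm (integral {0..1} f) \<le> C"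
proof -
  have "norm (integral {0..1} f) \<le> integral {0..1} (\<lambda>_::real. C)"
    using assms by (intro integral_norm_bound_integral integrable_continuous_real continuous_intros) auto
  then show ?thesis by simp
qed

text \<open>The constant depends only on the cone, d, J and the bound B, not on A, y or m. This
  uniformity allows the later summation over all outer variables, whose partial sums take the place
  of A.\<close>

lemma em_unit_bound:
  fixes \<gamma> :: complex and B g G :: real
  assumes "g > 0" "g \<le> Re \<gamma>" "norm \<gamma> \<le> G" "d \<ge> 1" "B \<ge> 0"
  obtains C where "C \<ge> 0" "\<And>A y s m. y \<ge> 1 \<Longrightarrow> g * y \<le> Re A \<Longrightarrow> norm A \<le> G * y \<Longrightarrow> norm s \<le> B \<Longrightarrow>
     Re s + real J \<ge> 2 \<Longrightarrow>
     norm (em_unit d \<gamma> A s (d * J) m) \<le> C * y powr (2 - Re s - real J) / (1 + real m)\<^sup>2"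
proof -
  define K where "K = d * J"
  obtain C where C: "C \<ge> 0" "\<And>A y s x. y \<ge> 1 \<Longrightarrow> g * y \<le> Re A \<Longrightarrow> norm A \<le> G * y \<Longrightarrow> norm s \<le> B \<Longrightarrow>
     x \<ge> 0 \<Longrightarrow> x \<ge> 1 \<or> K = d * J \<Longrightarrow>
     norm (pow_deriv d \<gamma> A s K (of_real x)) \<le> C * (y + x ^ d) powr (- Re s - real J)"
    using pow_deriv_bound[OF assms(1-4), of J K B] assms(5) K_def by auto
  have "compact ((\<lambda>x. bernpoly K (of_real x)) ` {0..1::real})"
    by (intro compact_continuous_image continuous_intros) auto
  then obtain P where P: "P \<ge> 0" "\<And>x. x \<in> {0..1::real} \<Longrightarrow> norm (bernpoly K (of_real x)) \<le> P"
    using bounded_pos compact_imp_bounded by (metis image_eqI less_imp_le)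
  show ?thesis
  proof (rule that[of "P * C * 4"])
    show "P * C * 4 \<ge> 0" using P C by simp
    fix A s :: complex and y :: real and m :: nat
    assume y: "y \<ge> 1" "g * y \<le> Re A" "norm A \<le> G * y" and s: "norm s \<le> B" "Re s + real J \<ge> 2"
    have RA: "Re A > 0" using y assms by (meson less_le_trans mult_pos_pos zero_less_one)
    have "norm (integral {0..1} (\<lambda>x. bernpoly K (of_real x) * pow_deriv d \<gamma> A s K (of_real (real m + x))))
      \<le> P * (C * (y powr (2 - (Re s + real J)) * (4 / (1 + real m)\<^sup>2)))"
    proof (rule norm_integral_unit_le)
      show "continuous_on {0..1} (\<lambda>x. bernpoly K (of_real x) * pow_deriv d \<gamma> A s K (of_real (real m + x)))"
        using assms RA by (intro continuous_intros continuous_on_pow_deriv) auto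
      fix x :: real assume x: "x \<in> {0..1}"
      have "norm (pow_deriv d \<gamma> A s K (of_real (real m + x))) \<le> C * (y + (real m + x) ^ d) powr (- (Re s + real J))"
        using C(2)[OF y s(1), of "real m + x"] x K_def by simp
      also have "\<dots> \<le> C * (y powr (2 - (Re s + real J)) * (4 / (1 + real m)\<^sup>2))"
        using C(1) y s x assms by (intro mult_left_mono powr_decay_bound) auto
      finally show "norm (bernpoly K (of_real x) * pow_deriv d \<gamma> A s K (of_real (real m + x)))
          \<le> P * (C * (y powr (2 - (Re s + real J)) * (4 / (1 + real m)\<^sup>2)))"
        unfolding norm_mult using P x by (intro mult_mono) auto
    qed
    moreover have "norm (em_unit d \<gamma> A s K m) \<le>
      norm (integral {0..1} (\<lambda>x. bernpoly K (of_real x) * pow_deriv d \<gamma> A s K (of_real (real m + x))))"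
      unfolding em_unit_def norm_mult by (intro mult_left_le_one_le) (auto simp: norm_divide norm_power fact_ge_1)
    ultimately show "norm (em_unit d \<gamma> A s (d * J) m) \<le> P * C * 4 * y powr (2 - Re s - real J) / (1 + real m)\<^sup>2"
      unfolding K_def by (simp add: algebra_simps)
  qed
qed

lemma em_rem_bound:
  fixes \<gamma> :: complex and B g G :: real
  assumes "g > 0" "g \<le> Re \<gamma>" "norm \<gamma> \<le> G" "d \<ge> 1" "B \<ge> 0"
  obtains C where "C \<ge> 0" "\<And>A y s. y \<ge> 1 \<Longrightarrow> g * y \<le> Re A \<Longrightarrow> norm A \<le> G * y \<Longrightarrow> norm s \<le> B \<Longrightarrow>
     Re s + real J \<ge> 2 \<Longrightarrow> norm (em_rem d \<gamma> A s J) \<le> C * y powr (2 - Re s - real J)"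
proof -
  obtain C where C: "C \<ge> 0" "\<And>A y s m. y \<ge> 1 \<Longrightarrow> g * y \<le> Re A \<Longrightarrow> norm A \<le> G * y \<Longrightarrow> norm s \<le> B \<Longrightarrow>
     Re s + real J \<ge> 2 \<Longrightarrow>
     norm (em_unit d \<gamma> A s (d * J) m) \<le> C * y powr (2 - Re s - real J) / (1 + real m)\<^sup>2"
    using em_unit_bound[OF assms, of J] by blast
  define Z where "Z = (\<Sum>\<^sub>\<infinity>m. 1 / (1 + real m)\<^sup>2)"
  have Z: "Z \<ge> 0" unfolding Z_def by (intro infsum_nonneg) auto
  show ?thesis
  proof (rule that[of "C * Z"])
    fix A s :: complex and y :: real
    assume y: "y \<ge> 1" "g * y \<le> Re A" "norm A \<le> G * y" and s: "norm s \<le> B" "Re s + real J \<ge> 2"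
    have "norm (em_rem d \<gamma> A s J) \<le> (\<Sum>\<^sub>\<infinity>m. C * y powr (2 - Re s - real J) / (1 + real m)\<^sup>2)"
      unfolding em_rem_def
      by (rule norm_infsum_le_infsum(2)[OF summable_on_inverse_square C(2)[OF y s]])
    also have "\<dots> = (\<Sum>\<^sub>\<infinity>m. (C * y powr (2 - Re s - real J)) * (1 / (1 + real m)\<^sup>2))" by simp
    also have "\<dots> = C * y powr (2 - Re s - real J) * Z"
      unfolding Z_def by (rule infsum_cmult_right')
    finally show "norm (em_rem d \<gamma> A s J) \<le> C * Z * y powr (2 - Re s - real J)" by (simp add: mult_ac)
  qed (use C Z in auto)
qed

lemma cone_witness:
  fixes A \<gamma> :: complex
  assumes "Re A > 0" "Re \<gamma> > 0"
  obtains g G :: real where "g > 0" "g \<le> Re \<gamma>" "norm \<gamma> \<le> G" "g * 1 \<le> Re A" "norm A \<le> G * 1"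
  using assms by (intro that[of "min (Re A) (Re \<gamma>)" "max (norm A) (norm \<gamma>)"]) auto

text \<open>Expanded by the definition of \<open>pow_deriv\<close>, the integral is a finite sum of
  polynomials in s times parameter integrals.\<close>

lemma em_unit_holomorphic:
  assumes "Re A > 0" "Re \<gamma> > 0" "d \<ge> 1"
  shows "(\<lambda>s. em_unit d \<gamma> A s K m) holomorphic_on UNIV"
proof -
  define h where "h x = complex_of_real (real m + x) ^ d" for x
  have hc: "continuous_on {0..1} h" unfolding h_def by (intro continuous_intros)
  define W where "W i x = bernpoly K (of_real x) * complex_of_real (real m + x) ^ (d * i - K)" for i x
  have Wc: "continuous_on {0..1} (W i)" for i unfolding W_def by (intro continuous_intros)
  have b: "Re (A + \<gamma> * h x) > 0" if "x \<in> {0..1}" for x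
    unfolding h_def using that assms by (intro Re_base_pos) auto
  have nz: "A + \<gamma> * h x \<noteq> 0" if "x \<in> {0..1}" for x
    using b[OF that] by (metis less_irrefl zero_complex.sel(1))
  have pc: "continuous_on {0..1} (\<lambda>x. (A + \<gamma> * h x) powr w)" for w
    using b nz by (intro continuous_on_powr_complex continuous_on_add continuous_on_mult continuous_on_const hc)
      (simp add: subset_iff less_imp_le, blast)
  have int: "(\<lambda>x. W i x * (A + \<gamma> * h x) powr (- s - of_nat i)) integrable_on {0..1}" for i s
    by (intro integrable_continuous_real continuous_on_mult Wc pc)
  have "em_unit d \<gamma> A s K m = - ((-1) ^ K / fact K) * (\<Sum>i\<le>K. faa_coeff d K i * (\<Prod>l<i. - s - of_nat l) * \<gamma> ^ i *
     integral {0..1} (\<lambda>x. W i x * (A + \<gamma> * h x) powr (- s - of_nat i)))" for s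
  proof -
    have "integral {0..1} (\<lambda>x. bernpoly K (of_real x) * pow_deriv d \<gamma> A s K (of_real (real m + x))) =
       integral {0..1} (\<lambda>x. \<Sum>i\<le>K. faa_coeff d K i * (\<Prod>l<i. - s - of_nat l) * \<gamma> ^ i *
          (W i x * (A + \<gamma> * h x) powr (- s - of_nat i)))"
      by (intro integral_cong) (simp add: pow_deriv_def sum_distrib_left W_def h_def mult_ac)
    also have "\<dots> = (\<Sum>i\<le>K. faa_coeff d K i * (\<Prod>l<i. - s - of_nat l) * \<gamma> ^ i *
     integral {0..1} (\<lambda>x. W i x * (A + \<gamma> * h x) powr (- s - of_nat i)))"
      by (subst integral_sum)
         (auto intro!: integrable_continuous_real continuous_on_mult continuous_on_const Wc pc)
    finally show ?thesis by (simp add: em_unit_def)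
  qed
  moreover have "(\<lambda>s. integral {0..1} (\<lambda>x. W i x * (A + \<gamma> * h x) powr (- s - of_nat i))) holomorphic_on UNIV" for i
    using holomorphic_on_unit_integral[OF Wc hc convex_UNIV, of A 0 \<gamma> 0 i "of_nat i" 1] b by (simp add: algebra_simps)
  ultimately show ?thesis by (auto intro!: holomorphic_intros)
qed

lemma open_Re_gt: "open {s. Re s > c}"
  by (rule open_halfspace_Re_gt)

lemma em_rem_holomorphic:
  assumes "Re A > 0" "Re \<gamma> > 0" "d \<ge> 1"
  shows "(\<lambda>s. em_rem d \<gamma> A s J) holomorphic_on {s. Re s > 2 - real J}"
  unfolding em_rem_def
proof (rule holomorphic_on_infsum[OF open_Re_gt])
  show "(\<lambda>s. em_unit d \<gamma> A s (d * J) m) holomorphic_on {s. Re s > 2 - real J}" for m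
    using em_unit_holomorphic[OF assms] by (rule holomorphic_on_subset) auto
  fix z assume z: "z \<in> {s. Re s > 2 - real J}"
  obtain g G where gG: "g > 0" "g \<le> Re \<gamma>" "norm \<gamma> \<le> G" "g * 1 \<le> Re A" "norm A \<le> G * 1"
    using cone_witness[OF assms(1,2)] .
  obtain C where C: "C \<ge> 0" "\<And>A y s m. y \<ge> 1 \<Longrightarrow> g * y \<le> Re A \<Longrightarrow> norm A \<le> G * y \<Longrightarrow> norm s \<le> norm z + 1 \<Longrightarrow>
     Re s + real J \<ge> 2 \<Longrightarrow>
     norm (em_unit d \<gamma> A s (d * J) m) \<le> C * y powr (2 - Re s - real J) / (1 + real m)\<^sup>2"
    using em_unit_bound[OF gG(1-3) assms(3), of "norm z + 1" J] by (smt (verit) norm_ge_zero)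
  have "\<forall>\<^sub>F w in nhds z. w \<in> {s. Re s > 2 - real J}"
    by (rule eventually_nhds_in_open[OF open_Re_gt z])
  moreover have "\<forall>\<^sub>F w in nhds z. norm w < norm z + 1"
    by (rule order_tendstoD(2)[of norm "norm z"]) (auto intro: tendsto_norm filterlim_ident)
  ultimately have "\<forall>\<^sub>F w in nhds z. \<forall>m\<in>UNIV. norm (em_unit d \<gamma> A w (d * J) m) \<le> C / (1 + real m)\<^sup>2"
    by eventually_elim (use C(2)[of 1 A] gG in auto)
  then show "\<exists>M. M summable_on UNIV \<and> (\<forall>\<^sub>F w in nhds z. \<forall>m\<in>UNIV. norm (em_unit d \<gamma> A w (d * J) m) \<le> M m)"
    using summable_on_inverse_square by blast
qed

lemma em_rem_eq_0:
  assumes "N < J" "d \<ge> 1"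
  shows "em_rem d \<gamma> A (- of_nat N) J = 0"
  using assms by (simp add: em_rem_def em_unit_def pow_deriv_eq_0)

section \<open>Expansion of the one-dimensional sum\<close>

text \<open>The substitution u = t^(1/d) turns the integral into that of the Beta function at (1/d,
  b).\<close>

lemma integral_one_minus_power:
  assumes "d \<ge> 1" "b > 1"
  shows "integral {0..1} (\<lambda>u::real. (1 - u ^ d) powr (b - 1)) = Beta (1 / real d) b / real d"
proof -
  define f where "f u = (1 - u ^ d) powr (b - 1)" for u :: real
  have fc: "continuous_on {0..1} f"
    unfolding f_def using assms by (intro continuous_on_powr' continuous_intros) (auto intro: power_le_one)
  have "((\<lambda>t. (1 / real d * t powr (1 / real d - 1)) *\<^sub>R f (t powr (1 / real d))) has_integral
      integral {0 powr (1 / real d)..1 powr (1 / real d)} f) {0..1}"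
  \<comment> \<open>The derivative of t^(1/d) is taken away from t = 0 only, so 0 is the exceptional
    point.\<close>
  proof (rule has_integral_substitution_strong[where s = "{0}" and c = 0 and d = 1])
    show "continuous_on {0..1} (\<lambda>t::real. t powr (1 / real d))"
      using assms by (intro continuous_on_powr' continuous_intros) auto
    show "((\<lambda>t. t powr (1 / real d)) has_field_derivative 1 / real d * x powr (1 / real d - 1)) (at x within {0..1})"
      if "x \<in> {0..1} - {0}" for x
      using that by (auto intro!: derivative_eq_intros)
    show "(\<lambda>t::real. t powr (1 / real d)) ` {0..1} \<subseteq> {0..1}"
      using powr_mono2[of "1 / real d" _ 1] by auto
  qed (use fc in auto)
  then have I: "((\<lambda>t. (1 / real d * t powr (1 / real d - 1)) *\<^sub>R f (t powr (1 / real d))) has_integral integral {0..1} f) {0..1}"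
    by simp
  have "f (t powr (1 / real d)) = (1 - t) powr (b - 1)" if "t \<in> {0..1}" for t
  proof -
    have "(t powr (1 / real d)) ^ d = t"
      using that assms by (cases "t = 0") (auto simp: powr_power)
    then show ?thesis by (simp add: f_def)
  qed
  then have "((\<lambda>t. 1 / real d * (t powr (1 / real d - 1) * (1 - t) powr (b - 1))) has_integral integral {0..1} f) {0..1}"
    by (intro has_integral_eq[OF _ I]) simp
  moreover have "((\<lambda>t. 1 / real d * (t powr (1 / real d - 1) * (1 - t) powr (b - 1))) has_integral (1 / real d * Beta (1 / real d) b)) {0..1}"
    using assms by (intro has_integral_mult_right has_integral_Beta_real) auto
  ultimately have "integral {0..1} f = 1 / real d * Beta (1 / real d) b" by (rule has_integral_unique)
  then show ?thesis unfolding f_def by simp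
qed

text \<open>The substitution \<open>u\<^sup>d = \<gamma> x\<^sup>d / (A + \<gamma> x\<^sup>d)\<close> has a continuous integrand on both sides.\<close>

lemma integral_binomial_power:
  fixes A \<gamma> s :: real
  assumes "A > 0" "\<gamma> > 0" "s > 2" "d \<ge> 1"
  shows "(\<lambda>M. integral {0..real M} (\<lambda>x. (A + \<gamma> * x ^ d) powr (- s))) \<longlonglongrightarrow>
     \<gamma> powr (- 1 / real d) * A powr (1 / real d - s) * (Beta (1 / real d) (s - 1 / real d) / real d)"
proof -
  define b where "b = s - 1 / real d"
  have "1 / real d \<le> 1" using assms by simp
  then have b: "b > 1" using assms(3) unfolding b_def by linarith
  define f where "f u = (1 - u ^ d) powr (b - 1)" for u :: real
  have fc: "continuous_on {0..1} f"
    unfolding f_def using b by (intro continuous_on_powr' continuous_intros) (auto intro: power_le_one)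
  define P where "P x = A + \<gamma> * x ^ d" for x
  have P: "P x > 0" if "x \<ge> 0" for x unfolding P_def using assms that by (intro add_pos_nonneg) auto
  \<comment> \<open>G x is the new variable u, so that 1 - G x ^ d = A / P x.\<close>
  define G where "G x = \<gamma> powr (1 / real d) * x * P x powr (- 1 / real d)" for x
  have Gd: "G x ^ d = \<gamma> * x ^ d / P x" if "x \<ge> 0" for x
  proof -
    have "(\<gamma> powr (1 / real d)) ^ d = \<gamma>" "(P x powr (- 1 / real d)) ^ d = 1 / P x"
      using assms P[OF that] powr_minus_divide[of "P x" 1] by (auto simp: powr_power)
    then show ?thesis by (simp add: G_def power_mult_distrib)
  qed
  have G0: "G x \<ge> 0" if "x \<ge> 0" for x unfolding G_def using that by simp
  have G1: "G x \<le> 1" if "x \<ge> 0" for x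
  proof -
    have "G x ^ d \<le> 1" unfolding Gd[OF that] using P[OF that] assms by (simp add: P_def field_simps)
    then show ?thesis using G0[OF that] assms by (simp add: power_le_one_iff)
  qed
  \<comment> \<open>The constant for which G'(x) * f (G x) = c * P x powr (- s): one factor A from
    the derivative, A^(b - 1) from f.\<close>
  define c where "c = \<gamma> powr (1 / real d) * A powr b"
  have c: "c > 0" using assms by (simp add: c_def)
  have int: "integral {0..real M} (\<lambda>x. (A + \<gamma> * x ^ d) powr (- s)) = integral {0..G (real M)} f / c" for M
  proof -
    have "((\<lambda>x. (\<gamma> powr (1 / real d) * A * P x powr (- 1 / real d - 1)) *\<^sub>R f (G x)) has_integral
        integral {G 0..G (real M)} f) {0..real M}"
    proof (rule has_integral_substitution[where c = 0 and d = 1])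
      fix x assume x: "x \<in> {0..real M}"
      then have Px: "P x > 0" using P by simp
      have eq0: "x * (P x powr (- 1 / real d - 1) * (\<gamma> * (real d * x ^ (d - 1)))) / real d
         = P x powr (- 1 / real d - 1) * (\<gamma> * x ^ d)"
        using assms by (cases d) auto
      have "P x powr (- 1 / real d) = P x powr (- 1 / real d - 1) * P x"
        using Px by (simp add: powr_diff)
      then have eq: "P x powr (- 1 / real d) - P x powr (- 1 / real d - 1) * (\<gamma> * x ^ d) = A * P x powr (- 1 / real d - 1)"
        by (simp add: P_def algebra_simps)
      have dP: "(P has_field_derivative (\<gamma> * (real d * x ^ (d - 1)))) (at x within {0..real M})"
        unfolding P_def by (auto intro!: derivative_eq_intros)
      have "((\<lambda>x. P x powr (- 1 / real d)) has_field_derivative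
         (- 1 / real d) * P x powr (- 1 / real d - 1) * (\<gamma> * (real d * x ^ (d - 1)))) (at x within {0..real M})"
        using has_real_derivative_powr[OF Px, of "- 1 / real d"] dP by (rule DERIV_chain2)
      then have "(G has_field_derivative \<gamma> powr (1 / real d) * (P x powr (- 1 / real d) +
          x * ((- 1 / real d) * P x powr (- 1 / real d - 1) * (\<gamma> * (real d * x ^ (d - 1)))))) (at x within {0..real M})"
        unfolding G_def mult.assoc
        by (intro DERIV_cmult) (use DERIV_mult[OF DERIV_ident] in \<open>fastforce simp: add.commute mult_ac\<close>)
      also have "P x powr (- 1 / real d) + x * ((- 1 / real d) * P x powr (- 1 / real d - 1) * (\<gamma> * (real d * x ^ (d - 1))))
         = P x powr (- 1 / real d) - P x powr (- 1 / real d - 1) * (\<gamma> * x ^ d)"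
        unfolding eq0[symmetric] by (simp add: mult_ac)
      also have "\<dots> = A * P x powr (- 1 / real d - 1)" by (rule eq)
      finally show "(G has_field_derivative \<gamma> powr (1 / real d) * A * P x powr (- 1 / real d - 1)) (at x within {0..real M})"
        by (simp add: mult_ac)
    qed (use fc G0 G1 in \<open>auto simp: G_def\<close>)
    moreover have "(\<gamma> powr (1 / real d) * A * P x powr (- 1 / real d - 1)) * f (G x) = c * P x powr (- s)"
      if "x \<in> {0..real M}" for x
    proof -
      have Px: "P x > 0" using P that by simp
      have "1 - \<gamma> * x ^ d / P x = A / P x" using Px by (simp add: P_def field_simps)
      then have "f (G x) = (A / P x) powr (b - 1)" using that by (simp add: f_def Gd)
      also have "\<dots> = A powr (b - 1) * P x powr (1 - b)"
        using Px assms by (simp add: powr_divide powr_diff field_simps)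
      finally have "f (G x) = A powr (b - 1) * P x powr (1 - b)" .
      then have "(\<gamma> powr (1 / real d) * A * P x powr (- 1 / real d - 1)) * f (G x) =
         \<gamma> powr (1 / real d) * (A powr 1 * A powr (b - 1)) * (P x powr (- 1 / real d - 1) * P x powr (1 - b))"
        using assms by simp
      also have "A powr 1 * A powr (b - 1) = A powr b"
        by (simp only: powr_add[symmetric]) simp
      also have "P x powr (- 1 / real d - 1) * P x powr (1 - b) = P x powr (- s)"
        by (simp only: powr_add[symmetric]) (simp add: b_def)
      finally show ?thesis by (simp add: c_def)
    qed
    ultimately have "((\<lambda>x. c * P x powr (- s)) has_integral integral {G 0..G (real M)} f) {0..real M}"
      by (elim has_integral_eq[rotated]) simp
    then have "((\<lambda>x. inverse c * (c * P x powr (- s))) has_integral inverse c * integral {G 0..G (real M)} f) {0..real M}"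
      by (rule has_integral_mult_right)
    moreover have "inverse c * (c * P x powr (- s)) = (A + \<gamma> * x ^ d) powr (- s)" for x
      using c by (simp add: P_def)
    ultimately show ?thesis
      by (intro integral_unique) (simp add: G_def divide_inverse mult.commute)
  qed
  have "filterlim (\<lambda>M. \<gamma> * real M ^ d) at_top sequentially"
    using assms by (intro filterlim_tendsto_pos_mult_at_top[OF tendsto_const] filterlim_pow_at_top filterlim_real_sequentially) auto
  then have "filterlim (\<lambda>M. P (real M)) at_top sequentially"
    unfolding P_def by (intro filterlim_tendsto_add_at_top[OF tendsto_const])
  then have "(\<lambda>M. 1 - A / P (real M)) \<longlonglongrightarrow> 1 - 0"
    by (intro tendsto_diff tendsto_const tendsto_divide_0[OF tendsto_const] filterlim_at_top_imp_at_infinity)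
  then have "(\<lambda>M. (1 - A / P (real M)) powr (1 / real d)) \<longlonglongrightarrow> (1 - 0) powr (1 / real d)"
    by (intro tendsto_powr tendsto_const) auto
  moreover have "(1 - A / P (real M)) powr (1 / real d) = G (real M)" for M
  proof -
    have "1 - A / P (real M) = G (real M) ^ d"
      using P[of "real M"] by (simp add: Gd) (simp add: P_def field_simps)
    then show ?thesis using G0[of "real M"] assms
      by (cases "G (real M) = 0") (auto simp: powr_powr powr_realpow[symmetric])
  qed
  ultimately have "(\<lambda>M. G (real M)) \<longlonglongrightarrow> 1" by simp
  moreover have "continuous_on {0..1} (\<lambda>u. integral {0..u} f)"
    by (intro indefinite_integral_continuous_1 integrable_continuous_real fc)
  ultimately have "(\<lambda>M. integral {0..G (real M)} f) \<longlonglongrightarrow> integral {0..1} f"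
    using G0 G1 by (intro continuous_on_tendsto_compose[where f = "\<lambda>u. integral {0..u} f" and s = "{0..1}"]) auto
  then have "(\<lambda>M. integral {0..G (real M)} f / c) \<longlonglongrightarrow> integral {0..1} f / c"
    using c by (intro tendsto_divide tendsto_const) auto
  moreover have "integral {0..1} f / c = \<gamma> powr (- 1 / real d) * A powr (1 / real d - s) * (Beta (1 / real d) (s - 1 / real d) / real d)"
    using integral_one_minus_power[OF assms(4) b] unfolding f_def c_def b_def
    by (simp add: powr_minus_divide powr_diff field_simps)
  ultimately show ?thesis unfolding int by simp
qed

lemma integral_unit_sum:
  fixes f :: "real \<Rightarrow> complex"
  assumes "continuous_on {0..} f"
  shows "integral {0..real M} f = (\<Sum>m<M. integral {0..1} (\<lambda>x. f (real m + x)))"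
proof (induction M)
  case (Suc M)
  have int: "f integrable_on {0..real (Suc M)}"
    by (intro integrable_continuous_real continuous_on_subset[OF assms]) auto
  have "integral {0..real (Suc M)} f = integral {0..real M} f + integral {real M..real (Suc M)} f"
    using Henstock_Kurzweil_Integration.integral_combine[OF _ _ int, of "real M"] by simp
  also have "integral {real M..real (Suc M)} f = integral {0..1} (\<lambda>x. f (real M + x))"
    using integral_shift_Icc_real[of 0 1 f "real M"] by (simp add: add.commute o_def)
  finally show ?case using Suc by simp
qed simp

section \<open>The main term for complex parameters\<close>

definition em_int :: "nat \<Rightarrow> complex \<Rightarrow> complex \<Rightarrow> complex \<Rightarrow> nat \<Rightarrow> complex" where
  "em_int d \<gamma> A s m = integral {0..1} (\<lambda>x. (A + \<gamma> * of_real (real m + x) ^ d) powr (- s))"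

text \<open>The integral over the half line is taken as a series over unit intervals, which puts it
  under the same Weierstrass argument as the remainder.\<close>

definition em_main :: "nat \<Rightarrow> complex \<Rightarrow> complex \<Rightarrow> complex \<Rightarrow> complex" where
  "em_main d \<gamma> A s = (\<Sum>\<^sub>\<infinity>m. em_int d \<gamma> A s m)"

lemma binomial_power_bound:
  assumes "g > 0" "g \<le> Re \<gamma>" "norm \<gamma> \<le> G" "g \<le> Re A" "norm A \<le> G" "norm s \<le> B" "Re s \<ge> 2" "d \<ge> 1"
    and "x \<ge> real m"
  shows "norm ((A + \<gamma> * of_real x ^ d) powr (- s)) \<le> (powr_const g G B * 4) / (1 + real m)\<^sup>2"
proof -
  have x: "x \<ge> 0" using assms(9) of_nat_0_le_iff[of m] by linarith
  have "x ^ d \<ge> 0" using x by simp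
  then have Y: "1 + x ^ d > 0" by linarith
  have "norm ((A + \<gamma> * of_real x ^ d) powr (- s)) \<le> powr_const g G B * (1 + x ^ d) powr (- Re s)"
    using base_bounds[of g 1 A G \<gamma> x d] assms x Y by (intro norm_powr_bound) auto
  also have "\<dots> \<le> powr_const g G B * (1 powr (2 - Re s) * (4 / (1 + real m)\<^sup>2))"
    using assms by (intro mult_left_mono powr_decay_bound) auto
  finally show ?thesis by simp
qed

lemma continuous_on_binomial_power:
  assumes "Re A > 0" "Re \<gamma> > 0"
  shows "continuous_on {0..} (\<lambda>x. (A + \<gamma> * of_real x ^ d) powr (- s))"
proof (intro continuous_on_powr_complex continuous_on_add continuous_on_mult continuous_on_power
    continuous_on_const continuous_on_of_real continuous_on_id)
  show "{0..} \<subseteq> {x. Re (A + \<gamma> * of_real x ^ d) \<ge> 0 \<or> Im (A + \<gamma> * of_real x ^ d) \<noteq> 0}"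
    using Re_base_pos[OF assms] by (simp add: subset_iff less_imp_le)
  fix x :: real assume "x \<in> {0..}" "A + \<gamma> * of_real x ^ d = 0"
  then have False using Re_base_pos[OF assms, of x d] by simp
  then show "Re (- s) > 0" ..
qed

lemma em_int_bound:
  assumes "g > 0" "g \<le> Re \<gamma>" "norm \<gamma> \<le> G" "g \<le> Re A" "norm A \<le> G" "norm s \<le> B" "Re s \<ge> 2" "d \<ge> 1"
  shows "norm (em_int d \<gamma> A s m) \<le> (powr_const g G B * 4) / (1 + real m)\<^sup>2"
  unfolding em_int_def
proof (rule norm_integral_unit_le)
  show "continuous_on {0..1} (\<lambda>x. (A + \<gamma> * of_real (real m + x) ^ d) powr (- s))"
    using assms by (intro continuous_on_compose2[OF continuous_on_binomial_power[of A \<gamma> d s], of _ "\<lambda>x. real m + x"]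
        continuous_intros) auto
qed (use assms in \<open>auto intro!: binomial_power_bound simp del: of_real_add\<close>)

lemma em_int_sums:
  assumes "Re A > 0" "Re \<gamma> > 0" "Re s \<ge> 2" "d \<ge> 1"
  shows "em_int d \<gamma> A s sums em_main d \<gamma> A s"
proof -
  obtain g G where gG: "g > 0" "g \<le> Re \<gamma>" "norm \<gamma> \<le> G" "g * 1 \<le> Re A" "norm A \<le> G * 1"
    using cone_witness[OF assms(1,2)] .
  have "norm (em_int d \<gamma> A s m) \<le> (powr_const g G (norm s) * 4) / (1 + real m)\<^sup>2" for m
    using gG assms by (intro em_int_bound) auto
  then have "em_int d \<gamma> A s summable_on UNIV"
    by (intro norm_infsum_le_infsum(1)[OF summable_on_inverse_square])
  then show ?thesis
    unfolding em_main_def by (intro has_sum_imp_sums has_sum_infsum)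
qed

text \<open>Affine dependence of all three parameters on one variable z makes holomorphy in s, in
  \<gamma> and in A instances of a single statement.\<close>

lemma em_main_holomorphic:
  assumes U: "open U" "convex U" and d: "d \<ge> 1"
    and A: "\<And>z. z \<in> U \<Longrightarrow> Re (a0 + a1 * z) > 0" and \<gamma>: "\<And>z. z \<in> U \<Longrightarrow> Re (g0 + g1 * z) > 0"
    and s: "\<And>z. z \<in> U \<Longrightarrow> Re (s0 + s1 * z) > 2"
  shows "(\<lambda>z. em_main d (g0 + g1 * z) (a0 + a1 * z) (s0 + s1 * z)) holomorphic_on U"
  unfolding em_main_def
proof (rule holomorphic_on_infsum[OF U(1)])
  fix m
  have "Re (a0 + a1 * z + (g0 + g1 * z) * of_real (real m + x) ^ d) > 0" if "z \<in> U" "x \<in> {0..1}" for z x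
    using that by (intro Re_base_pos A \<gamma>) auto
  then show "(\<lambda>z. em_int d (g0 + g1 * z) (a0 + a1 * z) (s0 + s1 * z) m) holomorphic_on U"
    using holomorphic_on_unit_integral[of "\<lambda>_. 1" "\<lambda>x. of_real (real m + x) ^ d" U a0 a1 g0 g1 s0 s1] U
    unfolding em_int_def by (simp add: continuous_intros del: of_real_add plus_complex.simps times_complex.simps)
next
  fix z assume z: "z \<in> U"
  define g where "g = min (Re (g0 + g1 * z) / 2) (Re (a0 + a1 * z) / 2)"
  define G where "G = max (norm (g0 + g1 * z) + 1) (norm (a0 + a1 * z) + 1)"
  define B where "B = norm (s0 + s1 * z) + 1"
  have g: "g > 0" using A[OF z] \<gamma>[OF z] by (simp add: g_def)
  have lin: "((\<lambda>w. p + q * w) \<longlongrightarrow> p + q * z) (nhds z)" for p q :: complex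
    by (intro tendsto_intros filterlim_ident)
  have evR: "\<forall>\<^sub>F w in nhds z. Re (p + q * w) > c" if "Re (p + q * z) > c" for p q c
    using order_tendstoD(1)[OF tendsto_Re[OF lin[of p q]] that] .
  have evN: "\<forall>\<^sub>F w in nhds z. norm (p + q * w) < norm (p + q * z) + 1" for p q
    by (rule order_tendstoD(2)[OF tendsto_norm[OF lin[of p q]]]) simp
  have "\<forall>\<^sub>F w in nhds z. Re (g0 + g1 * w) > g" "\<forall>\<^sub>F w in nhds z. Re (a0 + a1 * w) > g"
    using A[OF z] \<gamma>[OF z] by (intro evR; simp add: g_def min_def)+
  moreover have "\<forall>\<^sub>F w in nhds z. Re (s0 + s1 * w) > 2" using s[OF z] by (rule evR)
  ultimately have "\<forall>\<^sub>F w in nhds z. \<forall>m\<in>UNIV. norm (em_int d (g0 + g1 * w) (a0 + a1 * w) (s0 + s1 * w) m)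
      \<le> (powr_const g G B * 4) / (1 + real m)\<^sup>2"
    using evN[of g0 g1] evN[of a0 a1] evN[of s0 s1]
  proof eventually_elim
    case (elim w)
    then show ?case using g d by (intro ballI em_int_bound) (auto simp: G_def B_def)
  qed
  then show "\<exists>M. M summable_on UNIV \<and>
      (\<forall>\<^sub>F w in nhds z. \<forall>m\<in>UNIV. norm (em_int d (g0 + g1 * w) (a0 + a1 * w) (s0 + s1 * w) m) \<le> M m)"
    using summable_on_inverse_square by blast
qed

text \<open>The zeros on the real ray accumulate at its point c' + 1.\<close>

lemma halfplane_identity:
  assumes "f holomorphic_on {z. Re z > c}" "\<And>x. x > c' \<Longrightarrow> f (of_real x) = 0" "c \<le> c'" "Re z > c"
  shows "f z = 0"
proof (rule analytic_continuation[OF assms(1) open_Re_gt])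
  show "connected {z. Re z > c}" by (intro convex_connected convex_halfspace_Re_gt)
  show "complex_of_real ` {c'<..} \<subseteq> {z. Re z > c}" "complex_of_real (c' + 1) \<in> {z. Re z > c}" "z \<in> {z. Re z > c}"
    using assms(3,4) by auto
  show "complex_of_real (c' + 1) islimpt complex_of_real ` {c'<..}"
    unfolding islimpt_approachable
  proof (intro allI impI)
    fix e :: real assume "e > 0"
    then show "\<exists>x'\<in>complex_of_real ` {c'<..}. x' \<noteq> complex_of_real (c' + 1) \<and> dist x' (complex_of_real (c' + 1)) < e"
      by (intro bexI[of _ "complex_of_real (c' + 1 + e / 2)"])
         (auto simp: dist_norm simp del: of_real_add simp flip: of_real_diff)
  qed
qed (use assms(2) in auto)

definition main_const :: "nat \<Rightarrow> complex \<Rightarrow> complex" where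
  "main_const d \<gamma> = \<gamma> powr (- (1 / of_nat d)) * Gamma (1 / of_nat d) / of_nat d"

lemma em_main_eq_real:
  fixes A \<gamma> s :: real
  assumes "A > 0" "\<gamma> > 0" "s > 2" "d \<ge> 1"
  shows "em_main d (of_real \<gamma>) (of_real A) (of_real s) = main_const d (of_real \<gamma>) *
     (Gamma (of_real s - 1 / of_nat d) * rGamma (of_real s)) * of_real A powr (1 / of_nat d - of_real s)"
proof -
  define L where "L = \<gamma> powr (- 1 / real d) * A powr (1 / real d - s) * (Beta (1 / real d) (s - 1 / real d) / real d)"
  have "(\<lambda>M. integral {0..real M} (\<lambda>x. (A + \<gamma> * x ^ d) powr (- s))) \<longlonglongrightarrow> L"
    unfolding L_def by (rule integral_binomial_power[OF assms])
  then have "(\<lambda>M. complex_of_real (integral {0..real M} (\<lambda>x. (A + \<gamma> * x ^ d) powr (- s)))) \<longlonglongrightarrow> of_real L"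
    by (rule tendsto_of_real)
  moreover have "complex_of_real (integral {0..real M} (\<lambda>x. (A + \<gamma> * x ^ d) powr (- s))) =
     (\<Sum>m<M. em_int d (of_real \<gamma>) (of_real A) (of_real s) m)" for M
  proof -
    have pos: "A + \<gamma> * x ^ d > 0" if "x \<ge> 0" for x using assms that by (intro add_pos_nonneg) auto
    have "continuous_on {0..real M} (\<lambda>x. (A + \<gamma> * x ^ d) powr (- s))"
      using pos by (intro continuous_on_powr continuous_intros) (auto simp: less_imp_neq[symmetric])
    then have "((\<lambda>x. complex_of_real ((A + \<gamma> * x ^ d) powr (- s))) has_integral
        complex_of_real (integral {0..real M} (\<lambda>x. (A + \<gamma> * x ^ d) powr (- s)))) {0..real M}"
      by (intro has_integral_of_real integrable_integral integrable_continuous_real)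
    then have "complex_of_real (integral {0..real M} (\<lambda>x. (A + \<gamma> * x ^ d) powr (- s))) =
       integral {0..real M} (\<lambda>x. complex_of_real ((A + \<gamma> * x ^ d) powr (- s)))"
      by (rule integral_unique[symmetric])
    also have "\<dots> = integral {0..real M} (\<lambda>x. (of_real A + of_real \<gamma> * of_real x ^ d) powr (- of_real s))"
    proof (intro integral_cong)
      fix x assume "x \<in> {0..real M}"
      then show "complex_of_real ((A + \<gamma> * x ^ d) powr (- s)) = (of_real A + of_real \<gamma> * of_real x ^ d) powr (- of_real s)"
        using powr_of_real[of "A + \<gamma> * x ^ d" "- s"] pos[of x] by simp
    qed
    also have "\<dots> = (\<Sum>m<M. em_int d (of_real \<gamma>) (of_real A) (of_real s) m)"
      unfolding em_int_def using assms by (intro integral_unit_sum continuous_on_binomial_power) auto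
    finally show ?thesis .
  qed
  ultimately have "em_int d (of_real \<gamma>) (of_real A) (of_real s) sums of_real L" by (simp add: sums_def)
  then have "em_main d (of_real \<gamma>) (of_real A) (of_real s) = of_real L"
    using em_int_sums[of "of_real A" "of_real \<gamma>" "of_real s" d] assms sums_unique2 by auto
  also have "of_real L = main_const d (of_real \<gamma>) *
     (Gamma (of_real s - 1 / of_nat d) * rGamma (of_real s)) * of_real A powr (1 / of_nat d - of_real s)"
  proof -
    have "complex_of_real (\<gamma> powr (- 1 / real d)) = of_real \<gamma> powr (- (1 / of_nat d))"
      using powr_of_real[of \<gamma> "- 1 / real d"] assms by simp
    moreover have "complex_of_real (A powr (1 / real d - s)) = of_real A powr (1 / of_nat d - of_real s)"
      using powr_of_real[of A "1 / real d - s"] assms by simp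
    moreover have "complex_of_real (Beta (1 / real d) (s - 1 / real d)) =
       Gamma (1 / of_nat d) * (Gamma (of_real s - 1 / of_nat d) * rGamma (of_real s))"
      using Gamma_complex_of_real[of "1 / real d"] Gamma_complex_of_real[of "s - 1 / real d"] Gamma_complex_of_real[of s]
      by (simp add: Beta_def rGamma_inverse_Gamma field_simps)
    ultimately show ?thesis unfolding L_def main_const_def of_real_mult of_real_divide by (simp add: mult_ac)
  qed
  finally show ?thesis .
qed

text \<open>Both sides are continued from positive real parameters one variable at a time: s with A
  and \<gamma> real, then \<gamma> with A real, and A last. Right half-planes avoid the branch cut,
  so principal powers are preserved.\<close>

lemma em_main_eq:
  assumes A: "Re A > 0" and \<gamma>: "Re \<gamma> > 0" and s: "Re s > 2" and d: "d \<ge> 1"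
  shows "em_main d \<gamma> A s = main_const d \<gamma> * (Gamma (s - 1 / of_nat d) * rGamma s) * A powr (1 / of_nat d - s)"
proof -
  define R where "R \<gamma> A s = main_const d \<gamma> * (Gamma (s - 1 / of_nat d) * rGamma s) * A powr (1 / of_nat d - s)"
    for \<gamma> A s :: complex
  have Rne: "z \<notin> \<real>\<^sub>\<le>\<^sub>0" if "Re z > 0" for z using that by (auto simp: complex_nonpos_Reals_iff)
  have Gne: "s - 1 / of_nat d \<notin> \<int>\<^sub>\<le>\<^sub>0" if "Re s > 2" for s
  proof -
    have "1 / real d \<le> 1" using d by simp
    then have pos: "Re (s - 1 / of_nat d) > 0" using that by (simp add: Re_divide_of_nat)
    show ?thesis
    proof
      assume "s - 1 / of_nat d \<in> \<int>\<^sub>\<le>\<^sub>0"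
      then obtain n where "s - 1 / of_nat d = of_int n" "n \<le> 0" by (rule nonpos_Ints_cases)
      then show False using pos by (simp only:) simp
    qed
  qed
  have 1: "em_main d (of_real \<gamma>) (of_real A) s = R (of_real \<gamma>) (of_real A) s" if "A > 0" "\<gamma> > 0" "Re s > 2"
    for A \<gamma> :: real and s
  proof -
    have "(\<lambda>s. em_main d (of_real \<gamma>) (of_real A) s - R (of_real \<gamma>) (of_real A) s) holomorphic_on {s. Re s > 2}"
    proof (rule holomorphic_on_diff)
      show "(\<lambda>s. em_main d (of_real \<gamma>) (of_real A) s) holomorphic_on {s. Re s > 2}"
        using em_main_holomorphic[OF open_Re_gt[of 2] convex_halfspace_Re_gt d, of "of_real A" 0 "of_real \<gamma>" 0 0 1] that
        by simp
      show "(\<lambda>s. R (of_real \<gamma>) (of_real A) s) holomorphic_on {s. Re s > 2}"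
        unfolding R_def using that Gne by (intro holomorphic_intros) auto
    qed
    then have "em_main d (of_real \<gamma>) (of_real A) s - R (of_real \<gamma>) (of_real A) s = 0"
      by (rule halfplane_identity[where c' = 2]) (use that d in \<open>auto simp: em_main_eq_real R_def\<close>)
    then show ?thesis by simp
  qed
  have 2: "em_main d \<gamma> (of_real A) s = R \<gamma> (of_real A) s" if "A > 0" "Re \<gamma> > 0" for A :: real and \<gamma>
  proof -
    have "(\<lambda>\<gamma>. em_main d \<gamma> (of_real A) s - R \<gamma> (of_real A) s) holomorphic_on {s. Re s > 0}"
    proof (rule holomorphic_on_diff)
      show "(\<lambda>\<gamma>. em_main d \<gamma> (of_real A) s) holomorphic_on {s. Re s > 0}"
        using em_main_holomorphic[OF open_Re_gt[of 0] convex_halfspace_Re_gt d, of "of_real A" 0 0 1 s 0] that s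
        by simp
      show "(\<lambda>\<gamma>. R \<gamma> (of_real A) s) holomorphic_on {s. Re s > 0}"
        unfolding R_def main_const_def using Rne d by (intro holomorphic_intros) auto
    qed
    then have "em_main d \<gamma> (of_real A) s - R \<gamma> (of_real A) s = 0"
      by (rule halfplane_identity[where c' = 0]) (use that 1 s in auto)
    then show ?thesis by simp
  qed
  have "(\<lambda>A. em_main d \<gamma> A s - R \<gamma> A s) holomorphic_on {s. Re s > 0}"
  proof (rule holomorphic_on_diff)
    show "(\<lambda>A. em_main d \<gamma> A s) holomorphic_on {s. Re s > 0}"
      using em_main_holomorphic[OF open_Re_gt[of 0] convex_halfspace_Re_gt d, of 0 1 \<gamma> 0 s 0] \<gamma> s
      by simp
    show "(\<lambda>A. R \<gamma> A s) holomorphic_on {s. Re s > 0}"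
      unfolding R_def using Rne by (intro holomorphic_intros) auto
  qed
  then have "em_main d \<gamma> A s - R \<gamma> A s = 0"
    by (rule halfplane_identity[where c' = 0]) (use 2 \<gamma> A in auto)
  then show ?thesis by (simp add: R_def)
qed

text \<open>The boundary term of order k = d * i at 0, where the k! of the derivative against the (k
  + 1)! of Euler-Maclaurin leaves 1 / (d * i + 1).\<close>

definition em_coeff :: "nat \<Rightarrow> complex \<Rightarrow> complex \<Rightarrow> nat \<Rightarrow> complex" where
  "em_coeff d \<gamma> s i = bernoulli_plus (d * i + 1) / of_nat (d * i + 1) * ((- s) gchoose i) * \<gamma> ^ i"

lemma sum_dvd_reindex:
  fixes h :: "nat \<Rightarrow> 'a :: comm_monoid_add"
  assumes "d \<ge> 1"
  shows "(\<Sum>k<d * J. if d dvd k then h k else 0) = (\<Sum>i<J. h (d * i))"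
proof -
  have "(\<Sum>k<d * J. if d dvd k then h k else 0) = (\<Sum>k\<in>(*) d ` {..<J}. if d dvd k then h k else 0)"
    by (rule sum.mono_neutral_right) (use assms in auto)
  also have "\<dots> = (\<Sum>i<J. h (d * i))"
    using assms by (subst sum.reindex) (auto simp: inj_on_def)
  finally show ?thesis .
qed

text \<open>The unit-interval formula is summed over m < M. Its boundary terms telescope; those at M
  tend to 0, while those at 0 are nonzero only for orders divisible by d and give the powers A^(-s -
  i).\<close>

theorem power_sum_expansion:
  assumes A: "Re A > 0" and \<gamma>: "Re \<gamma> > 0" and s: "Re s > 2" and d: "d \<ge> 1" and J: "J \<ge> 1"
  shows "(\<lambda>k. norm ((A + \<gamma> * of_nat (k ^ d)) powr (- s))) summable_on {1..}"
    and "(\<Sum>\<^sub>\<infinity>k\<in>{1..}. (A + \<gamma> * of_nat (k ^ d)) powr (- s)) =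
       main_const d \<gamma> * (Gamma (s - 1 / of_nat d) * rGamma s) * A powr (1 / of_nat d - s) -
       (\<Sum>i<J. em_coeff d \<gamma> s i * A powr (- s - of_nat i)) + em_rem d \<gamma> A s J"
proof -
  define f where "f k = (A + \<gamma> * of_nat (k ^ d)) powr (- s)" for k :: nat
  define K where "K = d * J"
  have K: "K \<ge> 1" using d J by (simp add: K_def)
  obtain g G where gG: "g > 0" "g \<le> Re \<gamma>" "norm \<gamma> \<le> G" "g * 1 \<le> Re A" "norm A \<le> G * 1"
    using cone_witness[OF A \<gamma>] .
  have fb: "norm (f (Suc m)) \<le> (powr_const g G (norm s) * 4) / (1 + real m)\<^sup>2" for m
    unfolding f_def using binomial_power_bound[of g \<gamma> G A s "norm s" d m "real (Suc m)"] gG s d by simp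
  have img: "{1..} = Suc ` UNIV" by (auto simp: image_iff Suc_le_eq gr0_conv_Suc)
  have "(\<lambda>m. norm (f (Suc m))) summable_on UNIV"
    by (rule Infinite_Sum.abs_summable_on_comparison_test'[OF summable_on_inverse_square fb])
  then show asum: "(\<lambda>k. norm (f k)) summable_on {1..}" unfolding img
    by (subst summable_on_reindex) (auto simp: o_def)
  then have "f summable_on {1..}" by (rule Infinite_Sum.abs_summable_summable)
  then have "(f has_sum infsum f {1..}) {1..}" by (rule has_sum_infsum)
  then have "((\<lambda>m. f (Suc m)) has_sum infsum f {1..}) UNIV"
    unfolding img by (subst (asm) has_sum_reindex) (auto simp: o_def)
  then have s1: "(\<lambda>M. \<Sum>m<M. f (Suc m)) \<longlonglongrightarrow> infsum f {1..}"
    using has_sum_imp_sums by (auto simp: sums_def)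
  have s2: "(\<lambda>M. \<Sum>m<M. em_int d \<gamma> A s m) \<longlonglongrightarrow> em_main d \<gamma> A s"
    using em_int_sums[OF A \<gamma> _ d, of s] s by (simp add: sums_def)
  obtain C where C: "C \<ge> 0" "\<And>A y t m. y \<ge> 1 \<Longrightarrow> g * y \<le> Re A \<Longrightarrow> norm A \<le> G * y \<Longrightarrow> norm t \<le> norm s \<Longrightarrow>
     Re t + real J \<ge> 2 \<Longrightarrow>
     norm (em_unit d \<gamma> A t (d * J) m) \<le> C * y powr (2 - Re t - real J) / (1 + real m)\<^sup>2"
    using em_unit_bound[OF gG(1-3) d, of "norm s" J] by (metis norm_ge_zero)
  have "em_unit d \<gamma> A s K summable_on UNIV"
    using C(2)[of 1 A s] gG s unfolding K_def
    by (intro norm_infsum_le_infsum(1)[OF summable_on_inverse_square[of C]]) auto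
  then have s3: "(\<lambda>M. \<Sum>m<M. em_unit d \<gamma> A s K m) \<longlonglongrightarrow> em_rem d \<gamma> A s J"
    unfolding em_rem_def K_def using has_sum_imp_sums has_sum_infsum by (auto simp: sums_def)
  define p where "p k x = pow_deriv d \<gamma> A s k (of_real x)" for k and x :: real
  have dp: "((\<lambda>x. p k (real m + x)) has_vector_derivative p (Suc k) (real m + x)) (at x within {0..1})"
    if "x \<in> {0..1}" for k m x
  proof -
    have nz: "A + \<gamma> * (of_nat m + of_real x) ^ d \<notin> \<real>\<^sub>\<le>\<^sub>0"
      using base_nonpos[OF A \<gamma>, of "real m + x" d] that by simp
    have "((\<lambda>z. pow_deriv d \<gamma> A s k (of_nat m + z)) has_field_derivative pow_deriv d \<gamma> A s (Suc k) (of_nat m + of_real x) * 1) (at (of_real x))"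
      by (rule DERIV_chain2[where f = "pow_deriv d \<gamma> A s k" and g = "\<lambda>z. of_nat m + z", OF pow_deriv_has_derivative[OF nz d]])
         (auto intro!: derivative_eq_intros)
    from has_vector_derivative_real_field[OF this] show ?thesis by (simp add: p_def)
  qed
  have unit: "f (Suc m) = em_int d \<gamma> A s m + (\<Sum>k<K. bernoulli_plus (Suc k) / fact (Suc k) * (p k (real (Suc m)) - p k (real m)))
     + em_unit d \<gamma> A s K m" for m
    using Euler_Maclaurin_unit[of "\<lambda>k x. p k (real m + x)" K, OF dp K]
    by (simp add: p_def pow_deriv_0 f_def em_int_def em_unit_def add.commute)
  define bd where "bd M = (\<Sum>k<K. bernoulli_plus (Suc k) / fact (Suc k) * (p k (real M) - p k 0))" for M
  have "(\<Sum>m<M. f (Suc m)) = (\<Sum>m<M. em_int d \<gamma> A s m) + bd M + (\<Sum>m<M. em_unit d \<gamma> A s K m)" for M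
  proof (induction M)
    case (Suc M)
    have "bd (Suc M) = bd M + (\<Sum>k<K. bernoulli_plus (Suc k) / fact (Suc k) * (p k (real (Suc M)) - p k (real M)))"
      unfolding bd_def sum.distrib[symmetric] by (intro sum.cong) (simp_all add: ring_distribs del: of_nat_Suc)
    then show ?case using Suc by (simp add: unit del: of_nat_Suc)
  qed (simp add: bd_def)
  moreover have "bd \<longlonglongrightarrow> (\<Sum>k<K. bernoulli_plus (Suc k) / fact (Suc k) * (0 - p k 0))"
    unfolding bd_def
  proof (intro tendsto_intros)
    fix k
    obtain C where C: "C \<ge> 0" "\<And>A y t x. y \<ge> 1 \<Longrightarrow> g * y \<le> Re A \<Longrightarrow> norm A \<le> G * y \<Longrightarrow> norm t \<le> norm s \<Longrightarrow>
       x \<ge> 0 \<Longrightarrow> x \<ge> 1 \<or> k = d * 0 \<Longrightarrow>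
       norm (pow_deriv d \<gamma> A t k (of_real x)) \<le> C * (y + x ^ d) powr (- Re t - real 0)"
      \<comment> \<open>J = 0 is enough here: Re s > 2 already makes every derivative decay at
        infinity.\<close>
      using pow_deriv_bound[OF gG(1-3) d, of 0 k "norm s"] by auto
    have "norm (p k (real M)) \<le> C * 4 / (1 + real M)\<^sup>2" if "M \<ge> 1" for M
    proof -
      have "norm (p k (real M)) \<le> C * (1 + real M ^ d) powr (- Re s)"
        using C(2)[of 1 A s "real M"] gG that by (simp add: p_def)
      also have "\<dots> \<le> C * (1 powr (2 - Re s) * (4 / (1 + real M)\<^sup>2))"
        using C(1) s d by (intro mult_left_mono powr_decay_bound) auto
      finally show ?thesis by simp
    qed
    then have "\<forall>\<^sub>F M in sequentially. norm (p k (real M)) \<le> C * 4 / (1 + real M)\<^sup>2"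
      by (auto simp: eventually_sequentially)
    moreover have "(\<lambda>M. C * 4 / (1 + real M)\<^sup>2) \<longlonglongrightarrow> 0"
      using summable_on_imp_summable[OF summable_on_inverse_square] by (rule summable_LIMSEQ_zero)
    ultimately show "(\<lambda>M. p k (real M)) \<longlonglongrightarrow> 0"
      by (rule Lim_null_comparison)
  qed
  ultimately have "(\<lambda>M. \<Sum>m<M. f (Suc m)) \<longlonglongrightarrow> em_main d \<gamma> A s +
      (\<Sum>k<K. bernoulli_plus (Suc k) / fact (Suc k) * (0 - p k 0)) + em_rem d \<gamma> A s J"
    using s2 s3 by (simp add: tendsto_add)
  then have "infsum f {1..} = em_main d \<gamma> A s +
      (\<Sum>k<K. bernoulli_plus (Suc k) / fact (Suc k) * (0 - p k 0)) + em_rem d \<gamma> A s J"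
    using s1 LIMSEQ_unique by blast
  moreover have "(\<Sum>k<K. bernoulli_plus (Suc k) / fact (Suc k) * (0 - p k 0)) =
      - (\<Sum>i<J. em_coeff d \<gamma> s i * A powr (- s - of_nat i))"
  proof -
    have "bernoulli_plus (Suc k) / fact (Suc k) * (0 - p k 0) = (if d dvd k then
       - (bernoulli_plus (Suc k) / of_nat (Suc k) * ((- s) gchoose (k div d)) * \<gamma> ^ (k div d) * A powr (- s - of_nat (k div d))) else 0)" for k
      using pow_deriv_at_0[OF d, of \<gamma> A s k] by (simp add: p_def del: of_nat_Suc)
    then have "(\<Sum>k<K. bernoulli_plus (Suc k) / fact (Suc k) * (0 - p k 0)) = (\<Sum>i<J. 
       - (bernoulli_plus (Suc (d * i)) / of_nat (Suc (d * i)) * ((- s) gchoose (d * i div d)) * \<gamma> ^ (d * i div d) * A powr (- s - of_nat (d * i div d))))"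
      unfolding K_def by (simp only: sum_dvd_reindex[OF d])
    then show ?thesis using d by (simp add: em_coeff_def sum_negf)
  qed
  ultimately show "infsum f {1..} = main_const d \<gamma> * (Gamma (s - 1 / of_nat d) * rGamma s) * A powr (1 / of_nat d - s) -
       (\<Sum>i<J. em_coeff d \<gamma> s i * A powr (- s - of_nat i)) + em_rem d \<gamma> A s J"
    by (simp add: em_main_eq[OF A \<gamma> s d])
qed

section \<open>Summation over the lattice\<close>

text \<open>The parameters after the innermost sum has left a power of the m-th base, whose exponent
  joins that of the last outer factor. Coordinate m + 1 keeps its old value, which m-fold functions
  do not read.\<close>

definition merge_last :: "nat \<Rightarrow> complex \<Rightarrow> (nat \<Rightarrow> complex) \<Rightarrow> (nat \<Rightarrow> complex)" where
  "merge_last m c s = s(m := s m + s (Suc m) + c)"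

lemma filterlim_merge_last:
  assumes "m \<ge> 1"
  shows "filterlim (merge_last m c) (nbh m (merge_last m c z)) (nbh (Suc m) z)"
proof (rule filterlim_nbh)
  fix i assume i: "i \<in> {1..m}"
  show "((\<lambda>w. merge_last m c w i) \<longlongrightarrow> merge_last m c z i) (nbh (Suc m) z)"
  proof (cases "i = m")
    case True
    then show ?thesis using assms unfolding merge_last_def
      by (auto intro!: tendsto_intros tendsto_coord_nbh)
  next
    case False
    then show ?thesis using i unfolding merge_last_def by (auto intro!: tendsto_coord_nbh)
  qed
qed

lemma cd_merge_last:
  assumes "m \<ge> 1" "complex_differentiable_at m f (merge_last m c z)"
  shows "complex_differentiable_at (Suc m) (\<lambda>w. f (merge_last m c w)) z"
proof -
  obtain \<phi> where \<phi>: "\<And>i. i\<in>{1..m} \<Longrightarrow> (\<phi> i \<longlongrightarrow> \<phi> i (merge_last m c z)) (nbh m (merge_last m c z))"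
    "\<forall>\<^sub>F w in nbh m (merge_last m c z). f w = f (merge_last m c z) + (\<Sum>i=1..m. \<phi> i w * (w i - merge_last m c z i))"
    by (rule cd_E[OF assms(2)]) blast
  \<comment> \<open>The increment of the merged coordinate is the sum of the increments of
    coordinates m and m + 1, so both receive the slope of index m.\<close>
  define \<psi> where "\<psi> i w = \<phi> (min i m) (merge_last m c w)" for i w
  show ?thesis
  proof (rule cd_I[of _ \<psi>])
    fix i assume "i \<in> {1..Suc m}"
    then have "min i m \<in> {1..m}" using assms(1) by auto
    from filterlim_compose[OF \<phi>(1)[OF this] filterlim_merge_last[OF assms(1)]]
    show "(\<psi> i \<longlongrightarrow> \<psi> i z) (nbh (Suc m) z)" unfolding \<psi>_def .
  next
    have "\<forall>\<^sub>F w in nbh (Suc m) z. f (merge_last m c w) = f (merge_last m c z) + (\<Sum>i=1..m. \<phi> i (merge_last m c w) * (merge_last m c w i - merge_last m c z i))"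
      using eventually_compose_filterlim[OF \<phi>(2) filterlim_merge_last[OF assms(1)]] .
    then show "\<forall>\<^sub>F w in nbh (Suc m) z. f (merge_last m c w) = f (merge_last m c z) + (\<Sum>i=1..Suc m. \<psi> i w * (w i - z i))"
    proof eventually_elim
      case (elim w)
      obtain k where k: "m = Suc k" using assms(1) by (cases m) auto
      have "(\<Sum>i=1..k. \<phi> i (merge_last m c w) * (merge_last m c w i - merge_last m c z i)) = (\<Sum>i=1..k. \<psi> i w * (w i - z i))"
        by (intro sum.cong) (auto simp: \<psi>_def merge_last_def k min_def)
      then have "(\<Sum>i=1..m. \<phi> i (merge_last m c w) * (merge_last m c w i - merge_last m c z i)) = (\<Sum>i=1..Suc m. \<psi> i w * (w i - z i))"
        by (simp add: k) (simp add: \<psi>_def merge_last_def k algebra_simps)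
      then show ?case using elim by simp
    qed
  qed
qed

section \<open>Absolute convergence of the multiple series\<close>

locale multizeta =
  fixes d :: "nat \<Rightarrow> nat" and \<gamma> :: "nat \<Rightarrow> complex" and n :: nat
  assumes Re_gamma: "\<And>j. j \<in> {1..n} \<Longrightarrow> Re (\<gamma> j) > 0"
    and d_ge_1: "\<And>j. j \<in> {1..n} \<Longrightarrow> d j \<ge> 1"
begin

definition base :: "(nat \<Rightarrow> nat) \<Rightarrow> nat \<Rightarrow> complex" where
  "base x j = (\<Sum>k=1..j. \<gamma> k * of_nat (x k ^ d k))"

text \<open>The scale that plays the role of y in the cone estimates, with \<open>base\<close> in
  the role of A.\<close>

definition size_at :: "(nat \<Rightarrow> nat) \<Rightarrow> nat \<Rightarrow> real" where
  "size_at x j = (\<Sum>k=1..j. real (x k ^ d k))"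

text \<open>Cone constants common to all \<gamma> j; the inserted 1 keeps the sets nonempty.\<close>

definition lo :: real where "lo = Min (insert 1 ((\<lambda>j. Re (\<gamma> j)) ` {1..n}))"
definition hi :: real where "hi = Max (insert 1 ((\<lambda>j. norm (\<gamma> j)) ` {1..n}))"

lemma lo: "lo > 0" "j \<in> {1..n} \<Longrightarrow> lo \<le> Re (\<gamma> j)"
proof -
  show "lo > 0" unfolding lo_def using Re_gamma by (subst Min_gr_iff) auto
  show "lo \<le> Re (\<gamma> j)" if "j \<in> {1..n}" unfolding lo_def by (rule Min_le) (use that in auto)
qed

lemma hi: "j \<in> {1..n} \<Longrightarrow> norm (\<gamma> j) \<le> hi"
  unfolding hi_def by (rule Max_ge) auto

lemma idx_ge_1: "x \<in> mzeta_indices m \<Longrightarrow> j \<in> {1..m} \<Longrightarrow> x j \<ge> 1"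
  by (auto simp: mzeta_indices_def PiE_iff)

lemma coord_le_size:
  assumes "x \<in> mzeta_indices m" "k \<in> {1..j}" "j \<le> m" "m \<le> n"
  shows "real (x k) \<le> size_at x j"
proof -
  have "x k \<ge> 1" using assms by (intro idx_ge_1[OF assms(1)]) auto
  moreover have "d k \<ge> 1" using assms by (intro d_ge_1) auto
  ultimately have "x k ^ 1 \<le> x k ^ d k" by (intro power_increasing)
  then have "real (x k) \<le> real (x k ^ d k)" by (simp only: of_nat_le_iff) simp
  also have "\<dots> \<le> size_at x j"
    unfolding size_at_def using assms by (intro member_le_sum) auto
  finally show ?thesis .
qed

lemma size_ge_1:
  assumes "x \<in> mzeta_indices m" "j \<in> {1..m}" "m \<le> n"
  shows "size_at x j \<ge> 1"
  using coord_le_size[of x m j j] idx_ge_1[OF assms(1,2)] assms by auto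

lemma size_mono: "j \<le> m \<Longrightarrow> size_at x j \<le> size_at x m"
  unfolding size_at_def by (intro sum_mono2) auto

lemma base_cone:
  assumes "j \<le> n"
  shows "lo * size_at x j \<le> Re (base x j)" "norm (base x j) \<le> hi * size_at x j"
proof -
  have "lo * size_at x j = (\<Sum>k=1..j. lo * real (x k ^ d k))"
    by (simp add: size_at_def sum_distrib_left)
  also have "\<dots> \<le> (\<Sum>k=1..j. Re (\<gamma> k) * real (x k ^ d k))"
    using assms lo by (intro sum_mono mult_right_mono) auto
  also have "\<dots> = Re (base x j)" unfolding base_def Re_sum by (intro sum.cong refl) (simp only: Re_complex_of_real Im_complex_of_real times_complex.simps, simp)
  finally show "lo * size_at x j \<le> Re (base x j)" .
  have "norm (base x j) \<le> (\<Sum>k=1..j. hi * real (x k ^ d k))"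
    unfolding base_def
  proof (intro sum_norm_le)
    fix k assume "k \<in> {1..j}"
    then show "norm (\<gamma> k * of_nat (x k ^ d k)) \<le> hi * real (x k ^ d k)"
      unfolding norm_mult norm_of_nat using hi assms by (intro mult_right_mono) auto
  qed
  then show "norm (base x j) \<le> hi * size_at x j" by (simp add: size_at_def sum_distrib_left)
qed

lemma base_pos:
  assumes "x \<in> mzeta_indices m" "j \<in> {1..m}" "m \<le> n"
  shows "Re (base x j) > 0" "base x j \<noteq> 0"
proof -
  have "0 < lo * size_at x j"
    using size_ge_1[OF assms] lo by (intro mult_pos_pos) auto
  also have "\<dots> \<le> Re (base x j)" using assms by (intro base_cone) auto
  finally show "Re (base x j) > 0" .
  then show "base x j \<noteq> 0" by auto
qed

lemma mzeta_term_eq: "mzeta_term m d \<gamma> s x = (\<Prod>j=1..m. base x j powr (- s j))"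
  by (simp add: mzeta_term_def base_def)

lemma base_powr_bound:
  assumes "x \<in> mzeta_indices m" "j \<in> {1..m}" "m \<le> n" "norm w \<le> B"
  shows "norm (base x j powr (- w)) \<le> powr_const lo hi B * size_at x j powr (- Re w)"
proof (rule norm_powr_bound)
  show "size_at x j > 0" using size_ge_1[OF assms(1-3)] by simp
qed (use base_cone[of j x] lo assms in auto)

lemma summable_on_inverse_squares:
  "(\<lambda>x. C * (\<Prod>k=1..m. 1 / (real (x k))\<^sup>2)) summable_on mzeta_indices m"
proof -
  have "(\<lambda>k::nat. 1 / (real k)\<^sup>2) summable_on UNIV"
    using inverse_power_summable[of 2, where 'a = real]
    by (intro norm_summable_imp_summable_on) (simp add: inverse_eq_divide)
  then have "(\<lambda>k::nat. 1 / (real k)\<^sup>2) summable_on {1..}"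
    by (rule summable_on_subset_banach) simp
  then have "(\<lambda>k::nat. norm (1 / (real k)\<^sup>2)) summable_on {1..}" by simp
  then have "Infinite_Set_Sum.abs_summable_on (\<lambda>k::nat. 1 / (real k)\<^sup>2) {1..}"
    unfolding abs_summable_equivalent .
  then have "Infinite_Set_Sum.abs_summable_on (\<lambda>x. \<Prod>k\<in>{1..m}. 1 / (real (x k))\<^sup>2) (PiE {1..m} (\<lambda>_. {1..}))"
    by (intro abs_summable_on_prod_PiE) auto
  then have "(\<lambda>x. \<Prod>k=1..m. 1 / (real (x k))\<^sup>2) summable_on mzeta_indices m"
    unfolding mzeta_indices_def abs_summable_equivalent[symmetric] by (rule Infinite_Sum.abs_summable_summable)
  then show ?thesis by (rule summable_on_cmult_right)
qed

lemma mzeta_term_bound: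
  assumes "x \<in> mzeta_indices m" "m \<le> n" "\<And>j. j \<in> {1..m} \<Longrightarrow> norm (s j) \<le> B" "\<And>j. j \<in> {1..m} \<Longrightarrow> Re (s j) \<ge> 2"
  shows "norm (mzeta_term m d \<gamma> s x) \<le> powr_const lo hi B ^ m * (\<Prod>k=1..m. 1 / (real (x k))\<^sup>2)"
proof -
  have "norm (mzeta_term m d \<gamma> s x) = (\<Prod>j=1..m. norm (base x j powr (- s j)))"
    by (simp add: mzeta_term_eq prod_norm)
  also have "\<dots> \<le> (\<Prod>j=1..m. powr_const lo hi B * (1 / (real (x j))\<^sup>2))"
  proof (intro prod_mono conjI norm_ge_zero)
    fix j assume j: "j \<in> {1..m}"
    have xj: "real (x j) \<ge> 1" using idx_ge_1[OF assms(1) j] by simp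
    have "norm (base x j powr (- s j)) \<le> powr_const lo hi B * size_at x j powr (- Re (s j))"
      using assms j by (intro base_powr_bound) auto
    also have "size_at x j powr (- Re (s j)) \<le> real (x j) powr (- Re (s j))"
      using coord_le_size[OF assms(1), of j j] xj assms(2) assms(4)[OF j] j by (intro powr_mono2') auto
    also have "\<dots> \<le> real (x j) powr (- 2)" using xj assms(4)[OF j] by (intro powr_mono) auto
    also have "\<dots> = 1 / (real (x j))\<^sup>2" using xj by (simp add: powr_minus_divide powr_numeral)
    finally show "norm (base x j powr (- s j)) \<le> powr_const lo hi B * (1 / (real (x j))\<^sup>2)"
      by (simp add: mult_left_mono)
  qed
  also have "\<dots> = powr_const lo hi B ^ m * (\<Prod>k=1..m. 1 / (real (x k))\<^sup>2)"
    unfolding prod.distrib by simp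
  finally show ?thesis .
qed

lemma exists_bound: "\<exists>B. \<forall>j\<in>{1..m::nat}. norm (s j :: complex) \<le> B"
  by (rule exI[of _ "\<Sum>j=1..m. norm (s j)"]) (auto intro!: member_le_sum)

lemma mzeta_abs_summable:
  assumes "m \<le> n" "\<And>j. j \<in> {1..m} \<Longrightarrow> Re (s j) \<ge> 2"
  shows "(\<lambda>x. norm (mzeta_term m d \<gamma> s x)) summable_on mzeta_indices m"
proof -
  obtain B where "\<forall>j\<in>{1..m}. norm (s j) \<le> B" using exists_bound by blast
  then show ?thesis using assms
    by (intro Infinite_Sum.abs_summable_on_comparison_test'[OF summable_on_inverse_squares mzeta_term_bound[where B = B]]) auto
qed

text \<open>A crude region of absolute convergence. Every identity is established here, where all
  sums may be rearranged, and extended by uniqueness.\<close>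

definition far :: "nat \<Rightarrow> (nat \<Rightarrow> complex) \<Rightarrow> bool" where
  "far m s \<longleftrightarrow> (\<forall>j\<in>{1..m}. Re (s j) > 2)"

definition region :: "nat \<Rightarrow> real \<Rightarrow> (nat \<Rightarrow> complex) \<Rightarrow> bool" where
  "region m R s \<longleftrightarrow> (\<forall>j\<in>{1..m}. Re (s j) > - R)"

lemma eventually_region: "region m R s \<Longrightarrow> \<forall>\<^sub>F w in nbh m s. region m R w"
  unfolding region_def
proof (intro eventually_ball_finite ballI)
  fix j assume "\<forall>j\<in>{1..m}. - R < Re (s j)" and j: "j \<in> {1..m}"
  then have "- R < Re (s j)" by blast
  with tendsto_Re[OF tendsto_coord_nbh[OF j]] show "\<forall>\<^sub>F w in nbh m s. - R < Re (w j)"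
    by (rule order_tendstoD)
qed simp

lemma far_region: "far m s \<longleftrightarrow> region m (-2) s"
  by (simp add: far_def region_def)

lemma far_in_domain:
  assumes "m \<le> n" "far m s"
  shows "s \<in> mzeta_domain m d \<gamma>"
proof -
  have "\<forall>\<^sub>F w in nbh m s. region m (-2) w" using assms by (intro eventually_region) (simp add: far_region)
  then obtain r where "r > 0" "\<forall>w\<in>polydisc m s r. region m (-2) w" by (auto simp: eventually_nbh)
  moreover have "(\<lambda>x. norm (mzeta_term m d \<gamma> w x)) summable_on mzeta_indices m" if "region m (-2) w" for w
    using that by (intro mzeta_abs_summable[OF assms(1)]) (simp add: region_def less_imp_le)
  ultimately show ?thesis unfolding mzeta_domain_def by blast
qed

definition Z :: "nat \<Rightarrow> (nat \<Rightarrow> complex) \<Rightarrow> complex" where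
  "Z m s = infsum (mzeta_term m d \<gamma> s) (mzeta_indices m)"

text \<open>Index tuples of length m + 1 are the updates x(Suc m := k), and absolute summability
  permits the exchange of the two sums.\<close>

lemma Z_Suc_Fubini:
  assumes "Suc m \<le> n" "far (Suc m) s"
  shows "Z (Suc m) s = (\<Sum>\<^sub>\<infinity>x\<in>mzeta_indices m. mzeta_term m d \<gamma> s x *
     (\<Sum>\<^sub>\<infinity>k\<in>{1..}. (base x m + \<gamma> (Suc m) * of_nat (k ^ d (Suc m))) powr (- s (Suc m))))"
proof -
  define \<phi> where "\<phi> = (\<lambda>(k, x :: nat \<Rightarrow> nat). x(Suc m := k))"
  have img: "mzeta_indices (Suc m) = \<phi> ` ({1..} \<times> mzeta_indices m)"
  proof -
    have "{1..Suc m} = insert (Suc m) {1..m}" by auto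
    then show ?thesis unfolding mzeta_indices_def \<phi>_def by (simp only: PiE_insert_eq)
  qed
  have inj: "inj_on \<phi> ({1..} \<times> mzeta_indices m)"
    unfolding mzeta_indices_def \<phi>_def by (rule inj_combinator) auto
  define f where "f k x = mzeta_term m d \<gamma> s x *
     (base x m + \<gamma> (Suc m) * of_nat (k ^ d (Suc m))) powr (- s (Suc m))" for k x
  have term_eq: "mzeta_term (Suc m) d \<gamma> s (x(Suc m := k)) = f k x" for k x
  proof -
    have "base (x(Suc m := k)) j = base x j" if "j \<le> m" for j
      unfolding base_def using that by (intro sum.cong) auto
    moreover from this[of m] have "base (x(Suc m := k)) (Suc m) = base x m + \<gamma> (Suc m) * of_nat (k ^ d (Suc m))"
      by (simp add: base_def)
    ultimately show ?thesis by (simp add: mzeta_term_eq f_def)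
  qed
  have "(\<lambda>x. norm (mzeta_term (Suc m) d \<gamma> s x)) summable_on mzeta_indices (Suc m)"
    using assms by (intro mzeta_abs_summable) (auto simp: far_def less_imp_le)
  then have "mzeta_term (Suc m) d \<gamma> s summable_on \<phi> ` ({1..} \<times> mzeta_indices m)"
    unfolding img[symmetric] by (rule Infinite_Sum.abs_summable_summable)
  then have sm: "(\<lambda>(k, x). f k x) summable_on ({1..} \<times> mzeta_indices m)"
    unfolding summable_on_reindex[OF inj] by (simp add: o_def \<phi>_def case_prod_beta' term_eq)
  have "Z (Suc m) s = infsum (\<lambda>(k, x). f k x) ({1..} \<times> mzeta_indices m)"
    unfolding Z_def img infsum_reindex[OF inj] by (simp add: o_def \<phi>_def case_prod_beta' term_eq)
  also have "\<dots> = (\<Sum>\<^sub>\<infinity>k\<in>{1..}. \<Sum>\<^sub>\<infinity>x\<in>mzeta_indices m. f k x)"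
    using sm by (intro infsum_Sigma'_banach[symmetric])
  also have "\<dots> = (\<Sum>\<^sub>\<infinity>x\<in>mzeta_indices m. \<Sum>\<^sub>\<infinity>k\<in>{1..}. f k x)"
    using sm by (rule infsum_swap_banach)
  also have "\<dots> = (\<Sum>\<^sub>\<infinity>x\<in>mzeta_indices m. mzeta_term m d \<gamma> s x *
     (\<Sum>\<^sub>\<infinity>k\<in>{1..}. (base x m + \<gamma> (Suc m) * of_nat (k ^ d (Suc m))) powr (- s (Suc m))))"
    unfolding f_def by (simp add: infsum_cmult_right')
  finally show ?thesis .
qed

lemma mzeta_term_merge_last:
  assumes "x \<in> mzeta_indices m" "m \<ge> 1" "m \<le> n"
  shows "mzeta_term m d \<gamma> s x * base x m powr (- s (Suc m) - c) = mzeta_term m d \<gamma> (merge_last m c s) x"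
proof -
  obtain k where k: "m = Suc k" using assms by (cases m) auto
  have "base x m powr (- s m) * base x m powr (- s (Suc m) - c) = base x m powr (- (s m + s (Suc m) + c))"
    unfolding powr_add[symmetric] by (rule arg_cong2[of _ _ _ _ "(powr)"]) simp_all
  moreover have "(\<Prod>j=1..k. base x j powr (- s j)) = (\<Prod>j=1..k. base x j powr (- merge_last m c s j))"
    by (intro prod.cong) (auto simp: merge_last_def k)
  ultimately show ?thesis
    by (simp add: mzeta_term_eq k merge_last_def mult.assoc)
qed

section \<open>The series of remainders\<close>

definition rem_term :: "nat \<Rightarrow> nat \<Rightarrow> (nat \<Rightarrow> complex) \<Rightarrow> (nat \<Rightarrow> nat) \<Rightarrow> complex" where
  "rem_term m J s x = mzeta_term m d \<gamma> s x * em_rem (d (Suc m)) (\<gamma> (Suc m)) (base x m) (s (Suc m)) J"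

definition rem_sum :: "nat \<Rightarrow> nat \<Rightarrow> (nat \<Rightarrow> complex) \<Rightarrow> complex" where
  "rem_sum m J s = (\<Sum>\<^sub>\<infinity>x\<in>mzeta_indices m. rem_term m J s x)"

text \<open>With Y the size of the outer base, the m outer factors grow at most like Y^(m R), the
  exponent s_(m+1) costs Y^R, and 2 was spent on the inner sum. The last 2 m leaves Y^(-2 m), that
  is one inverse square for each outer variable.\<close>

definition depth :: "nat \<Rightarrow> nat \<Rightarrow> nat" where "depth m R = 2 + R + m * R + 2 * m"

lemma rem_term_bound:
  assumes "m \<ge> 1" "Suc m \<le> n" "B \<ge> 0"
  obtains C where "C \<ge> 0" "\<And>s x. x \<in> mzeta_indices m \<Longrightarrow> (\<And>j. j \<in> {1..Suc m} \<Longrightarrow> norm (s j) \<le> B) \<Longrightarrow>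
     region (Suc m) (real R) s \<Longrightarrow> norm (rem_term m (depth m R) s x) \<le> C * (\<Prod>k=1..m. 1 / (real (x k))\<^sup>2)"
proof -
  define J where "J = depth m R"
  have Sm: "Suc m \<in> {1..n}" using assms by auto
  obtain C where C: "C \<ge> 0" "\<And>A y s. y \<ge> 1 \<Longrightarrow> lo * y \<le> Re A \<Longrightarrow> norm A \<le> hi * y \<Longrightarrow> norm s \<le> B \<Longrightarrow>
     Re s + real J \<ge> 2 \<Longrightarrow> norm (em_rem (d (Suc m)) (\<gamma> (Suc m)) A s J) \<le> C * y powr (2 - Re s - real J)"
    using em_rem_bound[OF lo(1) lo(2)[OF Sm] hi[OF Sm] d_ge_1[OF Sm] assms(3), of J] by blast
  define P where "P = powr_const lo hi B"
  have P: "P \<ge> 0" by (simp add: P_def)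
  show ?thesis
  proof (rule that[of "P ^ m * C"])
    show "P ^ m * C \<ge> 0" using P C by simp
    fix s x assume x: "x \<in> mzeta_indices m" and B: "\<And>j. j \<in> {1..Suc m} \<Longrightarrow> norm (s j) \<le> B"
      and reg: "region (Suc m) (real R) s"
    define Y where "Y = size_at x m"
    have Y: "Y \<ge> 1" unfolding Y_def using assms by (intro size_ge_1[OF x]) auto
    have R: "Re (s j) \<ge> - real R" if "j \<in> {1..Suc m}" for j using reg that by (auto simp: region_def less_imp_le)
    have "norm (mzeta_term m d \<gamma> s x) = (\<Prod>j=1..m. norm (base x j powr (- s j)))"
      by (simp add: mzeta_term_eq prod_norm)
    also have "\<dots> \<le> (\<Prod>j=1..m. P * Y powr real R)"
    proof (intro prod_mono conjI norm_ge_zero)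
      fix j assume j: "j \<in> {1..m}"
      have y1: "size_at x j \<ge> 1" using assms by (intro size_ge_1[OF x j]) auto
      have "norm (base x j powr (- s j)) \<le> P * size_at x j powr (- Re (s j))"
        unfolding P_def using assms j B[of j] by (intro base_powr_bound[OF x]) auto
      also have "size_at x j powr (- Re (s j)) \<le> size_at x j powr real R"
        using y1 R[of j] j by (intro powr_mono) auto
      also have "\<dots> \<le> Y powr real R"
        unfolding Y_def using y1 j size_mono[of j m x] by (intro powr_mono2) auto
      finally show "norm (base x j powr (- s j)) \<le> P * Y powr real R" using P by (simp add: mult_left_mono)
    qed
    also have "\<dots> = P ^ m * Y powr (real m * real R)"
      using Y by (simp add: power_mult_distrib powr_power mult.commute)
    finally have 1: "norm (mzeta_term m d \<gamma> s x) \<le> P ^ m * Y powr (real m * real R)" .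
    have Jr: "real J = 2 + real R + real m * real R + 2 * real m" by (simp add: J_def depth_def)
    have RS: "Re (s (Suc m)) \<ge> - real R" by (rule R) auto
    have "real m * real R \<ge> 0" "real m \<ge> 0" by simp_all
    then have sJ: "Re (s (Suc m)) + real J \<ge> 2" using RS Jr by linarith
    have "norm (em_rem (d (Suc m)) (\<gamma> (Suc m)) (base x m) (s (Suc m)) J) \<le> C * Y powr (2 - Re (s (Suc m)) - real J)"
      using Y base_cone[of m x] assms B[of "Suc m"] sJ unfolding Y_def[symmetric]
      by (intro C(2)) auto
    also have "\<dots> \<le> C * Y powr (- (real m * real R) - 2 * real m)"
      using C(1) Y RS unfolding Jr by (intro mult_left_mono powr_mono) auto
    finally have 2: "norm (em_rem (d (Suc m)) (\<gamma> (Suc m)) (base x m) (s (Suc m)) J) \<le> C * Y powr (- (real m * real R) - 2 * real m)" .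
    have "norm (rem_term m J s x) \<le> (P ^ m * Y powr (real m * real R)) * (C * Y powr (- (real m * real R) - 2 * real m))"
      unfolding rem_term_def norm_mult using 1 2 P by (intro mult_mono) auto
    also have "\<dots> = P ^ m * C * Y powr (- 2 * real m)"
      by (simp flip: powr_add add: mult_ac)
    also have "Y powr (- 2 * real m) = (\<Prod>k=1..m. Y powr (-2))"
      using Y by (simp add: powr_power mult.commute)
    also have "\<dots> \<le> (\<Prod>k=1..m. 1 / (real (x k))\<^sup>2)"
    proof (intro prod_mono conjI)
      fix k assume k: "k \<in> {1..m}"
      have xk: "real (x k) \<ge> 1" using idx_ge_1[OF x k] by simp
      have "Y powr (-2) \<le> real (x k) powr (-2)"
        unfolding Y_def using coord_le_size[OF x, of k m] k xk assms by (intro powr_mono2') auto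
      then show "Y powr (-2) \<le> 1 / (real (x k))\<^sup>2" using xk by (simp add: powr_minus_divide powr_numeral)
    qed simp
    finally show "norm (rem_term m (depth m R) s x) \<le> P ^ m * C * (\<Prod>k=1..m. 1 / (real (x k))\<^sup>2)"
      unfolding J_def using P C by (simp add: mult_left_mono)
  qed
qed

lemma rem_term_summable:
  assumes "m \<ge> 1" "Suc m \<le> n" "region (Suc m) (real R) s"
  shows "rem_term m (depth m R) s summable_on mzeta_indices m"
proof -
  obtain B where B: "\<forall>j\<in>{1..Suc m}. norm (s j) \<le> B" using exists_bound by blast
  have "norm (s 1) \<le> B" using B by auto
  then have "B \<ge> 0" using norm_ge_zero order_trans by blast
  obtain C where C: "C \<ge> 0" "\<And>s x. x \<in> mzeta_indices m \<Longrightarrow> (\<And>j. j \<in> {1..Suc m} \<Longrightarrow> norm (s j) \<le> B) \<Longrightarrow>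
     region (Suc m) (real R) s \<Longrightarrow> norm (rem_term m (depth m R) s x) \<le> C * (\<Prod>k=1..m. 1 / (real (x k))\<^sup>2)"
    by (rule rem_term_bound[OF assms(1,2) \<open>B \<ge> 0\<close>]) blast
  show ?thesis
    by (rule norm_infsum_le_infsum(1)[OF summable_on_inverse_squares[of C]])
       (use C(2) B assms(3) in blast)
qed

lemma rem_term_holomorphic:
  assumes "m \<ge> 1" "Suc m \<le> n" "x \<in> mzeta_indices m" "i \<in> {1..Suc m}" "S \<subseteq> {u. Re u > - real R}"
    and w: "Re (w (Suc m)) > - real R"
  shows "(\<lambda>u. rem_term m (depth m R) (w(i := u)) x) holomorphic_on S"
proof -
  have b: "Re (base x j) > 0" "base x j \<noteq> 0" if "j \<in> {1..m}" for j
    using base_pos[OF assms(3) that] assms by auto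
  have "(\<lambda>u. base x j powr (- (w(i := u)) j)) holomorphic_on S" if "j \<in> {1..m}" for j
    using b[OF that] by (cases "j = i") (auto intro!: holomorphic_intros)
  then have 1: "(\<lambda>u. mzeta_term m d \<gamma> (w(i := u)) x) holomorphic_on S"
    unfolding mzeta_term_eq by (intro holomorphic_on_prod) auto
  have "(\<lambda>u. em_rem (d (Suc m)) (\<gamma> (Suc m)) (base x m) ((w(i := u)) (Suc m)) (depth m R)) holomorphic_on S"
  proof (cases "i = Suc m")
    case True
    have "(\<lambda>u. em_rem (d (Suc m)) (\<gamma> (Suc m)) (base x m) u (depth m R)) holomorphic_on {s. Re s > 2 - real (depth m R)}"
      using b[of m] assms Re_gamma d_ge_1 by (intro em_rem_holomorphic) auto
    moreover have "2 - real (depth m R) \<le> - real R"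
    proof -
      have "real (depth m R) = 2 + real R + real m * real R + 2 * real m" by (simp add: depth_def)
      moreover have "real m * real R \<ge> 0" "real m \<ge> 0" by simp_all
      ultimately show ?thesis by linarith
    qed
    ultimately show ?thesis using True assms(5) by (auto elim!: holomorphic_on_subset)
  qed auto
  then show ?thesis unfolding rem_term_def by (intro holomorphic_on_mult 1)
qed

text \<open>One summable majorant on a polydisc of radius 2 r gives both hypotheses of Osgood's
  lemma: boundedness of the sum, and holomorphy in each variable by the M-test.\<close>

lemma rem_sum_differentiable:
  assumes m: "m \<ge> 1" "Suc m \<le> n" and p: "region (Suc m) (real R) p"
  shows "complex_differentiable_at (Suc m) (rem_sum m (depth m R)) p"
proof -
  obtain r0 where r0: "r0 > 0" "\<forall>w\<in>polydisc (Suc m) p r0. region (Suc m) (real R) w"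
    using eventually_region[OF p] by (auto simp: eventually_nbh)
  define r where "r = r0 / 2"
  have r: "r > 0" "\<And>w. w \<in> polydisc (Suc m) p (2 * r) \<Longrightarrow> region (Suc m) (real R) w"
    using r0 by (auto simp: r_def)
  obtain B0 where B0: "\<forall>j\<in>{1..Suc m}. norm (p j) \<le> B0" using exists_bound by blast
  define B where "B = B0 + 2 * r"
  have "norm (p 1) \<le> B0" using B0 by auto
  then have "B \<ge> 0" using r norm_ge_zero[of "p 1"] unfolding B_def by linarith
  have B: "norm (w j) \<le> B" if "w \<in> polydisc (Suc m) p (2 * r)" "j \<in> {1..Suc m}" for w j
  proof -
    have "norm (w j - p j) < 2 * r" "norm (p j) \<le> B0" using that B0 by (auto simp: polydisc_def)
    then show ?thesis using norm_triangle_sub[of "w j" "p j"] unfolding B_def by linarith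
  qed
  obtain C where C: "C \<ge> 0" "\<And>s x. x \<in> mzeta_indices m \<Longrightarrow> (\<And>j. j \<in> {1..Suc m} \<Longrightarrow> norm (s j) \<le> B) \<Longrightarrow>
     region (Suc m) (real R) s \<Longrightarrow> norm (rem_term m (depth m R) s x) \<le> C * (\<Prod>k=1..m. 1 / (real (x k))\<^sup>2)"
    by (rule rem_term_bound[OF m \<open>B \<ge> 0\<close>]) blast
  define M where "M x = C * (\<Prod>k=1..m. 1 / (real (x k))\<^sup>2)" for x :: "nat \<Rightarrow> nat"
  have Ms: "M summable_on mzeta_indices m" unfolding M_def by (rule summable_on_inverse_squares)
  have bd: "norm (rem_term m (depth m R) w x) \<le> M x" if "w \<in> polydisc (Suc m) p (2 * r)" "x \<in> mzeta_indices m" for w x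
    unfolding M_def using that by (intro C(2) B r(2)) auto
  have upd: "w(i := u) \<in> polydisc (Suc m) p (2 * r)" if "w \<in> polydisc (Suc m) p (2 * r)" "u \<in> ball (p i) (2 * r)" for w i u
    using that by (auto simp: polydisc_def dist_norm norm_minus_commute)
  show ?thesis
  proof (rule separately_holomorphic_imp_differentiable[OF _ r(1), where M = "infsum M (mzeta_indices m)"])
    fix w w' :: "nat \<Rightarrow> complex" assume eq: "\<And>i. i \<in> {1..Suc m} \<Longrightarrow> w i = w' i"
    have "mzeta_term m d \<gamma> w x = mzeta_term m d \<gamma> w' x" for x
      unfolding mzeta_term_eq using eq by (intro prod.cong) auto
    then show "rem_sum m (depth m R) w = rem_sum m (depth m R) w'"
      using eq[of "Suc m"] by (simp add: rem_sum_def rem_term_def)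
  next
    fix w assume "w \<in> polydisc (Suc m) p (2 * r)"
    then show "norm (rem_sum m (depth m R) w) \<le> infsum M (mzeta_indices m)"
      unfolding rem_sum_def using bd by (intro norm_infsum_le_infsum(2)[OF Ms])
  next
    fix w i assume w: "w \<in> polydisc (Suc m) p (2 * r)" and i: "i \<in> {1..Suc m}"
    show "(\<lambda>u. rem_sum m (depth m R) (w(i := u))) holomorphic_on ball (p i) (2 * r)"
      unfolding rem_sum_def
    proof (rule holomorphic_on_infsum[OF open_ball])
      have "ball (p i) (2 * r) \<subseteq> {u. Re u > - real R}"
      proof
        fix u assume "u \<in> ball (p i) (2 * r)"
        from r(2)[OF upd[OF w this]] i show "u \<in> {u. Re u > - real R}" unfolding region_def by fastforce
      qed
      moreover have "Re (w (Suc m)) > - real R" using r(2)[OF w] by (auto simp: region_def)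
      ultimately show "(\<lambda>u. rem_term m (depth m R) (w(i := u)) x) holomorphic_on ball (p i) (2 * r)"
        if "x \<in> mzeta_indices m" for x using that m i by (intro rem_term_holomorphic)
      fix z assume z: "z \<in> ball (p i) (2 * r)"
      have "\<forall>\<^sub>F u in nhds z. u \<in> ball (p i) (2 * r)"
        using z by (intro eventually_nhds_in_open) auto
      then have "\<forall>\<^sub>F u in nhds z. \<forall>x\<in>mzeta_indices m. norm (rem_term m (depth m R) (w(i := u)) x) \<le> M x"
        by eventually_elim (use bd upd w in auto)
      then show "\<exists>M. M summable_on mzeta_indices m \<and>
          (\<forall>\<^sub>F u in nhds z. \<forall>x\<in>mzeta_indices m. norm (rem_term m (depth m R) (w(i := u)) x) \<le> M x)"
        using Ms by blast
    qed
  qed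
qed

lemma rem_sum_eq_0:
  assumes "Suc m \<le> n" "N < J" "s (Suc m) = - of_nat N"
  shows "rem_sum m J s = 0"
  using assms em_rem_eq_0[OF assms(2) d_ge_1[of "Suc m"]] by (simp add: rem_sum_def rem_term_def)

text \<open>Two coordinates with real part above 2 add up to more than 4, so a shift by at least -1
  does not leave the region; -1/d is such a shift.\<close>

lemma far_merge_last:
  assumes "far (Suc m) s" "m \<ge> 1" "Re c \<ge> -1"
  shows "far m (merge_last m c s)"
proof -
  have sm: "Re (s m) > 2" "Re (s (Suc m)) > 2" using assms by (auto simp: far_def)
  show ?thesis unfolding far_def
  proof
    fix j assume j: "j \<in> {1..m}"
    show "Re (merge_last m c s j) > 2"
    proof (cases "j = m")
      case True
      have "Re (s m + s (Suc m) + c) = Re (s m) + Re (s (Suc m)) + Re c" by simp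
      then show ?thesis using True sm assms(3) by (simp add: merge_last_def)
    next
      case False
      then show ?thesis using j assms(1) by (simp add: merge_last_def far_def)
    qed
  qed
qed

lemma has_sum_diff_complex:
  fixes f g :: "'a \<Rightarrow> complex"
  assumes "(f has_sum a) A" "(g has_sum b) A"
  shows "((\<lambda>x. f x - g x) has_sum (a - b)) A"
  using has_sum_add[OF assms(1), of "\<lambda>x. - g x" "- b"] assms(2) by (simp add: has_sum_uminus)

lemma has_sum_finite_sum:
  fixes f :: "'i \<Rightarrow> 'a \<Rightarrow> complex"
  assumes "finite I" "\<And>i. i \<in> I \<Longrightarrow> (f i has_sum a i) A"
  shows "((\<lambda>x. \<Sum>i\<in>I. f i x) has_sum (\<Sum>i\<in>I. a i)) A"
  using assms by (induction I rule: finite_induct) (auto intro: has_sum_add)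

theorem Z_recursion:
  fixes R :: nat
  assumes m: "m \<ge> 1" "Suc m \<le> n" and s: "far (Suc m) s"
  defines "d' \<equiv> d (Suc m)" and "\<gamma>' \<equiv> \<gamma> (Suc m)" and "s' \<equiv> s (Suc m)" and "J \<equiv> depth m R"
  shows "Z (Suc m) s = main_const d' \<gamma>' * (Gamma (s' - 1 / of_nat d') * rGamma s') * Z m (merge_last m (- (1 / of_nat d')) s)
     - (\<Sum>i<J. em_coeff d' \<gamma>' s' i * Z m (merge_last m (of_nat i) s)) + rem_sum m J s"
proof -
  have Sm: "Suc m \<in> {1..n}" using m by auto
  have d': "d' \<ge> 1" and \<gamma>': "Re \<gamma>' > 0" using Sm d_ge_1 Re_gamma by (auto simp: d'_def \<gamma>'_def)
  have s': "Re s' > 2" using s by (auto simp: far_def s'_def)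
  have J: "J \<ge> 1" by (simp add: J_def depth_def)
  have Zs: "mzeta_term m d \<gamma> (merge_last m c s) summable_on mzeta_indices m" if "Re c \<ge> -1" for c
  proof (rule Infinite_Sum.abs_summable_summable, rule mzeta_abs_summable)
    show "Re (merge_last m c s j) \<ge> 2" if "j \<in> {1..m}" for j
      using far_merge_last[OF s m(1) \<open>Re c \<ge> -1\<close>] that by (auto simp: far_def less_imp_le)
  qed (use m in auto)
  have rs: "rem_term m J s summable_on mzeta_indices m"
    unfolding J_def using m s by (intro rem_term_summable) (auto simp: far_def region_def intro: less_trans[of _ 2])
  have "1 / real d' \<le> 1" using d' by simp
  then have c1: "Re (- (1 / of_nat d')) \<ge> -1" by (simp add: Re_divide_of_nat)
  define K where "K = main_const d' \<gamma>' * (Gamma (s' - 1 / of_nat d') * rGamma s')"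
  have "Z (Suc m) s = (\<Sum>\<^sub>\<infinity>x\<in>mzeta_indices m. K * mzeta_term m d \<gamma> (merge_last m (- (1 / of_nat d')) s) x
     - (\<Sum>i<J. em_coeff d' \<gamma>' s' i * mzeta_term m d \<gamma> (merge_last m (of_nat i) s) x) + rem_term m J s x)"
    unfolding Z_Suc_Fubini[OF m(2) s]
  proof (intro infsum_cong)
    fix x assume x: "x \<in> mzeta_indices m"
    have A: "Re (base x m) > 0" using m by (intro base_pos[OF x]) auto
    note mt = mzeta_term_merge_last[OF x m(1), of s, folded s'_def]
    have mt': "mzeta_term m d \<gamma> s x * base x m powr (1 / of_nat d' - s') = mzeta_term m d \<gamma> (merge_last m (- (1 / of_nat d')) s) x"
      using mt[of "- (1 / of_nat d')"] m by (simp add: algebra_simps)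
    have "mzeta_term m d \<gamma> s x * (\<Sum>\<^sub>\<infinity>k\<in>{1..}. (base x m + \<gamma>' * of_nat (k ^ d')) powr (- s'))
      = K * (mzeta_term m d \<gamma> s x * base x m powr (1 / of_nat d' - s')) -
        (\<Sum>i<J. em_coeff d' \<gamma>' s' i * (mzeta_term m d \<gamma> s x * base x m powr (- s' - of_nat i))) +
        mzeta_term m d \<gamma> s x * em_rem d' \<gamma>' (base x m) s' J"
      unfolding power_sum_expansion(2)[OF A \<gamma>' s' d' J] K_def
      by (simp add: algebra_simps sum_distrib_left)
    also have "\<dots> = K * mzeta_term m d \<gamma> (merge_last m (- (1 / of_nat d')) s) x
     - (\<Sum>i<J. em_coeff d' \<gamma>' s' i * mzeta_term m d \<gamma> (merge_last m (of_nat i) s) x) + rem_term m J s x"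
      using mt m unfolding mt' by (simp add: rem_term_def d'_def \<gamma>'_def s'_def)
    finally show "mzeta_term m d \<gamma> s x * (\<Sum>\<^sub>\<infinity>k\<in>{1..}. (base x m + \<gamma> (Suc m) * of_nat (k ^ d (Suc m))) powr (- s (Suc m))) =
       K * mzeta_term m d \<gamma> (merge_last m (- (1 / of_nat d')) s) x
     - (\<Sum>i<J. em_coeff d' \<gamma>' s' i * mzeta_term m d \<gamma> (merge_last m (of_nat i) s) x) + rem_term m J s x"
      unfolding d'_def \<gamma>'_def s'_def .
  qed
  moreover have "((\<lambda>x. K * mzeta_term m d \<gamma> (merge_last m (- (1 / of_nat d')) s) x
     - (\<Sum>i<J. em_coeff d' \<gamma>' s' i * mzeta_term m d \<gamma> (merge_last m (of_nat i) s) x) + rem_term m J s x) has_sum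
     (K * Z m (merge_last m (- (1 / of_nat d')) s) - (\<Sum>i<J. em_coeff d' \<gamma>' s' i * Z m (merge_last m (of_nat i) s)) + rem_sum m J s))
     (mzeta_indices m)"
    unfolding Z_def rem_sum_def
    by (intro has_sum_add has_sum_diff_complex has_sum_cmult_right has_sum_finite_sum has_sum_infsum Zs rs c1) auto
  ultimately show ?thesis unfolding K_def by (simp add: infsumI)
qed

end

section \<open>Entire continuation\<close>

text \<open>Multiplied by w + 1, the absorption identity turns the sum into the Bernoulli recursion
  for index w + 1. It evaluates the one-dimensional expansion at -w.\<close>

lemma sum_choose_bernoulli_plus:
  "(\<Sum>i\<le>w. bernoulli_plus (i + 1) / of_nat (i + 1) * of_nat (w choose i)) =
     1 - 1 / of_nat (w + 1) + bernoulli_plus (w + 1) / of_nat (w + 1)"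
proof -
  define p where "p = Suc w"
  have p0: "(of_nat p :: complex) \<noteq> 0" unfolding p_def by (rule of_nat_neq_0)
  have "of_nat p * (\<Sum>i\<le>w. bernoulli_plus (Suc i) / of_nat (Suc i) * of_nat (w choose i)) =
     (\<Sum>i\<le>w. of_nat (p choose Suc i) * bernoulli_plus (Suc i))"
    unfolding sum_distrib_left
  proof (intro sum.cong refl)
    fix i
    have "of_nat (Suc i) * of_nat (p choose Suc i) = (of_nat p * of_nat (w choose i) :: complex)"
      unfolding p_def by (metis Suc_times_binomial_eq mult.commute of_nat_mult)
    then have "of_nat (p choose Suc i) = (of_nat p * of_nat (w choose i) / of_nat (Suc i) :: complex)"
      by (simp add: field_simps del: of_nat_Suc)
    then show "of_nat p * (bernoulli_plus (Suc i) / of_nat (Suc i) * of_nat (w choose i)) =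
       of_nat (p choose Suc i) * bernoulli_plus (Suc i)" by simp
  qed
  also have "\<dots> = (\<Sum>j\<le>p. of_nat (p choose j) * bernoulli_plus j) - 1"
    unfolding p_def by (subst sum.atMost_Suc_shift) (simp add: bernoulli_plus_def)
  also have "(\<Sum>j\<le>p. of_nat (p choose j) * bernoulli_plus j) =
      (\<Sum>j\<le>p. of_nat (p choose j) * bernoulli j + (if j = 1 then of_nat p else 0))"
    by (intro sum.cong refl) (simp add: bernoulli_plus_def field_simps)
  also have "\<dots> = (\<Sum>j\<le>p. of_nat (p choose j) * bernoulli j) + of_nat p"
    by (simp add: sum.distrib p_def)
  also have "(\<Sum>j\<le>p. of_nat (p choose j) * bernoulli j) = bernoulli_plus p"
    using bernpoly_at_1[of p] by (simp add: bernpoly_def p_def)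
  finally have "(\<Sum>i\<le>w. bernoulli_plus (Suc i) / of_nat (Suc i) * of_nat (w choose i)) =
     (bernoulli_plus p + of_nat p - 1) / of_nat p"
    using p0 by (simp add: field_simps)
  then show ?thesis using p0 by (simp add: p_def field_simps del: of_nat_Suc)
qed

lemma em_coeff_holomorphic: "(\<lambda>s. em_coeff d \<gamma> s i) holomorphic_on UNIV"
  unfolding em_coeff_def gbinomial_prod_rev by (intro holomorphic_intros) auto

lemma em_coeff_nat: "em_coeff d \<gamma> (- of_nat N) i =
    bernoulli_plus (d * i + 1) / of_nat (d * i + 1) * of_nat (N choose i) * \<gamma> ^ i"
  by (simp add: em_coeff_def binomial_gbinomial)

context multizeta
begin

section \<open>Uniqueness and gluing over the growing regions\<close>

lemma region_mono: "region m R s \<Longrightarrow> R \<le> R' \<Longrightarrow> region m R' s"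
  by (force simp: region_def)

text \<open>Along the diagonal z + t (1, ..., 1) both functions are holomorphic on a half-plane
  around t = 0, and for large real t the point is far.\<close>

lemma region_identity:
  assumes f: "\<And>z. region m R z \<Longrightarrow> complex_differentiable_at m f z"
    and g: "\<And>z. region m R z \<Longrightarrow> complex_differentiable_at m g z"
    and eq: "\<And>z. far m z \<Longrightarrow> f z = g z" and z: "region m R z"
  shows "f z = g z"
proof -
  obtain r where r: "r > 0" "\<forall>w\<in>polydisc m z r. region m R w"
    using eventually_region[OF z] by (auto simp: eventually_nbh)
  define e where "e = r / 2"
  have e: "e > 0" using r by (simp add: e_def)
  have "(\<lambda>i. z i - of_real e) \<in> polydisc m z r" using r by (auto simp: polydisc_def e_def)
  then have reg: "region m R (\<lambda>i. z i - of_real e)" using r by blast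
  define L where "L t = (\<lambda>i. z i + t * 1)" for t :: complex
  have regL: "region m R (L t)" if "Re t > - e" for t
    unfolding region_def
  proof
    fix j assume "j \<in> {1..m}"
    then have "- R < Re (z j) - e" using reg by (auto simp: region_def)
    then show "- R < Re (L t j)" using that by (simp add: L_def)
  qed
  obtain B where B: "\<forall>j\<in>{1..m}. norm (z j) \<le> B" using exists_bound by blast
  have fd: "(\<lambda>t. h (L t)) holomorphic_on {t. Re t > - e}"
    if h: "\<And>z. region m R z \<Longrightarrow> complex_differentiable_at m h z" for h
    unfolding holomorphic_on_def
  proof
    fix t assume "t \<in> {t. Re t > - e}"
    then have "complex_differentiable_at m h (L t)" using h regL by blast
    then show "(\<lambda>t. h (L t)) field_differentiable at t within {t. Re t > - e}"
      using field_differentiable_line[of m h z t "\<lambda>_. 1"] by (simp add: L_def field_differentiable_at_within)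
  qed
  have "f (L 0) - g (L 0) = 0"
  proof (rule halfplane_identity[where f = "\<lambda>t. f (L t) - g (L t)" and c = "- e" and c' = "max (- e) (2 + B)"])
    show "(\<lambda>t. f (L t) - g (L t)) holomorphic_on {t. Re t > - e}"
      by (intro holomorphic_on_diff fd f g)
    fix x :: real assume x: "x > max (- e) (2 + B)"
    have "far m (L (of_real x))"
      unfolding far_def
    proof
      fix j assume "j \<in> {1..m}"
      then have "norm (z j) \<le> B" using B by blast
      then have "Re (z j) \<ge> - B" using abs_Re_le_cmod[of "z j"] by linarith
      then show "Re (L (of_real x) j) > 2" using x by (simp add: L_def)
    qed
    then show "f (L (of_real x)) - g (L (of_real x)) = 0" using eq by simp
  qed (use e in auto)
  then show ?thesis by (simp add: L_def)
qed

text \<open>The expansion of depth R is holomorphic only on region R. By uniqueness two depths agree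
  where both apply, so at each point any admissible depth may be chosen, and near that point the
  choice can be replaced by a fixed one.\<close>

lemma glue_regions:
  fixes H :: "nat \<Rightarrow> (nat \<Rightarrow> complex) \<Rightarrow> complex"
  assumes H: "\<And>R z. region m (real R) z \<Longrightarrow> complex_differentiable_at m (H R) z"
    and eq: "\<And>R z. far m z \<Longrightarrow> H R z = F z"
  shows "\<exists>G. (\<forall>z. complex_differentiable_at m G z) \<and> (\<forall>z. far m z \<longrightarrow> G z = F z)"
proof -
  define Rz where "Rz z = (SOME R. region m (real R) z)" for z
  have Rz: "region m (real (Rz z)) z" for z
    unfolding Rz_def
  proof (rule someI_ex)
    obtain B where B: "\<forall>j\<in>{1..m}. norm (z j) \<le> B" using exists_bound by blast
    obtain R :: nat where R: "real R > B" using reals_Archimedean2 by blast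
    have "region m (real R) z"
      unfolding region_def
    proof
      fix j assume "j \<in> {1..m}"
      then have "norm (z j) \<le> B" using B by blast
      then show "- real R < Re (z j)" using abs_Re_le_cmod[of "z j"] R by linarith
    qed
    then show "\<exists>R. region m (real R) z" by blast
  qed
  have same: "H R z = H R' z" if "region m (real R) z" "region m (real R') z" for R R' z
  proof (rule region_identity[where f = "H R" and g = "H R'" and m = m and R = "real (min R R')"])
    show "region m (real (min R R')) z" using that by (simp add: min_def)
    show "complex_differentiable_at m (H R) w" "complex_differentiable_at m (H R') w"
      if "region m (real (min R R')) w" for w
      using that by (auto intro!: H elim: region_mono)
  qed (simp add: eq)
  define G where "G z = H (Rz z) z" for z
  have "complex_differentiable_at m G z" for z
  proof (rule cd_cong[OF H[OF Rz[of z]]])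
    show "\<forall>\<^sub>F w in nbh m z. H (Rz z) w = G w"
      using eventually_region[OF Rz[of z]] by eventually_elim (auto simp: G_def intro: same Rz)
  qed
  moreover have "G z = F z" if "far m z" for z using that by (simp add: G_def eq)
  ultimately show ?thesis by blast
qed

section \<open>The denominator of the continuation\<close>

text \<open>An entire function whose zeros contain the poles of the continuation.\<close>

primrec Dn :: "nat \<Rightarrow> (nat \<Rightarrow> complex) \<Rightarrow> complex" where
  "Dn 0 s = 1"
| "Dn (Suc m) s = rGamma (s (Suc m) - 1 / of_nat (d (Suc m))) * Dn m (merge_last m 0 s) *
     Dn m (merge_last m (- (1 / of_nat (d (Suc m)))) s)"

primrec shift_factor :: "nat \<Rightarrow> nat \<Rightarrow> (nat \<Rightarrow> complex) \<Rightarrow> complex" where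
  "shift_factor 0 l s = 1"
| "shift_factor (Suc m) l s = pochhammer (s (Suc m) - 1 / of_nat (d (Suc m))) l * shift_factor m l (merge_last m 0 s) *
     shift_factor m l (merge_last m (- (1 / of_nat (d (Suc m)))) s)"

lemma merge_last_cong:
  assumes "\<And>i. i \<in> {1..Suc m} \<Longrightarrow> s i = t i" "i \<in> {1..m}"
  shows "merge_last m c s i = merge_last m c t i"
  using assms(2) assms(1)[of i] assms(1)[of "Suc m"] by (auto simp: merge_last_def)

lemma Dn_cong: "(\<And>i. i \<in> {1..m} \<Longrightarrow> s i = t i) \<Longrightarrow> Dn m s = Dn m t"
proof (induction m arbitrary: s t)
  case (Suc m)
  have "Dn m (merge_last m c s) = Dn m (merge_last m c t)" for c
    by (rule Suc.IH, rule merge_last_cong[OF Suc.prems])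
  then show ?case using Suc.prems[of "Suc m"] by simp
qed simp

text \<open>Each factor satisfies rGamma z = pochhammer z l * rGamma (z + l). Hence raising the last
  variable by a natural number creates no new zeros, and the denominator for shift 0 also clears the
  terms of the expansion with shift i.\<close>

lemma Dn_shift: "Dn m s = shift_factor m l s * Dn m (s(m := s m + of_nat l))"
proof (induction m arbitrary: s)
  case (Suc m)
  let ?s = "s(Suc m := s (Suc m) + of_nat l)"
  have IH: "Dn m (merge_last m c s) = shift_factor m l (merge_last m c s) * Dn m (merge_last m c ?s)" for c
  proof -
    have "Dn m ((merge_last m c s)(m := merge_last m c s m + of_nat l)) = Dn m (merge_last m c ?s)"
      by (rule Dn_cong) (auto simp: merge_last_def)
    then show ?thesis using Suc.IH[of "merge_last m c s"] by (simp del: fun_upd_apply)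
  qed
  have e: "s (Suc m) + of_nat l - 1 / of_nat (d (Suc m)) = s (Suc m) - 1 / of_nat (d (Suc m)) + of_nat l" by simp
  then show ?case
    using pochhammer_rGamma[of "s (Suc m) - 1 / of_nat (d (Suc m))" l]
    by (simp add: e IH[of 0] IH[of "- (1 / of_nat (d (Suc m)))"] mult_ac del: fun_upd_apply add: fun_upd_same)
qed simp

lemma Dn_merge_shift: "Dn m (merge_last m 0 s) = shift_factor m i (merge_last m 0 s) * Dn m (merge_last m (of_nat i) s)"
  using Dn_shift[of m "merge_last m 0 s" i] by (simp add: merge_last_def)

lemma Dn_differentiable: "complex_differentiable_at m (Dn m) z"
proof (induction m arbitrary: z)
  case 0
  have "complex_differentiable_at 0 (\<lambda>_. 1) z" by (rule cd_const)
  then show ?case by (rule cd_cong) simp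
next
  case (Suc m)
  have rG: "complex_differentiable_at (Suc m) (\<lambda>s. rGamma (s (Suc m) - c)) z" for c
    by (rule cd_entire[of "Suc m" "\<lambda>s. s (Suc m) - c" z rGamma]) (auto intro!: cd_intros holomorphic_rGamma)
  have D: "complex_differentiable_at (Suc m) (\<lambda>s. Dn m (merge_last m c s)) z" for c
  proof (cases "m = 0")
    case True
    have "complex_differentiable_at (Suc m) (\<lambda>_. 1) z" by (rule cd_const)
    then show ?thesis by (rule cd_cong) (simp add: True)
  next
    case False
    then show ?thesis by (intro cd_merge_last Suc.IH) simp
  qed
  show ?case unfolding Dn.simps by (intro cd_mult rG D)
qed

lemma shift_factor_differentiable: "complex_differentiable_at m (shift_factor m l) z"
proof (induction m arbitrary: z)
  case 0
  have "complex_differentiable_at 0 (\<lambda>_. 1) z" by (rule cd_const)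
  then show ?case by (rule cd_cong) simp
next
  case (Suc m)
  have P: "complex_differentiable_at (Suc m) (\<lambda>s. pochhammer (s (Suc m) - c) l) z" for c
    unfolding pochhammer_prod by (intro cd_intros) auto
  have D: "complex_differentiable_at (Suc m) (\<lambda>s. shift_factor m l (merge_last m c s)) z" for c
  proof (cases "m = 0")
    case True
    have "complex_differentiable_at (Suc m) (\<lambda>_. 1) z" by (rule cd_const)
    then show ?thesis by (rule cd_cong) (simp add: True)
  next
    case False
    then show ?thesis by (intro cd_merge_last Suc.IH) simp
  qed
  show ?case unfolding shift_factor.simps by (intro cd_mult P D)
qed

section \<open>The one-fold zeta function\<close>

text \<open>In dimension one the expansion is applied to \<open>\<Sum>k\<ge>1. (1 + k)\<^sup>-\<^sup>w\<close>, that is, to the Riemann zeta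
  function without its first term.\<close>

definition zeta_regular_part :: "nat \<Rightarrow> complex \<Rightarrow> complex" where
  "zeta_regular_part J w = 1 - (\<Sum>i<J. em_coeff 1 1 w i) + em_rem 1 1 1 w J"

text \<open>The product of \<open>Dn 1\<close> with \<gamma>_1^(-u) times the Riemann zeta function
  at d_1 u. The pole part 1 / (d_1 u - 1) times rGamma (u - 1/d_1) is rGamma (u - 1/d_1 + 1) / d_1;
  the order 2 + d_1 R makes the remainder holomorphic for Re u > -R.\<close>

definition G1 :: "nat \<Rightarrow> complex \<Rightarrow> complex" where
  "G1 R u = \<gamma> 1 powr (- u) * (rGamma (u - 1 / of_nat (d 1)) * zeta_regular_part (2 + d 1 * R) (of_nat (d 1) * u) +
     rGamma (u - 1 / of_nat (d 1) + 1) / of_nat (d 1))"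

text \<open>A positive real factor leaves the argument unchanged, so the principal logarithms
  add.\<close>

lemma mult_of_real_powr:
  fixes z w :: complex
  assumes "r > 0" "z \<noteq> 0"
  shows "(z * of_real r) powr w = z powr w * of_real r powr w"
proof -
  have "Ln (z * of_real r) = Ln z + Ln (of_real r)"
    using assms Ln_times_of_real[of r z] Ln_of_real[of r] by (simp add: mult.commute add.commute)
  then show ?thesis using assms by (simp add: powr_def distrib_left exp_add)
qed

lemma Z_1:
  assumes n: "n \<ge> 1" and s: "Re (s 1) > 2"
  shows "Dn 1 s * Z 1 s = G1 R (s 1)"
proof -
  define u where "u = s 1"
  define w where "w = of_nat (d 1) * u"
  have d1: "d 1 \<ge> 1" using n d_ge_1 by auto
  have g1: "\<gamma> 1 \<noteq> 0" using Re_gamma[of 1] n by auto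
  have "1 * 2 < real (d 1) * Re u" using s d1 unfolding u_def by (intro mult_le_less_imp_less) auto
  then have w: "Re w > 2" by (simp add: w_def)
  define J where "J = 2 + d 1 * R"
  have J: "J \<ge> 1" by (simp add: J_def)
  have idx0: "mzeta_indices 0 = {\<lambda>_. undefined}" by (simp add: mzeta_indices_def)
  have far: "far (Suc 0) s" using s by (simp add: far_def)
  have "Z 1 s = (\<Sum>\<^sub>\<infinity>k\<in>{1..}. (\<gamma> 1 * of_nat (k ^ d 1)) powr (- u))"
    using Z_Suc_Fubini[OF _ far] n by (simp add: idx0 mzeta_term_def base_def u_def)
  also have "\<dots> = (\<Sum>\<^sub>\<infinity>k\<in>{1..}. \<gamma> 1 powr (- u) * of_nat k powr (- w))"
  proof (intro infsum_cong)
    fix k :: nat assume k: "k \<in> {1..}"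
    have "(\<gamma> 1 * of_nat (k ^ d 1)) powr (- u) = \<gamma> 1 powr (- u) * of_real (real k ^ d 1) powr (- u)"
      using mult_of_real_powr[of "real k ^ d 1" "\<gamma> 1" "- u"] k g1 by simp
    also have "of_real (real k ^ d 1) powr (- u) = of_nat k powr (- w)"
    proof -
      have "Ln (complex_of_real (real k ^ d 1)) = of_real (real (d 1) * ln (real k))"
        using k by (subst Ln_of_real) (auto simp: ln_realpow)
      moreover have "Ln (of_nat k :: complex) = of_real (ln (real k))"
        using k Ln_of_real[of "real k"] by simp
      ultimately show ?thesis using k by (simp add: powr_def w_def mult_ac)
    qed
    finally show "(\<gamma> 1 * of_nat (k ^ d 1)) powr (- u) = \<gamma> 1 powr (- u) * of_nat k powr (- w)" .
  qed
  also have "\<dots> = \<gamma> 1 powr (- u) * (\<Sum>\<^sub>\<infinity>k\<in>{1..}. of_nat k powr (- w))"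
    by (rule infsum_cmult_right')
  also have "(\<Sum>\<^sub>\<infinity>k\<in>{1..}. of_nat k powr (- w)) = 1 + (\<Sum>\<^sub>\<infinity>k\<in>{1..}. (1 + 1 * of_nat (k ^ 1)) powr (- w))"
  proof -
    have sm: "(\<lambda>k. (1 + 1 * of_nat (k ^ 1)) powr (- w)) summable_on {1..}"
      by (rule Infinite_Sum.abs_summable_summable, rule power_sum_expansion(1)[of 1 1 w 1 1]) (use w in simp_all)
    have img: "{1..} = insert (1::nat) (Suc ` {1..})"
    proof (intro equalityI subsetI)
      fix k :: nat assume "k \<in> {1..}"
      then show "k \<in> insert 1 (Suc ` {1..})" by (cases k) (auto simp: image_iff)
    qed auto
    have inj: "inj_on Suc {1..}" by simp
    have o: "((\<lambda>k. of_nat k powr (- w)) \<circ> Suc) = (\<lambda>k. (1 + 1 * of_nat (k ^ 1)) powr (- w))"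
      by (simp add: fun_eq_iff)
    have "(\<lambda>k. of_nat k powr (- w)) summable_on (Suc ` {1..})"
      unfolding summable_on_reindex[OF inj] o by (rule sm)
    then have "(\<Sum>\<^sub>\<infinity>k\<in>insert (1::nat) (Suc ` {1..}). of_nat k powr (- w)) =
       of_nat 1 powr (- w) + (\<Sum>\<^sub>\<infinity>k\<in>Suc ` {1..}. of_nat k powr (- w))"
      by (intro infsum_insert) auto
    then show ?thesis unfolding img[symmetric] infsum_reindex[OF inj] o by simp
  qed
  also have "(\<Sum>\<^sub>\<infinity>k\<in>{1..}. (1 + 1 * of_nat (k ^ 1)) powr (- w)) =
      Gamma (w - 1) * rGamma w - (\<Sum>i<J. em_coeff 1 1 w i) + em_rem 1 1 1 w J"
    using power_sum_expansion(2)[of 1 1 w 1 J] w J by (simp add: main_const_def)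
  also have "Gamma (w - 1) * rGamma w = 1 / (w - 1)"
  proof -
    have "rGamma (w - 1) = (w - 1) * rGamma w" using rGamma_plus1[of "w - 1"] by simp
    moreover have "rGamma w \<noteq> 0" using w by (auto simp: rGamma_eq_zero_iff elim!: nonpos_Ints_cases)
    ultimately show ?thesis by (simp add: Gamma_def divide_inverse)
  qed
  finally have Z1: "Z 1 s = \<gamma> 1 powr (- u) * (zeta_regular_part J w + 1 / (w - 1))"
    by (simp add: zeta_regular_part_def)
  have w1: "w - 1 \<noteq> 0" using w by auto
  have "rGamma (u - 1 / of_nat (d 1)) = (u - 1 / of_nat (d 1)) * rGamma (u - 1 / of_nat (d 1) + 1)"
    using rGamma_plus1[of "u - 1 / of_nat (d 1)"] by simp
  moreover have "u - 1 / of_nat (d 1) = (w - 1) / of_nat (d 1)" using d1 by (simp add: w_def field_simps)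
  ultimately have "rGamma (u - 1 / of_nat (d 1)) * (1 / (w - 1)) = rGamma (u - 1 / of_nat (d 1) + 1) / of_nat (d 1)"
    using w1 by simp
  note e = this
  have "rGamma (u - 1 / of_nat (d 1)) * Z 1 s = \<gamma> 1 powr (- u) *
      (rGamma (u - 1 / of_nat (d 1)) * zeta_regular_part J w + rGamma (u - 1 / of_nat (d 1)) * (1 / (w - 1)))"
    unfolding Z1 by (simp only: ring_distribs mult_ac)
  then have "rGamma (u - 1 / of_nat (d 1)) * Z 1 s = G1 R u"
    unfolding e G1_def w_def[symmetric] J_def[symmetric] .
  then show ?thesis by (simp add: u_def)
qed

lemma G1_holomorphic:
  assumes "n \<ge> 1"
  shows "G1 R holomorphic_on {u. Re u > - real R}"
proof -
  have d1: "d 1 \<ge> 1" using assms d_ge_1 by auto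
  have g1: "\<gamma> 1 \<noteq> 0" using Re_gamma[of 1] assms by auto
  have er: "(\<lambda>w. em_rem 1 1 1 w (2 + d 1 * R)) holomorphic_on {s. Re s > 2 - real (2 + d 1 * R)}"
    by (intro em_rem_holomorphic) auto
  have "(\<lambda>w. em_rem 1 1 1 w (2 + d 1 * R)) \<circ> (\<lambda>u. of_nat (d 1) * u) holomorphic_on {u. Re u > - real R}"
  proof (rule holomorphic_on_compose_gen[OF _ er])
    show "(\<lambda>u. of_nat (d 1) * u) ` {u. Re u > - real R} \<subseteq> {s. Re s > 2 - real (2 + d 1 * R)}"
    proof safe
      fix u :: complex assume "Re u > - real R"
      then have "real (d 1) * (- real R) < real (d 1) * Re u" using d1 by (intro mult_strict_left_mono) auto
      then show "Re (of_nat (d 1) * u) > 2 - real (2 + d 1 * R)" by simp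
    qed
  qed (intro holomorphic_intros)
  moreover have "(\<lambda>w. em_coeff 1 1 w i) \<circ> (\<lambda>u. of_nat (d 1) * u) holomorphic_on {u. Re u > - real R}" for i
    by (rule holomorphic_on_compose_gen[OF _ em_coeff_holomorphic]) (auto intro!: holomorphic_intros)
  ultimately have "(\<lambda>u. zeta_regular_part (2 + d 1 * R) (of_nat (d 1) * u)) holomorphic_on {u. Re u > - real R}"
    unfolding zeta_regular_part_def o_def by (intro holomorphic_intros)
  then show ?thesis unfolding G1_def using g1 d1 by (intro holomorphic_intros) auto
qed

lemma G1_differentiable:
  assumes "n \<ge> 1" "region 1 (real R) z"
  shows "complex_differentiable_at 1 (\<lambda>s. G1 R (s 1)) z"
proof (rule cd_compose[of 1 "\<lambda>s. s 1" z "G1 R"])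
  show "complex_differentiable_at 1 (\<lambda>s. s 1) z" by (rule cd_coord) simp
  have "z 1 \<in> {u. Re u > - real R}" using assms by (auto simp: region_def)
  with G1_holomorphic[OF assms(1)] show "G1 R field_differentiable at (z 1)"
    by (rule holomorphic_on_imp_differentiable_at[OF _ open_Re_gt])
qed

section \<open>From m to m + 1 variables\<close>

text \<open>The right-hand side of the recursion multiplied by \<open>Dn (Suc m)\<close>. Its factor
  rGamma (s' - 1/d') cancels the Gamma of the main term, its factor \<open>Dn m\<close> at the -1/d'
  shift is absorbed in G there, and \<open>Dn m\<close> at shift 0 becomes
  \<open>shift_factor\<close> times the denominator absorbed in G at shift i. Nothing is left to
  divide by.\<close>

definition GS :: "((nat \<Rightarrow> complex) \<Rightarrow> complex) \<Rightarrow> nat \<Rightarrow> nat \<Rightarrow> (nat \<Rightarrow> complex) \<Rightarrow> complex" where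
  "GS G m R s = main_const (d (Suc m)) (\<gamma> (Suc m)) * rGamma (s (Suc m)) * Dn m (merge_last m 0 s) *
       G (merge_last m (- (1 / of_nat (d (Suc m)))) s) +
     rGamma (s (Suc m) - 1 / of_nat (d (Suc m))) * Dn m (merge_last m (- (1 / of_nat (d (Suc m)))) s) *
     (Dn m (merge_last m 0 s) * rem_sum m (depth m R) s -
       (\<Sum>i<depth m R. em_coeff (d (Suc m)) (\<gamma> (Suc m)) (s (Suc m)) i * shift_factor m i (merge_last m 0 s) *
         G (merge_last m (of_nat i) s)))"

lemma GS_differentiable:
  assumes m: "m \<ge> 1" "Suc m \<le> n" and G: "\<And>z. complex_differentiable_at m G z" and z: "region (Suc m) (real R) z"
  shows "complex_differentiable_at (Suc m) (GS G m R) z"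
proof -
  have rG: "complex_differentiable_at (Suc m) (\<lambda>s. rGamma (s (Suc m) - c)) z" for c
    by (rule cd_entire[of "Suc m" "\<lambda>s. s (Suc m) - c" z rGamma]) (auto intro!: cd_intros holomorphic_rGamma)
  have rG0: "complex_differentiable_at (Suc m) (\<lambda>s. rGamma (s (Suc m))) z" using rG[of 0] by simp
  have em: "complex_differentiable_at (Suc m) (\<lambda>s. em_coeff (d (Suc m)) (\<gamma> (Suc m)) (s (Suc m)) i) z" for i
    by (rule cd_entire[of "Suc m" "\<lambda>s. s (Suc m)" z "\<lambda>u. em_coeff (d (Suc m)) (\<gamma> (Suc m)) u i"])
       (auto intro!: cd_coord em_coeff_holomorphic)
  show ?thesis unfolding GS_def
    by (intro cd_add cd_diff cd_mult cd_sum cd_const rG rG0 em rem_sum_differentiable m z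
          cd_merge_last G Dn_differentiable shift_factor_differentiable)
qed

lemma Re_inverse_le_1: "d' \<ge> 1 \<Longrightarrow> Re (- (1 / of_nat d' :: complex)) \<ge> -1"
  by (simp add: Re_divide_of_nat)

lemma GS_far:
  assumes m: "m \<ge> 1" "Suc m \<le> n" and G: "\<And>z. far m z \<Longrightarrow> G z = Dn m z * Z m z" and s: "far (Suc m) s"
  shows "GS G m R s = Dn (Suc m) s * Z (Suc m) s"
proof -
  define d' where "d' = d (Suc m)"
  define s' where "s' = s (Suc m)"
  have d': "d' \<ge> 1" using m d_ge_1[of "Suc m"] by (simp add: d'_def)
  have "1 / real d' \<le> 1" using d' by simp
  moreover have "Re s' > 2" using s by (auto simp: far_def s'_def)
  ultimately have "Re (s' - 1 / of_nat d') > 0" by (simp add: Re_divide_of_nat)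
  then have "s' - 1 / of_nat d' \<notin> \<int>\<^sub>\<le>\<^sub>0" by (metis nonpos_Ints_cases Re_complex_of_real of_int_le_0_iff of_real_of_int_eq linorder_not_less)
  then have Gr: "rGamma (s' - 1 / of_nat d') * Gamma (s' - 1 / of_nat d') = 1"
    by (simp add: Gamma_def rGamma_eq_zero_iff)
  have G0: "G (merge_last m c s) = Dn m (merge_last m c s) * Z m (merge_last m c s)" if "Re c \<ge> -1" for c
    using far_merge_last[OF s m(1) that] by (rule G)
  have Gi: "em_coeff d' (\<gamma> (Suc m)) s' i * shift_factor m i (merge_last m 0 s) * G (merge_last m (of_nat i) s) =
      Dn m (merge_last m 0 s) * (em_coeff d' (\<gamma> (Suc m)) s' i * Z m (merge_last m (of_nat i) s))" for i
    using G0[of "of_nat i"] by (subst Dn_merge_shift[of m s i]) (simp add: mult_ac)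
  show ?thesis
    unfolding GS_def Z_recursion[OF m s, of R] Dn.simps d'_def[symmetric] s'_def[symmetric] Gi
      G0[OF Re_inverse_le_1[OF d']] sum_distrib_left[symmetric]
  proof -
    define a where "a = rGamma (s' - 1 / of_nat d')"
    define b where "b = Gamma (s' - 1 / of_nat d')"
    define D0 where "D0 = Dn m (merge_last m 0 s)"
    define D1 where "D1 = Dn m (merge_last m (- (1 / of_nat d')) s)"
    define r where "r = rGamma s'"
    define k where "k = main_const d' (\<gamma> (Suc m))"
    define z where "z = Z m (merge_last m (- (1 / of_nat d')) s)"
    define S where "S = (\<Sum>i<depth m R. em_coeff d' (\<gamma> (Suc m)) s' i * Z m (merge_last m (of_nat i) s))"
    define q where "q = rem_sum m (depth m R) s"
    have "a * b = 1" using Gr by (simp add: a_def b_def)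
    then have "k * r * D0 * (D1 * z) + a * D1 * (D0 * q - D0 * S) =
       k * r * D0 * (D1 * z) * (a * b) + a * D1 * (D0 * q - D0 * S)" by simp
    also have "\<dots> = a * D0 * D1 * (k * (b * r) * z - S + q)" by (simp add: algebra_simps)
    finally show "k * r * D0 * (D1 * z) + a * D1 * (D0 * q - D0 * S) = a * D0 * D1 * (k * (b * r) * z - S + q)" .
  qed
qed

lemma entire_continuation:
  assumes "m \<ge> 1" "m \<le> n"
  shows "\<exists>G. (\<forall>z. complex_differentiable_at m G z) \<and> (\<forall>z. far m z \<longrightarrow> G z = Dn m z * Z m z)"
  using assms
proof (induction m rule: dec_induct)
  case base
  then show ?case
    using G1_differentiable Z_1 by (intro glue_regions[where H = "\<lambda>R s. G1 R (s 1)"]) (auto simp: far_def)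
next
  case (step m)
  then obtain G where G: "\<And>z. complex_differentiable_at m G z" "\<And>z. far m z \<Longrightarrow> G z = Dn m z * Z m z" by auto
  show ?case
    using step G by (intro glue_regions[where H = "GS G m"] GS_differentiable GS_far) auto
qed

definition zG :: "nat \<Rightarrow> (nat \<Rightarrow> complex) \<Rightarrow> complex" where
  "zG m = (SOME G. (\<forall>z. complex_differentiable_at m G z) \<and> (\<forall>z. far m z \<longrightarrow> G z = Dn m z * Z m z))"

lemma zG:
  assumes "m \<ge> 1" "m \<le> n"
  shows "complex_differentiable_at m (zG m) z" "far m z \<Longrightarrow> zG m z = Dn m z * Z m z"
  using someI_ex[OF entire_continuation[OF assms]] unfolding zG_def by auto

lemma zG_1:
  assumes "n \<ge> 1" "Re (s 1) > - real R"
  shows "zG 1 s = G1 R (s 1)"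
proof (rule region_identity[where f = "zG 1" and g = "\<lambda>s. G1 R (s 1)" and R = "real R" and m = 1])
  show "complex_differentiable_at 1 (zG 1) z" for z by (rule zG(1)) (use assms in auto)
  show "complex_differentiable_at 1 (\<lambda>s. G1 R (s 1)) z" if "region 1 (real R) z" for z
    by (rule G1_differentiable[OF assms(1) that])
  show "zG 1 z = G1 R (z 1)" if z: "far 1 z" for z
  proof -
    have "zG 1 z = Dn 1 z * Z 1 z" using z assms(1) by (intro zG(2)) auto
    also have "\<dots> = G1 R (z 1)" using z by (intro Z_1 assms(1)) (simp add: far_def)
    finally show ?thesis .
  qed
  show "region 1 (real R) s" using assms by (simp add: region_def)
qed

lemma zG_Suc:
  assumes "m \<ge> 1" "Suc m \<le> n" "region (Suc m) (real R) s"
  shows "zG (Suc m) s = GS (zG m) m R s"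
proof (rule region_identity[OF _ _ _ assms(3)])
  show "complex_differentiable_at (Suc m) (zG (Suc m)) z" for z using assms by (intro zG) auto
  show "complex_differentiable_at (Suc m) (GS (zG m) m R) z" if "region (Suc m) (real R) z" for z
    using assms that by (intro GS_differentiable zG) auto
  show "zG (Suc m) z = GS (zG m) m R z" if "far (Suc m) z" for z
    using assms that zG(2)[of "Suc m" z] GS_far[OF assms(1,2) zG(2) that] by auto
qed

text \<open>Meaningful where \<open>Dn\<close> is nonzero; at a zero of \<open>Dn\<close> the
  quotient takes the default value 0.\<close>

definition zf :: "nat \<Rightarrow> (nat \<Rightarrow> complex) \<Rightarrow> complex" where
  "zf m s = zG m s / Dn m s"

lemma zf_differentiable:
  "m \<ge> 1 \<Longrightarrow> m \<le> n \<Longrightarrow> Dn m z \<noteq> 0 \<Longrightarrow> complex_differentiable_at m (zf m) z"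
  unfolding zf_def by (intro cd_divide zG Dn_differentiable)

theorem zf_recursion:
  assumes m: "m \<ge> 1" "Suc m \<le> n" and s: "region (Suc m) (real R) s" and D: "Dn (Suc m) s \<noteq> 0"
  defines "d' \<equiv> d (Suc m)" and "s' \<equiv> s (Suc m)"
  shows "zf (Suc m) s = main_const d' (\<gamma> (Suc m)) * (Gamma (s' - 1 / of_nat d') * rGamma s') *
       zf m (merge_last m (- (1 / of_nat d')) s)
     - (\<Sum>i<depth m R. em_coeff d' (\<gamma> (Suc m)) s' i * zf m (merge_last m (of_nat i) s)) + rem_sum m (depth m R) s"
proof -
  define a where "a = rGamma (s' - 1 / of_nat d')"
  define D0 where "D0 = Dn m (merge_last m 0 s)"
  define D1 where "D1 = Dn m (merge_last m (- (1 / of_nat d')) s)"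
  have nz: "a \<noteq> 0" "D0 \<noteq> 0" "D1 \<noteq> 0" and DS: "Dn (Suc m) s = a * D0 * D1"
    using D by (auto simp: a_def D0_def D1_def d'_def s'_def)
  have Gi: "em_coeff d' (\<gamma> (Suc m)) s' i * shift_factor m i (merge_last m 0 s) * zG m (merge_last m (of_nat i) s) =
     D0 * (em_coeff d' (\<gamma> (Suc m)) s' i * zf m (merge_last m (of_nat i) s))" for i
    using nz unfolding D0_def Dn_merge_shift[of m s i] by (simp add: zf_def)
  define r where "r = rGamma s'"
  define k where "k = main_const d' (\<gamma> (Suc m))"
  define z where "z = zf m (merge_last m (- (1 / of_nat d')) s)"
  define S where "S = (\<Sum>i<depth m R. em_coeff d' (\<gamma> (Suc m)) s' i * zf m (merge_last m (of_nat i) s))"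
  define q where "q = rem_sum m (depth m R) s"
  have z: "zG m (merge_last m (- (1 / of_nat d')) s) = D1 * z" using nz by (simp add: z_def zf_def D1_def)
  have "zG (Suc m) s = k * r * D0 * (D1 * z) + a * D1 * (D0 * q - D0 * S)"
    unfolding zG_Suc[OF m s] GS_def d'_def[symmetric] s'_def[symmetric] Gi z sum_distrib_left[symmetric]
      a_def[symmetric] D0_def[symmetric] D1_def[symmetric] r_def[symmetric] k_def[symmetric] S_def[symmetric] q_def[symmetric] ..
  then have "zf (Suc m) s = k * (inverse a * r) * z - S + q"
    unfolding zf_def DS using nz by (simp add: field_simps)
  then show ?thesis by (simp add: k_def a_def r_def z_def S_def q_def Gamma_def)
qed

text \<open>With W = d_1 M this is \<gamma>_1^M times the Riemann zeta value -B_(W+1) / (W + 1). At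
  a nonpositive integer the remainder vanishes and the expansion is a finite Bernoulli sum.\<close>

lemma zf_1_value:
  assumes n: "n \<ge> 1" and s: "s 1 = - of_nat M" and D: "Dn 1 s \<noteq> 0"
  shows "zf 1 s = - (\<gamma> 1 ^ M * bernoulli_plus (d 1 * M + 1) / of_nat (d 1 * M + 1))"
proof -
  have d1: "d 1 \<ge> 1" using n d_ge_1 by auto
  have g1: "\<gamma> 1 \<noteq> 0" using Re_gamma[of 1] n by auto
  \<comment> \<open>One more than M, since the region is the open half-plane Re u > -R.\<close>
  define R where "R = Suc M"
  define W where "W = d 1 * M"
  define J where "J = 2 + d 1 * R"
  have JW: "W < J" by (simp add: J_def W_def R_def)
  define z where "z = (- of_nat M - 1 / of_nat (d 1) :: complex)"
  have z: "z = - (of_nat (W + 1) / of_nat (d 1))" using d1 by (simp add: z_def W_def field_simps)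
  have z0: "z \<noteq> 0" unfolding z using d1 by (simp del: of_nat_Suc of_nat_add)
  have rz: "rGamma z = z * rGamma (z + 1)" using rGamma_plus1[of z] by simp
  have zf: "zf 1 s = \<gamma> 1 ^ M * (rGamma z * zeta_regular_part J (- of_nat W) + rGamma (z + 1) / of_nat (d 1)) / rGamma z"
    using zG_1[OF n, of R s] s g1 by (simp add: zf_def R_def G1_def z_def J_def W_def powr_nat')
  have nz: "rGamma z \<noteq> 0" using D s by (simp add: z_def)
  then have z1: "rGamma (z + 1) \<noteq> 0" using rz by auto
  have em: "em_rem 1 1 1 (- of_nat W) J = 0" using JW by (intro em_rem_eq_0) auto
  have "(\<Sum>i<J. em_coeff 1 1 (- of_nat W) i) = (\<Sum>i\<le>W. em_coeff 1 1 (- of_nat W) i)"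
    by (rule sum.mono_neutral_right) (use JW in \<open>auto simp: em_coeff_nat binomial_eq_0\<close>)
  also have "\<dots> = 1 - 1 / of_nat (W + 1) + bernoulli_plus (W + 1) / of_nat (W + 1)"
    using sum_choose_bernoulli_plus[of W] by (simp add: em_coeff_nat)
  finally have "zeta_regular_part J (- of_nat W) = 1 / of_nat (W + 1) - bernoulli_plus (W + 1) / of_nat (W + 1)"
    unfolding zeta_regular_part_def em by simp
  moreover have "rGamma (z + 1) / of_nat (d 1) / rGamma z = - (1 / of_nat (W + 1))"
    unfolding rz using z1 d1 by (simp add: z field_simps del: of_nat_Suc of_nat_add)
  moreover have "zf 1 s = \<gamma> 1 ^ M * (zeta_regular_part J (- of_nat W) + rGamma (z + 1) / of_nat (d 1) / rGamma z)"
    unfolding zf using nz by (simp add: field_simps)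
  ultimately show ?thesis by (simp add: W_def)
qed

end

section \<open>Values of the continuation\<close>

lemma not_nonpos_Int_if_Re_pos: "Re z > 0 \<Longrightarrow> z \<notin> \<int>\<^sub>\<le>\<^sub>0"
  by (auto elim!: nonpos_Ints_cases)

section \<open>Comparison with the meromorphic continuation\<close>

context multizeta
begin

lemma Dn_far: "m \<le> n \<Longrightarrow> far m s \<Longrightarrow> Dn m s \<noteq> 0"
proof (induction m arbitrary: s)
  case (Suc m)
  have d: "d (Suc m) \<ge> 1" using Suc.prems by (intro d_ge_1) auto
  then have "1 / real (d (Suc m)) \<le> 1" by simp
  moreover have "Re (s (Suc m)) > 2" using Suc.prems by (auto simp: far_def)
  ultimately have "Re (s (Suc m) - 1 / of_nat (d (Suc m))) > 0" by (simp add: Re_divide_of_nat)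
  then have "rGamma (s (Suc m) - 1 / of_nat (d (Suc m))) \<noteq> 0"
    using not_nonpos_Int_if_Re_pos by (simp add: rGamma_eq_zero_iff)
  moreover have "Dn m (merge_last m c s) \<noteq> 0" if "Re c \<ge> -1" for c
  proof (cases "m = 0")
    case False
    then show ?thesis using Suc.prems by (intro Suc.IH far_merge_last that) auto
  qed simp
  ultimately show ?case using Re_inverse_le_1[OF d] by simp
qed simp

text \<open>A continuation must agree with the series on the whole interior of the domain of
  absolute convergence, not merely where every real part exceeds 2. Around s there is room to step
  back diagonally by e; the terms at s + t with Re t > -e are then dominated by those at s - e, and
  the diagonal half-plane reaches the far region.\<close>

lemma zG_domain:
  assumes m: "m \<ge> 1" "m \<le> n" and s: "s \<in> mzeta_domain m d \<gamma>"
  shows "zG m s = Dn m s * Z m s"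
proof -
  obtain r where r: "r > 0" "\<forall>w\<in>polydisc m s r. (\<lambda>x. norm (mzeta_term m d \<gamma> w x)) summable_on mzeta_indices m"
    using s by (auto simp: mzeta_domain_def)
  define e where "e = r / 2"
  have e: "e > 0" using r by (simp add: e_def)
  define s0 where "s0 = (\<lambda>i. s i - of_real e)"
  have "s0 \<in> polydisc m s r" using r by (auto simp: polydisc_def e_def s0_def)
  then have sm: "(\<lambda>x. norm (mzeta_term m d \<gamma> s0 x)) summable_on mzeta_indices m" using r by blast
  define L where "L t = (\<lambda>i. s i + t * 1)" for t :: complex
  have term_L: "norm (mzeta_term m d \<gamma> (L t) x) \<le> powr_const lo hi B ^ m * norm (mzeta_term m d \<gamma> s0 x)"
    if t: "Re t > - e" "norm (t + of_real e) \<le> B" and x: "x \<in> mzeta_indices m" for t B x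
  proof -
    have eq: "mzeta_term m d \<gamma> (L t) x = mzeta_term m d \<gamma> s0 x * (\<Prod>j=1..m. base x j powr (- (t + of_real e)))"
      unfolding mzeta_term_eq prod.distrib[symmetric]
    proof (intro prod.cong refl)
      fix j
      have "- L t j = - s0 j + - (t + of_real e)" by (simp add: L_def s0_def)
      then show "base x j powr (- L t j) = base x j powr (- s0 j) * base x j powr (- (t + of_real e))"
        by (simp only: powr_add)
    qed
    have "norm (\<Prod>j=1..m. base x j powr (- (t + of_real e))) \<le> (\<Prod>j=1..m. powr_const lo hi B)"
      unfolding prod_norm[symmetric]
    proof (intro prod_mono conjI norm_ge_zero)
      fix j assume j: "j \<in> {1..m}"
      have "norm (base x j powr (- (t + of_real e))) \<le> powr_const lo hi B * size_at x j powr (- Re (t + of_real e))"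
        using m t j by (intro base_powr_bound[OF x]) auto
      also have "size_at x j powr (- Re (t + of_real e)) \<le> size_at x j powr 0"
        using size_ge_1[OF x j] m t by (intro powr_mono) auto
      also have "size_at x j powr 0 = 1" using size_ge_1[OF x j] m by simp
      finally show "norm (base x j powr (- (t + of_real e))) \<le> powr_const lo hi B" by (simp add: mult_left_mono)
    qed
    then show ?thesis unfolding eq norm_mult by (simp add: mult_left_mono mult.commute)
  qed
  have hol: "(\<lambda>t. Z m (L t)) holomorphic_on {t. Re t > - e}"
    unfolding Z_def
  proof (rule holomorphic_on_infsum[OF open_Re_gt])
    fix x assume x: "x \<in> mzeta_indices m"
    show "(\<lambda>t. mzeta_term m d \<gamma> (L t) x) holomorphic_on {t. Re t > - e}"
      unfolding mzeta_term_eq L_def using base_pos[OF x] m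
      by (intro holomorphic_on_prod holomorphic_intros; auto)
  next
    fix z assume z: "z \<in> {t. Re t > - e}"
    define B where "B = norm (z + of_real e) + 1"
    have "((\<lambda>t. t + of_real e) \<longlongrightarrow> z + of_real e) (nhds z)"
      by (intro tendsto_intros filterlim_ident)
    then have "\<forall>\<^sub>F t in nhds z. norm (t + of_real e) < B"
      unfolding B_def by (intro order_tendstoD(2)[OF tendsto_norm]) auto
    moreover have "\<forall>\<^sub>F t in nhds z. t \<in> {t. Re t > - e}"
      by (rule eventually_nhds_in_open[OF open_Re_gt z])
    ultimately have "\<forall>\<^sub>F t in nhds z. \<forall>x\<in>mzeta_indices m. norm (mzeta_term m d \<gamma> (L t) x)
        \<le> powr_const lo hi B ^ m * norm (mzeta_term m d \<gamma> s0 x)"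
      by eventually_elim (use term_L[where B = B] in auto)
    moreover have "(\<lambda>x. powr_const lo hi B ^ m * norm (mzeta_term m d \<gamma> s0 x)) summable_on mzeta_indices m"
      by (rule summable_on_cmult_right[OF sm])
    ultimately show "\<exists>M. M summable_on mzeta_indices m \<and>
        (\<forall>\<^sub>F t in nhds z. \<forall>x\<in>mzeta_indices m. norm (mzeta_term m d \<gamma> (L t) x) \<le> M x)"
      by blast
  qed
  have fd: "(\<lambda>t. h (L t)) holomorphic_on {t. Re t > - e}"
    if h: "\<And>z. complex_differentiable_at m h z" for h
    unfolding holomorphic_on_def
  proof
    fix t assume "t \<in> {t. Re t > - e}"
    show "(\<lambda>t. h (L t)) field_differentiable at t within {t. Re t > - e}"
      using field_differentiable_line[of m h s t "\<lambda>_. 1"] h by (simp add: L_def field_differentiable_at_within)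
  qed
  obtain B where B: "\<forall>j\<in>{1..m}. norm (s j) \<le> B" using exists_bound by blast
  have "zG m (L 0) - Dn m (L 0) * Z m (L 0) = 0"
  proof (rule halfplane_identity[where f = "\<lambda>t. zG m (L t) - Dn m (L t) * Z m (L t)" and c = "- e" and c' = "max (- e) (2 + B)"])
    show "(\<lambda>t. zG m (L t) - Dn m (L t) * Z m (L t)) holomorphic_on {t. Re t > - e}"
      by (intro holomorphic_on_diff holomorphic_on_mult fd hol zG m Dn_differentiable)
    fix x :: real assume x: "x > max (- e) (2 + B)"
    have "far m (L (of_real x))"
      unfolding far_def
    proof
      fix j assume "j \<in> {1..m}"
      then have "norm (s j) \<le> B" using B by blast
      then have "Re (s j) \<ge> - B" using abs_Re_le_cmod[of "s j"] by linarith
      then show "Re (L (of_real x) j) > 2" using x by (simp add: L_def)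
    qed
    then show "zG m (L (of_real x)) - Dn m (L (of_real x)) * Z m (L (of_real x)) = 0"
      using zG(2)[OF m] by simp
  qed (use e in auto)
  then show ?thesis by (simp add: L_def)
qed

text \<open>At a point of the convergence domain where \<open>Dn\<close> vanishes, \<open>zf\<close>
  would give 0 instead of the sum, so the sum takes precedence.\<close>

definition cont :: "nat \<Rightarrow> (nat \<Rightarrow> complex) \<Rightarrow> complex" where
  "cont m s = (if s \<in> mzeta_domain m d \<gamma> then Z m s else zf m s)"

lemma cont_eq_zf: "m \<ge> 1 \<Longrightarrow> m \<le> n \<Longrightarrow> Dn m s \<noteq> 0 \<Longrightarrow> cont m s = zf m s"
  using zG_domain[of m s] by (simp add: cont_def zf_def)

lemma eventually_Dn_nonzero: "Dn m s \<noteq> 0 \<Longrightarrow> \<forall>\<^sub>F w in nbh m s. Dn m w \<noteq> 0"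
  by (intro tendsto_imp_eventually_ne[OF cd_tendsto] Dn_differentiable)

lemma cont_regular:
  assumes "m \<ge> 1" "m \<le> n" "Dn m s \<noteq> 0"
  shows "regular_at m (cont m) s"
proof -
  have cd: "complex_differentiable_at m (cont m) w" if "Dn m w \<noteq> 0" for w
  proof (rule cd_cong[OF zf_differentiable[OF assms(1,2) that]])
    show "\<forall>\<^sub>F v in nbh m w. zf m v = cont m v"
      using eventually_Dn_nonzero[OF that] by eventually_elim (use cont_eq_zf[OF assms(1,2)] in simp)
  qed
  obtain r where "r > 0" "\<forall>w\<in>polydisc m s r. Dn m w \<noteq> 0"
    using eventually_Dn_nonzero[OF assms(3)] by (auto simp: eventually_nbh)
  then show ?thesis using cd unfolding regular_at_def holomorphic_on_polydisc_def by blast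
qed

lemma cont_is_continuation:
  assumes "m \<ge> 1" "m \<le> n"
  shows "is_mzeta_continuation m d \<gamma> (cont m)"
  unfolding is_mzeta_continuation_def
proof
  show "\<forall>s\<in>mzeta_domain m d \<gamma>. cont m s = infsum (mzeta_term m d \<gamma> s) (mzeta_indices m)"
    by (simp add: cont_def Z_def)
  show "meromorphic_Cm m (cont m)"
    unfolding meromorphic_Cm_def
  proof
    fix p :: "nat \<Rightarrow> complex"
    have "\<exists>w\<in>polydisc m p 1. Dn m w \<noteq> 0"
    proof -
      \<comment> \<open>The far point (3, ..., 3) has nonzero denominator. One large polydisc
        contains both it and p, so the zeros of \<open>Dn\<close> cannot fill the unit polydisc
        about p.\<close>
      define q :: "nat \<Rightarrow> complex" where "q = (\<lambda>_. 3)"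
      obtain B where B: "\<forall>j\<in>{1..m}. norm (q j - p j) \<le> B" using exists_bound[of m "\<lambda>j. q j - p j"] by blast
      define R where "R = max B 0 + 1"
      have "q \<in> polydisc m p R" using B by (force simp: polydisc_def R_def)
      moreover have "Dn m q \<noteq> 0" using assms by (intro Dn_far) (auto simp: far_def q_def)
      moreover have "p \<in> polydisc m p R" by (simp add: R_def)
      moreover have "\<forall>\<^sub>F w in nbh m p. w \<in> polydisc m p 1" by (rule eventually_polydisc_nbh) simp
      ultimately show ?thesis
        using polydisc_nonzero_dense[of m "Dn m" p R q p "\<lambda>w. w \<in> polydisc m p 1"] Dn_differentiable
        by (auto simp: holomorphic_on_polydisc_def)
    qed
    then show "\<exists>r>0. \<exists>g h. holomorphic_on_polydisc m g p r \<and> holomorphic_on_polydisc m h p r \<and>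
        (\<exists>z\<in>polydisc m p r. h z \<noteq> 0) \<and> (\<forall>z\<in>polydisc m p r. h z \<noteq> 0 \<longrightarrow> cont m z = g z / h z)"
      using zG(1)[OF assms] Dn_differentiable cont_eq_zf[OF assms]
      by (intro exI[of _ 1] exI[of _ "zG m"] exI[of _ "Dn m"] conjI)
         (simp_all add: holomorphic_on_polydisc_def zf_def)
  qed
qed

text \<open>All continuations agree near the far point (3, ..., 3), hence by the meromorphic
  identity theorem at every point where they are regular; so the definite description denotes the
  value of \<open>cont\<close>.\<close>

theorem mzeta_eq_zf:
  assumes m: "m \<ge> 1" "m \<le> n" and D: "Dn m s \<noteq> 0"
  shows "mzeta_regular m d \<gamma> s" "mzeta m d \<gamma> s = zf m s"
proof -
  note c = cont_is_continuation[OF m] cont_regular[OF m D]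
  then show "mzeta_regular m d \<gamma> s" unfolding mzeta_regular_def by blast
  have uniq: "f s = zf m s" if f: "is_mzeta_continuation m d \<gamma> f" "regular_at m f s" for f
  proof -
    define q :: "nat \<Rightarrow> complex" where "q = (\<lambda>_. 3)"
    have "region m (-2) q" by (simp add: region_def q_def)
    from eventually_region[OF this] have "\<forall>\<^sub>F w in nbh m q. f w = cont m w"
    proof eventually_elim
      case (elim w)
      then have "w \<in> mzeta_domain m d \<gamma>" using far_in_domain[OF m(2)] by (simp add: far_region)
      then show ?case using f(1) by (simp add: is_mzeta_continuation_def cont_def Z_def)
    qed
    then have "f s = cont m s"
      using f c by (intro meromorphic_identity[of m f "cont m" q s]) (auto simp: is_mzeta_continuation_def)
    then show ?thesis using cont_eq_zf[OF m D] by simp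
  qed
  show "mzeta m d \<gamma> s = zf m s"
    unfolding mzeta_def using c uniq cont_eq_zf[OF m D] by (intro the_equality) blast+
qed

section \<open>Polar hyperplanes and values at nonpositive integers\<close>

lemma sum_merge_last:
  assumes "j \<in> {1..m}"
  shows "(\<Sum>i=j..m. merge_last m c s i) = (\<Sum>i=j..Suc m. s i) + c"
proof -
  obtain k where k: "m = Suc k" using assms by (cases m) auto
  have "(\<Sum>i=j..k. merge_last m c s i) = (\<Sum>i=j..k. s i)"
    by (intro sum.cong) (auto simp: merge_last_def k)
  then show ?thesis using assms by (simp add: k merge_last_def)
qed

text \<open>Unfolding the recursion of \<open>Dn\<close>, E collects the indices at which the factor
  with shift -1/d was taken rather than the one with shift 0; each zero lies on a hyperplane
  recorded by such a pair j, E.\<close>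

lemma Dn_nonzero:
  assumes "\<And>j E. j \<in> {1..m} \<Longrightarrow> E \<subseteq> {j+1..m} \<Longrightarrow>
     (\<Sum>i=j..m. s i) - (1 / of_nat (d j) + (\<Sum>k\<in>E. 1 / of_nat (d k))) \<notin> \<int>\<^sub>\<le>\<^sub>0"
  shows "Dn m s \<noteq> 0"
  using assms
proof (induction m arbitrary: s)
  case (Suc m)
  have "rGamma (s (Suc m) - 1 / of_nat (d (Suc m))) \<noteq> 0"
    using Suc.prems[of "Suc m" "{}"] by (simp add: rGamma_eq_zero_iff)
  moreover have "Dn m (merge_last m 0 s) \<noteq> 0"
  proof (rule Suc.IH)
    fix j E assume jE: "j \<in> {1..m}" "E \<subseteq> {j+1..m}"
    show "(\<Sum>i=j..m. merge_last m 0 s i) - (1 / of_nat (d j) + (\<Sum>k\<in>E. 1 / of_nat (d k))) \<notin> \<int>\<^sub>\<le>\<^sub>0"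
      unfolding sum_merge_last[OF jE(1)] using Suc.prems[of j E] jE by fastforce
  qed
  moreover have "Dn m (merge_last m (- (1 / of_nat (d (Suc m)))) s) \<noteq> 0"
  proof (rule Suc.IH)
    fix j E assume jE: "j \<in> {1..m}" "E \<subseteq> {j+1..m}"
    have "finite E" "Suc m \<notin> E" using jE(2) finite_subset by auto
    then have "(\<Sum>k\<in>insert (Suc m) E. 1 / of_nat (d k)) = 1 / of_nat (d (Suc m)) + (\<Sum>k\<in>E. 1 / of_nat (d k) :: complex)"
      by simp
    moreover have "insert (Suc m) E \<subseteq> {j+1..Suc m}" "j \<in> {1..Suc m}" using jE by auto
    ultimately show "(\<Sum>i=j..m. merge_last m (- (1 / of_nat (d (Suc m)))) s i) -
        (1 / of_nat (d j) + (\<Sum>k\<in>E. 1 / of_nat (d k))) \<notin> \<int>\<^sub>\<le>\<^sub>0"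
      unfolding sum_merge_last[OF jE(1)] using Suc.prems[of j "insert (Suc m) E"] by (simp add: algebra_simps)
  qed
  ultimately show ?case by simp
qed simp

lemma exists_region: "\<exists>R\<ge>(M::nat). region m (real R) s"
proof -
  obtain B where B: "\<forall>j\<in>{1..m}. norm (s j) \<le> B" using exists_bound by blast
  obtain R0 :: nat where R0: "real R0 > B" using reals_Archimedean2 by blast
  have "region m (real (max M R0)) s"
    unfolding region_def
  proof
    fix j assume "j \<in> {1..m}"
    then have "norm (s j) \<le> B" using B by blast
    then show "- real (max M R0) < Re (s j)" using abs_Re_le_cmod[of "s j"] R0 by simp
  qed
  then show ?thesis by (intro exI[of _ "max M R0"]) simp
qed

lemma Dn_merge_nat_nonzero: "Dn (Suc m) s \<noteq> 0 \<Longrightarrow> Dn m (merge_last m (of_nat i) s) \<noteq> 0"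
  using Dn_merge_shift[of m s i] by auto

text \<open>At nonpositive integers the main term and the remainder vanish.\<close>

lemma zf_at_nonpos:
  assumes m: "m \<ge> 1" "Suc m \<le> n" and D: "Dn (Suc m) s \<noteq> 0" and s: "s (Suc m) = - of_nat a"
  shows "zf (Suc m) s = - (\<Sum>i\<le>a. em_coeff (d (Suc m)) (\<gamma> (Suc m)) (- of_nat a) i * zf m (merge_last m (of_nat i) s))"
proof -
  obtain R where R: "R \<ge> a" "region (Suc m) (real R) s" using exists_region by blast
  have aJ: "a < depth m R" using R by (simp add: depth_def)
  have "rGamma (- of_nat a :: complex) = 0" by (simp add: rGamma_eq_zero_iff)
  then have "zf (Suc m) s = - (\<Sum>i<depth m R. em_coeff (d (Suc m)) (\<gamma> (Suc m)) (- of_nat a) i * zf m (merge_last m (of_nat i) s))"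
    using zf_recursion[OF m R(2) D] s rem_sum_eq_0[where s = s, OF m(2) aJ s] by simp
  also have "(\<Sum>i<depth m R. em_coeff (d (Suc m)) (\<gamma> (Suc m)) (- of_nat a) i * zf m (merge_last m (of_nat i) s)) =
     (\<Sum>i\<le>a. em_coeff (d (Suc m)) (\<gamma> (Suc m)) (- of_nat a) i * zf m (merge_last m (of_nat i) s))"
    by (rule sum.mono_neutral_right) (use aJ in \<open>auto simp: em_coeff_nat binomial_eq_0\<close>)
  finally show ?thesis .
qed

end

lemma subfield_closed:
  assumes "is_subfield K"
  shows "0 \<in> K" "1 \<in> K" "x \<in> K \<Longrightarrow> y \<in> K \<Longrightarrow> x + y \<in> K" "x \<in> K \<Longrightarrow> - x \<in> K" "x \<in> K \<Longrightarrow> y \<in> K \<Longrightarrow> x - y \<in> K"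
    "x \<in> K \<Longrightarrow> y \<in> K \<Longrightarrow> x * y \<in> K" "x \<in> K \<Longrightarrow> x ^ k \<in> K" "x \<in> K \<Longrightarrow> y \<in> K \<Longrightarrow> x / y \<in> K"
proof -
  show one: "1 \<in> K" using assms by (simp add: is_subfield_def)
  show diff: "x - y \<in> K" if "x \<in> K" "y \<in> K" for x y using assms that by (simp add: is_subfield_def)
  show zero: "0 \<in> K" using diff[OF one one] by simp
  show minus: "- x \<in> K" if "x \<in> K" for x using diff[OF zero that] by simp
  show "x + y \<in> K" if "x \<in> K" "y \<in> K" for x y using diff[OF that(1) minus[OF that(2)]] by simp
  show mult: "x * y \<in> K" if "x \<in> K" "y \<in> K" for x y using assms that by (simp add: is_subfield_def)
  show "x ^ k \<in> K" if "x \<in> K" for x k using that by (induction k) (auto intro: one mult)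
  show "x / y \<in> K" if "x \<in> K" "y \<in> K" for x y
    using assms that zero by (cases "y = 0") (simp_all add: is_subfield_def)
qed

lemma subfield_sum: "is_subfield K \<Longrightarrow> (\<And>i. i \<in> I \<Longrightarrow> f i \<in> K) \<Longrightarrow> sum f I \<in> K"
  by (induction I rule: infinite_finite_induct) (auto intro: subfield_closed)

lemma Rats_subset_subfield:
  assumes "is_subfield K" "x \<in> \<rat>"
  shows "x \<in> K"
proof -
  have nat: "of_nat k \<in> K" for k
    by (induction k) (auto intro: subfield_closed[OF assms(1)])
  have int: "of_int k \<in> K" for k
    by (cases k) (auto intro: nat subfield_closed[OF assms(1)] simp flip: of_nat_Suc simp del: of_nat_Suc)
  from assms(2) obtain a b where "x = of_int a / of_int b" by (auto elim: Rats_cases')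
  then show ?thesis using int subfield_closed(8)[OF assms(1)] by auto
qed

lemma is_subfield_rat_adjoin: "is_subfield (rat_adjoin S)"
  unfolding rat_adjoin_def by (auto simp: is_subfield_def)

lemma rat_adjoin_superset: "S \<subseteq> rat_adjoin S"
  by (auto simp: rat_adjoin_def)

lemma bernoulli_plus_in_Rats: "bernoulli_plus k \<in> \<rat>"
  using bernoulli_in_Rats by (simp add: bernoulli_plus_def)

context multizeta
begin

text \<open>The recursion at -a uses only shifts i with i <= a_(m+1), so the merged last coordinate
  -(a_m + a_(m+1) - i) is again a nonpositive integer. All coefficients are rational multiples of
  powers of \<gamma>_(m+1).\<close>

lemma zf_in_rat_adjoin:
  assumes "m \<ge> 1" "m \<le> n" "Dn m s \<noteq> 0" "\<And>i. i \<in> {1..m} \<Longrightarrow> s i = - of_nat (a i)"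
  shows "zf m s \<in> rat_adjoin (\<gamma> ` {1..n})"
  using assms
proof (induction m arbitrary: s a rule: dec_induct)
  case base
  note K = subfield_closed[OF is_subfield_rat_adjoin]
  have "\<gamma> 1 \<in> rat_adjoin (\<gamma> ` {1..n})" using base rat_adjoin_superset[of "\<gamma> ` {1..n}"] by auto
  moreover have "zf 1 s = - (\<gamma> 1 ^ a 1 * bernoulli_plus (d 1 * a 1 + 1) / of_nat (d 1 * a 1 + 1))"
    using base by (intro zf_1_value) auto
  ultimately show ?case
    using Rats_subset_subfield[OF is_subfield_rat_adjoin]
    by (auto intro!: K bernoulli_plus_in_Rats simp del: of_nat_add of_nat_Suc)
next
  case (step m)
  note K = subfield_closed[OF is_subfield_rat_adjoin]
  let ?K = "rat_adjoin (\<gamma> ` {1..n})"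
  have g: "\<gamma> (Suc m) \<in> ?K" using step rat_adjoin_superset[of "\<gamma> ` {1..n}"] by auto
  have "em_coeff (d (Suc m)) (\<gamma> (Suc m)) (- of_nat (a (Suc m))) i * zf m (merge_last m (of_nat i) s) \<in> ?K"
    if "i \<le> a (Suc m)" for i
  proof (intro K(6))
    show "em_coeff (d (Suc m)) (\<gamma> (Suc m)) (- of_nat (a (Suc m))) i \<in> ?K"
      unfolding em_coeff_nat using Rats_subset_subfield[OF is_subfield_rat_adjoin]
      by (intro K g) (auto intro!: bernoulli_plus_in_Rats simp del: of_nat_add of_nat_Suc)
    show "zf m (merge_last m (of_nat i) s) \<in> ?K"
    proof (rule step.IH[where a = "a(m := a m + (a (Suc m) - i))"])
      show "merge_last m (of_nat i) s j = - of_nat ((a(m := a m + (a (Suc m) - i))) j)" if "j \<in> {1..m}" for j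
        using step.prems(3)[of j] step.prems(3)[of "Suc m"] that \<open>i \<le> a (Suc m)\<close>
        by (auto simp: merge_last_def of_nat_diff)
    qed (use step Dn_merge_nat_nonzero[OF step.prems(2)] in auto)
  qed
  then have "(\<Sum>i\<le>a (Suc m). em_coeff (d (Suc m)) (\<gamma> (Suc m)) (- of_nat (a (Suc m))) i * zf m (merge_last m (of_nat i) s)) \<in> ?K"
    by (intro subfield_sum[OF is_subfield_rat_adjoin]) auto
  then show ?case
    using zf_at_nonpos[of m s "a (Suc m)"] step by (auto intro: K)
qed

end

section \<open>The directional limit\<close>

lemma not_nonpos_Int_diff:
  fixes x :: real
  assumes "x \<ge> 0" "x \<notin> \<nat>"
  shows "- of_nat a - complex_of_real x \<notin> \<int>\<^sub>\<le>\<^sub>0"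
proof
  assume "- of_nat a - complex_of_real x \<in> \<int>\<^sub>\<le>\<^sub>0"
  then obtain k where "- of_nat a - complex_of_real x = of_int k" by (rule nonpos_Ints_cases)
  then have "Re (- of_nat a - complex_of_real x) = Re (of_int k)" by simp
  then have x: "x = of_int (- k - int a)" by simp
  then have "- k - int a \<ge> 0" using assms(1) by linarith
  then have "x = of_nat (nat (- k - int a))" using x by simp
  then show False using assms(2) by (metis of_nat_in_Nats)
qed

text \<open>Either p lies in the open complement, or p is an integer and a nonzero displacement of
  modulus below 1 cannot lead to another integer.\<close>

lemma eventually_affine_not_nonpos_Int:
  fixes p v :: complex
  assumes "p \<notin> \<int>\<^sub>\<le>\<^sub>0 \<or> v \<noteq> 0"
  shows "\<forall>\<^sub>F t in at 0. p + t * v \<notin> \<int>\<^sub>\<le>\<^sub>0"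
proof (cases "p \<in> \<int>\<^sub>\<le>\<^sub>0")
  case False
  have "((\<lambda>t. p + t * v) \<longlongrightarrow> p + 0 * v) (at 0)" by (intro tendsto_intros)
  moreover have "open (- \<int>\<^sub>\<le>\<^sub>0 :: complex set)" "p + 0 * v \<in> - \<int>\<^sub>\<le>\<^sub>0"
    using False by (auto intro: closed_nonpos_Ints)
  ultimately have "\<forall>\<^sub>F t in at 0. p + t * v \<in> - \<int>\<^sub>\<le>\<^sub>0" by (rule topological_tendstoD)
  then show ?thesis by simp
next
  case True
  then obtain k where k: "p = of_int k" by (rule nonpos_Ints_cases)
  have v: "v \<noteq> 0" using assms True by simp
  have "((\<lambda>t. norm (t * v)) \<longlongrightarrow> norm (0 * v)) (at 0)" by (intro tendsto_intros)
  then have "\<forall>\<^sub>F t in at 0. norm (t * v) < 1" by (rule order_tendstoD) simp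
  moreover have "\<forall>\<^sub>F t in at 0. t \<noteq> (0 :: complex)" by (simp add: eventually_at_filter)
  ultimately show ?thesis
  proof eventually_elim
    case (elim t)
    show ?case
    proof
      assume "p + t * v \<in> \<int>\<^sub>\<le>\<^sub>0"
      then obtain l where "p + t * v = of_int l" by (rule nonpos_Ints_cases)
      then have tv: "t * v = of_int (l - k)" using k by (simp add: algebra_simps)
      then have "\<bar>real_of_int (l - k)\<bar> < 1" using elim(1) by (metis norm_of_int)
      then have "l - k = 0" by linarith
      then show False using tv elim(2) v by simp
    qed
  qed
qed

lemma rGamma_residue: "((\<lambda>z. rGamma (- of_nat a + z) / z) \<longlongrightarrow> (-1) ^ a * fact a) (at (0 :: complex))"
proof -
  have "(rGamma has_field_derivative (-1) ^ a * fact a) (at (- of_nat a :: complex))"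
    by (rule has_field_derivative_rGamma_nonpos_int)
  then have "((\<lambda>h. (rGamma (- of_nat a + h) - rGamma (- of_nat a)) / h) \<longlongrightarrow> (-1) ^ a * fact a) (at (0 :: complex))"
    by (rule DERIV_D)
  moreover have "rGamma (- of_nat a) = (0 :: complex)" by (simp add: rGamma_eq_zero_iff)
  ultimately show ?thesis by simp
qed

text \<open>Quotient of two simple zeros of rGamma: the factor t cancels, and the slopes \<alpha>
  and \<beta> remain. This is the only place where the direction of approach enters the
  value.\<close>

lemma rGamma_Gamma_limit:
  fixes \<alpha> \<beta> :: complex
  assumes "\<alpha> \<noteq> 0" "\<beta> \<noteq> 0"
  shows "((\<lambda>t. rGamma (- of_nat a + t * \<alpha>) * Gamma (- of_nat b + t * \<beta>)) \<longlongrightarrow>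
     ((-1) ^ a * fact a * \<alpha>) / ((-1) ^ b * fact b * \<beta>)) (at 0)"
proof -
  have res: "((\<lambda>t. rGamma (- of_nat a + t * \<alpha>) / (t * \<alpha>)) \<longlongrightarrow> (-1) ^ a * fact a) (at 0)"
    if "\<alpha> \<noteq> 0" for a and \<alpha> :: complex
  proof (rule filterlim_compose[OF rGamma_residue])
    have "((\<lambda>t. t * \<alpha>) \<longlongrightarrow> 0 * \<alpha>) (at 0)" by (intro tendsto_intros)
    then show "filterlim (\<lambda>t. t * \<alpha>) (at 0) (at 0)"
      using that by (intro filterlim_atI) (auto simp: eventually_at_filter)
  qed
  have "((\<lambda>t. (rGamma (- of_nat a + t * \<alpha>) / (t * \<alpha>) * \<alpha>) / (rGamma (- of_nat b + t * \<beta>) / (t * \<beta>) * \<beta>)) \<longlongrightarrow>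
     ((-1) ^ a * fact a * \<alpha>) / ((-1) ^ b * fact b * \<beta>)) (at 0)"
    by (intro tendsto_intros res assms) (use assms in auto)
  moreover have "\<forall>\<^sub>F t in at 0. (rGamma (- of_nat a + t * \<alpha>) / (t * \<alpha>) * \<alpha>) / (rGamma (- of_nat b + t * \<beta>) / (t * \<beta>) * \<beta>)
      = rGamma (- of_nat a + t * \<alpha>) * Gamma (- of_nat b + t * \<beta>)"
  proof -
    have "\<forall>\<^sub>F t in at 0. t \<noteq> (0 :: complex)" by (simp add: eventually_at_filter)
    then show ?thesis
      by eventually_elim (use assms in \<open>simp add: Gamma_def field_simps\<close>)
  qed
  ultimately show ?thesis by (rule Lim_transform_eventually)
qed

lemma tendsto_rGamma': "(f \<longlongrightarrow> l) F \<Longrightarrow> ((\<lambda>t. rGamma (f t :: complex)) \<longlongrightarrow> rGamma l) F"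
  by (rule isCont_tendsto_compose[OF isCont_rGamma]) auto

lemma tendsto_Gamma': "(f \<longlongrightarrow> l) F \<Longrightarrow> l \<notin> \<int>\<^sub>\<le>\<^sub>0 \<Longrightarrow> ((\<lambda>t. Gamma (f t :: complex)) \<longlongrightarrow> Gamma l) F"
  by (rule isCont_tendsto_compose[OF isCont_Gamma]) auto

lemma C_coeff_in_Rats: "C_coeff n d b N \<in> \<rat>"
proof -
  have "fact k \<in> (\<rat> :: complex set)" for k by (metis of_nat_fact Rats_of_nat)
  then show ?thesis unfolding C_coeff_def
    by (intro Rats_mult Rats_divide Rats_prod Rats_diff Rats_sum Rats_power)
       (auto simp del: of_nat_add of_nat_mult of_nat_Suc of_nat_sum of_nat_prod)
qed

text \<open>Each u in the product range is negative and the reciprocals subtracted from it are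
  nonnegative, so no factor vanishes.\<close>

lemma C_coeff_nonzero:
  assumes "n \<ge> 3" "\<And>j. j \<in> {1..n} \<Longrightarrow> d j \<ge> 1"
  shows "C_coeff n d b N \<noteq> 0"
proof -
  have "of_int u - (\<Sum>k=j..n. 1 / of_nat (d k)) \<noteq> (0 :: complex)"
    if u: "u \<in> {- (\<Sum>k=j-1..n. int (N k)) .. - (\<Sum>k=j..n. int (N k)) - 1}" for j u
  proof -
    have "(\<Sum>k=j..n. int (N k)) \<ge> 0" by (intro sum_nonneg) auto
    then have "u < 0" using u by auto
    moreover have "(\<Sum>k=j..n. 1 / real (d k)) \<ge> 0" by (intro sum_nonneg) auto
    ultimately have "Re (of_int u - (\<Sum>k=j..n. 1 / of_nat (d k))) < 0" by (simp add: Re_divide_of_nat)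
    then show ?thesis by (metis less_irrefl zero_complex.sel(1))
  qed
  then have "(\<Prod>j=3..n. \<Prod>u\<in>{- (\<Sum>k=j-1..n. int (N k)) .. - (\<Sum>k=j..n. int (N k)) - 1}.
        of_int u - (\<Sum>k=j..n. 1 / of_nat (d k)) :: complex) \<noteq> 0"
    by (simp add: prod_zero_iff)
  moreover have "(of_nat (\<Prod>j=2..n. d j) :: complex) \<noteq> 0"
  proof -
    have "d j \<noteq> 0" if "j \<in> {2..n}" for j using assms(2)[of j] that by auto
    then show ?thesis by simp
  qed
  moreover have "(of_nat (d 1 * ((\<Sum>k=1..n. N k) + b) + 1) :: complex) \<noteq> 0"
    by (metis Suc_eq_plus1 of_nat_neq_0)
  ultimately show ?thesis unfolding C_coeff_def by (simp del: of_nat_add of_nat_mult of_nat_prod)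
qed

section \<open>The approach to -N in the direction \<theta>\<close>

text \<open>The 0-1 vectors of the hypothesis are replaced by the sets E of indices with entry 1,
  which are the sets that label the factors of \<open>Dn\<close>.\<close>

locale multizeta_point = multizeta d \<gamma> n for d \<gamma> n +
  fixes N :: "nat \<Rightarrow> nat" and \<theta> :: "nat \<Rightarrow> complex" and b :: nat
  assumes n3: "n \<ge> 3"
    and nonint: "\<And>j E. j \<in> {1..n} \<Longrightarrow> E \<subseteq> {j+1..n} \<Longrightarrow>
      (1 / real (d j) + (\<Sum>k\<in>E. 1 / real (d k)) \<in> \<nat> \<longleftrightarrow> j = 2 \<and> E = {3..n})"
    and b_eq: "real b = (\<Sum>k=2..n. 1 / real (d k))"
    and theta_sum: "(\<Sum>j=2..n. \<theta> j) \<noteq> 0"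
    and theta_n: "\<theta> n \<noteq> 0"
begin

definition st :: "complex \<Rightarrow> nat \<Rightarrow> complex" where "st t = (\<lambda>j. - of_nat (N j) + t * \<theta> j)"
definition tail :: "nat \<Rightarrow> complex" where "tail i = (\<Sum>k=i+1..n. 1 / of_nat (d k))"

text \<open>\<open>P m t\<close> is the point at which the m-fold zeta function is evaluated after the main term of the
  recursion has been selected \<open>n - m\<close> times, starting from \<open>-N + t \<theta>\<close>; its last coordinate is \<open>X m t\<close>.\<close>

definition X :: "nat \<Rightarrow> complex \<Rightarrow> complex" where "X i t = (\<Sum>k=i..n. st t k) - tail i"
definition P :: "nat \<Rightarrow> complex \<Rightarrow> nat \<Rightarrow> complex" where
  "P m t = (\<lambda>i. if i < m \<or> i > n then st t i else X i t)"

lemma sum_st: "(\<Sum>k=i..n. st t k) = - of_nat (\<Sum>k=i..n. N k) + t * (\<Sum>k=i..n. \<theta> k)"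
  by (simp add: st_def sum.distrib sum_subtractf sum_negf sum_distrib_left)

lemma tail_Suc: "i < n \<Longrightarrow> tail i = 1 / of_nat (d (Suc i)) + tail (Suc i)"
  unfolding tail_def by (subst sum.atLeast_Suc_atMost) auto

lemma P_n: "P n t = st t"
  by (auto simp: P_def X_def tail_def fun_eq_iff)

lemma P_last: "m \<le> n \<Longrightarrow> P m t m = X m t"
  by (simp add: P_def)

lemma P_merge:
  assumes "Suc m \<le> n"
  shows "merge_last m (- (1 / of_nat (d (Suc m)))) (P (Suc m) t) = P m t"
proof
  fix i
  have "X m t = st t m + X (Suc m) t - 1 / of_nat (d (Suc m))"
    unfolding X_def using assms tail_Suc[of m] by (subst sum.atLeast_Suc_atMost) auto
  then show "merge_last m (- (1 / of_nat (d (Suc m)))) (P (Suc m) t) i = P m t i"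
    using assms by (auto simp: merge_last_def P_def)
qed

lemma nonpole:
  assumes "j \<in> {1..n}" "E \<subseteq> {j+1..n}" "\<not> (j = 2 \<and> E = {3..n})"
  shows "(\<Sum>i=j..n. st 0 i) - (1 / of_nat (d j) + (\<Sum>k\<in>E. 1 / of_nat (d k))) \<notin> \<int>\<^sub>\<le>\<^sub>0"
proof -
  define x where "x = 1 / real (d j) + (\<Sum>k\<in>E. 1 / real (d k))"
  have "x \<ge> 0" unfolding x_def by (intro add_nonneg_nonneg sum_nonneg) auto
  moreover have "x \<notin> \<nat>" using nonint[OF assms(1,2)] assms(3) by (simp add: x_def)
  moreover have "(\<Sum>i=j..n. st 0 i) - (1 / of_nat (d j) + (\<Sum>k\<in>E. 1 / of_nat (d k))) =
      - of_nat (\<Sum>k=j..n. N k) - complex_of_real x"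
    unfolding sum_st by (simp add: x_def)
  ultimately show ?thesis using not_nonpos_Int_diff by metis
qed

text \<open>At t = 0 only the factor with j = 2 and E = {3..n} can vanish; its argument moves with
  velocity \<theta>_2 + ... + \<theta>_n, which is nonzero. There are finitely many pairs j, E, so
  one neighbourhood of 0 serves all.\<close>

lemma Dn_path: "\<forall>\<^sub>F t in at 0. Dn n (st t) \<noteq> 0"
proof -
  have "\<forall>\<^sub>F t in at 0. \<forall>j\<in>{1..n}. \<forall>E\<in>Pow {j+1..n}.
     (\<Sum>i=j..n. st t i) - (1 / of_nat (d j) + (\<Sum>k\<in>E. 1 / of_nat (d k))) \<notin> \<int>\<^sub>\<le>\<^sub>0"
  proof (intro eventually_ball_finite ballI)
    fix j E assume jE: "j \<in> {1..n}" "E \<in> Pow {j+1..n}"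
    define p where "p = (\<Sum>i=j..n. st 0 i) - (1 / of_nat (d j) + (\<Sum>k\<in>E. 1 / of_nat (d k)) :: complex)"
    define v where "v = (\<Sum>k=j..n. \<theta> k)"
    have eq: "(\<Sum>i=j..n. st t i) - (1 / of_nat (d j) + (\<Sum>k\<in>E. 1 / of_nat (d k))) = p + t * v" for t
      unfolding p_def v_def sum_st by simp
    have "p \<notin> \<int>\<^sub>\<le>\<^sub>0 \<or> v \<noteq> 0"
      using nonpole[of j E] jE theta_sum by (cases "j = 2 \<and> E = {3..n}") (auto simp: p_def v_def)
    then show "\<forall>\<^sub>F t in at 0. (\<Sum>i=j..n. st t i) - (1 / of_nat (d j) + (\<Sum>k\<in>E. 1 / of_nat (d k))) \<notin> \<int>\<^sub>\<le>\<^sub>0"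
      unfolding eq by (rule eventually_affine_not_nonpos_Int)
  qed auto
  then show ?thesis
  proof eventually_elim
    case (elim t)
    show ?case by (rule Dn_nonzero) (use elim in blast)
  qed
qed

lemma Dn_P:
  assumes "Dn n (st t) \<noteq> 0" "m \<le> n"
  shows "Dn m (P m t) \<noteq> 0"
  using assms(2)
proof (induction m rule: inc_induct)
  case base
  then show ?case using assms(1) by (simp add: P_n)
next
  case (step m)
  then have "Dn m (merge_last m (- (1 / of_nat (d (Suc m)))) (P (Suc m) t)) \<noteq> 0" by simp
  then show ?case using step by (simp add: P_merge)
qed

text \<open>Taking a lower-order term at step m + 1 keeps the index m + 1 out of the set of selected
  main terms. The set is then never {3..n} with j = 2, so these branches are regular even at t = 0;
  shifts by i reduce to shift 0.\<close>

lemma Dn_merge_P: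
  assumes m: "m \<ge> 1" "Suc m \<le> n"
  shows "Dn m (merge_last m (of_nat i) (P (Suc m) 0)) \<noteq> 0"
proof -
  have "Dn m (merge_last m 0 (P (Suc m) 0)) \<noteq> 0"
  proof (rule Dn_nonzero)
    fix j E assume j: "j \<in> {1..m}" and E: "E \<subseteq> {j+1..m}"
    have finE: "finite E" using E finite_subset by blast
    have split: "{j..n} = {j..m} \<union> {Suc m..n}" using j m by auto
    have "(\<Sum>i=j..m. merge_last m 0 (P (Suc m) 0) i) = (\<Sum>i=j..m. P (Suc m) 0 i) + P (Suc m) 0 (Suc m)"
      unfolding sum_merge_last[OF j] using j by simp
    also have "(\<Sum>i=j..m. P (Suc m) 0 i) = (\<Sum>i=j..m. st 0 i)"
      by (intro sum.cong) (auto simp: P_def)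
    also have "P (Suc m) 0 (Suc m) = (\<Sum>i=Suc m..n. st 0 i) - tail (Suc m)"
      using m by (simp add: P_last X_def)
    also have "(\<Sum>i=j..m. st 0 i) + ((\<Sum>i=Suc m..n. st 0 i) - tail (Suc m)) = (\<Sum>i=j..n. st 0 i) - tail (Suc m)"
      unfolding split by (subst sum.union_disjoint) auto
    also have "(\<Sum>i=j..n. st 0 i) - tail (Suc m) - (1 / of_nat (d j) + (\<Sum>k\<in>E. 1 / of_nat (d k))) =
        (\<Sum>i=j..n. st 0 i) - (1 / of_nat (d j) + (\<Sum>k\<in>E \<union> {m+2..n}. 1 / of_nat (d k)))"
      unfolding tail_def using E finE by (subst sum.union_disjoint) auto
    finally have eq: "(\<Sum>i=j..m. merge_last m 0 (P (Suc m) 0) i) - (1 / of_nat (d j) + (\<Sum>k\<in>E. 1 / of_nat (d k))) =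
      (\<Sum>i=j..n. st 0 i) - (1 / of_nat (d j) + (\<Sum>k\<in>E \<union> {m+2..n}. 1 / of_nat (d k)))" by simp
    have "Suc m \<notin> E \<union> {m+2..n}" using E by auto
    moreover have "Suc m \<in> {3..n}" if "j = 2" using that j m by auto
    ultimately have "\<not> (j = 2 \<and> E \<union> {m+2..n} = {3..n})" by metis
    moreover have "E \<union> {m+2..n} \<subseteq> {j+1..n}" using E j m by auto
    ultimately show "(\<Sum>i=j..m. merge_last m 0 (P (Suc m) 0) i) - (1 / of_nat (d j) + (\<Sum>k\<in>E. 1 / of_nat (d k))) \<notin> \<int>\<^sub>\<le>\<^sub>0"
      unfolding eq using j m by (intro nonpole) auto
  qed
  then show ?thesis using Dn_merge_shift[of m "P (Suc m) 0" i] by auto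
qed

lemma tendsto_X: "(X i \<longlongrightarrow> X i 0) (at 0)"
  unfolding X_def st_def by (intro tendsto_intros)

lemma filterlim_P: "filterlim (P m) (nbh m (P m 0)) (at 0)"
proof (rule filterlim_nbh)
  fix i
  show "((\<lambda>t. P m t i) \<longlongrightarrow> P m 0 i) (at 0)"
  proof (cases "i < m \<or> i > n")
    case True
    have "((\<lambda>t. st t i) \<longlongrightarrow> st 0 i) (at 0)" unfolding st_def by (intro tendsto_intros)
    then show ?thesis using True by (simp add: P_def)
  next
    case False
    then show ?thesis using tendsto_X[of i] by (simp add: P_def)
  qed
qed

text \<open>All of the recursion except its main term. Its continuity at t = 0 rests on the
  regularity of the branches that leave the path P.\<close>

definition reg :: "nat \<Rightarrow> nat \<Rightarrow> complex \<Rightarrow> complex" where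
  "reg m R t = rem_sum m (depth m R) (P (Suc m) t) -
     (\<Sum>i<depth m R. em_coeff (d (Suc m)) (\<gamma> (Suc m)) (X (Suc m) t) i * zf m (merge_last m (of_nat i) (P (Suc m) t)))"

abbreviation K :: "nat \<Rightarrow> complex" where "K i \<equiv> main_const (d i) (\<gamma> i)"

lemma reg_tendsto:
  assumes m: "m \<ge> 1" "Suc m \<le> n" and R: "region (Suc m) (real R) (P (Suc m) 0)"
  shows "(reg m R \<longlongrightarrow> reg m R 0) (at 0)"
  unfolding reg_def
proof (intro tendsto_diff tendsto_sum tendsto_mult)
  show "((\<lambda>t. rem_sum m (depth m R) (P (Suc m) t)) \<longlongrightarrow> rem_sum m (depth m R) (P (Suc m) 0)) (at 0)"
    by (rule filterlim_compose[OF cd_tendsto[OF rem_sum_differentiable[OF m R]] filterlim_P])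
  fix i
  have "isCont (\<lambda>u. em_coeff (d (Suc m)) (\<gamma> (Suc m)) u i) (X (Suc m) 0)"
    using em_coeff_holomorphic by (metis UNIV_I continuous_on_eq_continuous_at holomorphic_on_imp_continuous_on open_UNIV)
  then show "((\<lambda>t. em_coeff (d (Suc m)) (\<gamma> (Suc m)) (X (Suc m) t) i) \<longlongrightarrow> em_coeff (d (Suc m)) (\<gamma> (Suc m)) (X (Suc m) 0) i) (at 0)"
    using tendsto_X by (rule isCont_tendsto_compose)
  have z: "(zf m \<longlongrightarrow> zf m (merge_last m (of_nat i) (P (Suc m) 0))) (nbh m (merge_last m (of_nat i) (P (Suc m) 0)))"
    using m Dn_merge_P[OF m] by (intro cd_tendsto zf_differentiable) auto
  show "((\<lambda>t. zf m (merge_last m (of_nat i) (P (Suc m) t))) \<longlongrightarrow> zf m (merge_last m (of_nat i) (P (Suc m) 0))) (at 0)"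
    by (rule filterlim_compose[OF z filterlim_compose[OF filterlim_merge_last[OF m(1)] filterlim_P]])
qed

lemma path_recursion:
  assumes m: "m \<ge> 1" "Suc m \<le> n" and R: "region (Suc m) (real R) (P (Suc m) 0)"
  shows "\<forall>\<^sub>F t in at 0. zf (Suc m) (P (Suc m) t) =
     K (Suc m) * (Gamma (X (Suc m) t - 1 / of_nat (d (Suc m))) * rGamma (X (Suc m) t)) * zf m (P m t) + reg m R t"
  using Dn_path eventually_compose_filterlim[OF eventually_region[OF R] filterlim_P]
proof eventually_elim
  case (elim t)
  show ?case
    using zf_recursion[OF m elim(2) Dn_P[OF elim(1) m(2)]] m by (simp add: P_merge P_last reg_def)
qed

text \<open>The argument at t = 0 of the Gamma factor in step i. \<open>Y 2\<close> equals -M and is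
  the only pole among them.\<close>

definition Y :: "nat \<Rightarrow> complex" where "Y i = X i 0 - 1 / of_nat (d i)"

lemma Y_nonpole:
  assumes "i \<in> {1..n}" "i \<noteq> 2"
  shows "Y i \<notin> \<int>\<^sub>\<le>\<^sub>0"
proof -
  have "Y i = (\<Sum>k=i..n. st 0 k) - (1 / of_nat (d i) + (\<Sum>k\<in>{i+1..n}. 1 / of_nat (d k)))"
    by (simp add: Y_def X_def tail_def)
  then show ?thesis using nonpole[of i "{i+1..n}"] assms by simp
qed

definition M where "M = (\<Sum>k=2..n. N k) + b"

lemma b_complex: "(\<Sum>k=2..n. 1 / of_nat (d k)) = (of_nat b :: complex)"
proof -
  have "complex_of_real (real b) = complex_of_real (\<Sum>k=2..n. 1 / real (d k))" using b_eq by simp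
  then show ?thesis by simp
qed

lemma X_2: "X 2 t - 1 / of_nat (d 2) = - of_nat M + t * (\<Sum>k=2..n. \<theta> k)"
proof -
  have "1 / of_nat (d 2) + tail 2 = (of_nat b :: complex)"
    using b_complex n3 by (subst (asm) sum.atLeast_Suc_atMost) (auto simp: tail_def)
  then show ?thesis unfolding X_def sum_st M_def by (simp add: algebra_simps)
qed

lemma X_1: "X 1 0 = - of_nat ((\<Sum>k=1..n. N k) + b)"
proof -
  have "tail 1 = of_nat b" using b_complex by (simp add: tail_def numeral_2_eq_2)
  then show ?thesis unfolding X_def sum_st by simp
qed

text \<open>The limit of rGamma (st t n) times the Gamma factor of the step to the one-fold zeta
  function, the zeros of 1/Gamma being at -N n and -M.\<close>

definition c :: complex where
  "c = ((-1) ^ N n * fact (N n) * \<theta> n) / ((-1) ^ M * fact M * (\<Sum>k=2..n. \<theta> k))"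

lemma rGamma_st: "((\<lambda>t. rGamma (st t n)) \<longlongrightarrow> 0) (at 0)"
proof -
  have "((\<lambda>t. rGamma (st t n)) \<longlongrightarrow> rGamma (st 0 n)) (at 0)"
    unfolding st_def by (intro tendsto_rGamma' tendsto_intros)
  then show ?thesis by (simp add: st_def rGamma_eq_zero_iff)
qed

text \<open>The factor rGamma (st t n) is carried along from the last step. At j = 2 it meets the
  singular Gamma factor, giving c; from then on each step is regular and multiplies the limit by its
  own constant. The trailing rGamma (X j 0) waits for the Gamma of the next step, so that the pairs
  of \<open>Gamma_quotient\<close> form.\<close>

lemma iterated_limit:
  assumes "2 \<le> j" "j < n"
  shows "((\<lambda>t. rGamma (st t n) * zf j (P j t)) \<longlongrightarrow> c * zf 1 (P 1 0) * (\<Prod>i=2..j. K i) *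
     (\<Prod>i=3..j. Gamma (Y i) * rGamma (X (i - 1) 0)) * rGamma (X j 0)) (at 0)"
  using assms
proof (induction j rule: dec_induct)
  case base
  obtain R where R: "region 2 (real R) (P 2 0)" using exists_region by blast
  have m: "1 \<ge> (1::nat)" "Suc 1 \<le> n" using n3 by auto
  have R': "region (Suc 1) (real R) (P (Suc 1) 0)" using R by (simp add: numeral_2_eq_2)
  have "\<forall>\<^sub>F t in at 0. K 2 * rGamma (X 2 t) * (rGamma (st t n) * Gamma (X 2 t - 1 / of_nat (d 2))) * zf 1 (P 1 t) +
      rGamma (st t n) * reg 1 R t = rGamma (st t n) * zf 2 (P 2 t)"
    using path_recursion[OF m R'] by eventually_elim (simp add: numeral_2_eq_2 algebra_simps)
  moreover have "((\<lambda>t. K 2 * rGamma (X 2 t) * (rGamma (st t n) * Gamma (X 2 t - 1 / of_nat (d 2))) * zf 1 (P 1 t) +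
      rGamma (st t n) * reg 1 R t) \<longlongrightarrow> K 2 * rGamma (X 2 0) * c * zf 1 (P 1 0) + 0 * reg 1 R 0) (at 0)"
  proof (intro tendsto_add tendsto_mult tendsto_const tendsto_rGamma' tendsto_X rGamma_st reg_tendsto[OF m R'])
    show "((\<lambda>t. rGamma (st t n) * Gamma (X 2 t - 1 / of_nat (d 2))) \<longlongrightarrow> c) (at 0)"
      unfolding X_2 c_def st_def using theta_n theta_sum by (rule rGamma_Gamma_limit)
    have "Dn 1 (P 1 0) \<noteq> 0"
      using Y_nonpole[of 1] n3 by (simp add: P_last rGamma_eq_zero_iff Y_def)
    then have "(zf 1 \<longlongrightarrow> zf 1 (P 1 0)) (nbh 1 (P 1 0))"
      using n3 by (intro cd_tendsto zf_differentiable) auto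
    from filterlim_compose[OF this filterlim_P] show "((\<lambda>t. zf 1 (P 1 t)) \<longlongrightarrow> zf 1 (P 1 0)) (at 0)" .
  qed
  ultimately have "((\<lambda>t. rGamma (st t n) * zf 2 (P 2 t)) \<longlongrightarrow> K 2 * rGamma (X 2 0) * c * zf 1 (P 1 0) + 0 * reg 1 R 0) (at 0)"
    by (rule Lim_transform_eventually[rotated])
  then show ?case by (simp add: mult_ac)
next
  case (step j)
  obtain R where R: "region (Suc j) (real R) (P (Suc j) 0)" using exists_region by blast
  have m: "j \<ge> 1" "Suc j \<le> n" using step by auto
  define L where "L = c * zf 1 (P 1 0) * (\<Prod>i=2..j. K i) * (\<Prod>i=3..j. Gamma (Y i) * rGamma (X (i - 1) 0)) * rGamma (X j 0)"
  have IH: "((\<lambda>t. rGamma (st t n) * zf j (P j t)) \<longlongrightarrow> L) (at 0)" using step unfolding L_def by simp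
  have "\<forall>\<^sub>F t in at 0. K (Suc j) * (Gamma (X (Suc j) t - 1 / of_nat (d (Suc j))) * rGamma (X (Suc j) t)) *
      (rGamma (st t n) * zf j (P j t)) + rGamma (st t n) * reg j R t = rGamma (st t n) * zf (Suc j) (P (Suc j) t)"
    using path_recursion[OF m R] by eventually_elim (simp add: algebra_simps)
  moreover have "((\<lambda>t. K (Suc j) * (Gamma (X (Suc j) t - 1 / of_nat (d (Suc j))) * rGamma (X (Suc j) t)) *
      (rGamma (st t n) * zf j (P j t)) + rGamma (st t n) * reg j R t) \<longlongrightarrow>
      K (Suc j) * (Gamma (Y (Suc j)) * rGamma (X (Suc j) 0)) * L + 0 * reg j R 0) (at 0)"
    unfolding Y_def
    by (intro tendsto_add tendsto_mult tendsto_const tendsto_rGamma' tendsto_Gamma' tendsto_diff tendsto_X rGamma_st reg_tendsto[OF m R] IH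
        Y_nonpole[unfolded Y_def]) (use step in auto)
  ultimately have "((\<lambda>t. rGamma (st t n) * zf (Suc j) (P (Suc j) t)) \<longlongrightarrow>
      K (Suc j) * (Gamma (Y (Suc j)) * rGamma (X (Suc j) 0)) * L + 0 * reg j R 0) (at 0)"
    by (rule Lim_transform_eventually[rotated])
  moreover have "K (Suc j) * (Gamma (Y (Suc j)) * rGamma (X (Suc j) 0)) * L + 0 * reg j R 0 =
     c * zf 1 (P 1 0) * (\<Prod>i=2..Suc j. K i) * (\<Prod>i=3..Suc j. Gamma (Y i) * rGamma (X (i - 1) 0)) * rGamma (X (Suc j) 0)"
    using step by (simp add: L_def mult_ac)
  ultimately show ?case by (simp only:)
qed

lemma path_limit:
  assumes R: "region n (real R) (st 0)"
  shows "((\<lambda>t. zf n (st t)) \<longlongrightarrow> c * zf 1 (P 1 0) * (\<Prod>i=2..n. K i) *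
     (\<Prod>i=3..n. Gamma (Y i) * rGamma (X (i - 1) 0)) + reg (n - 1) R 0) (at 0)"
proof -
  obtain j where j: "n = Suc j" using n3 by (cases n) auto
  have m: "j \<ge> 1" "Suc j \<le> n" using n3 j by auto
  have R': "region (Suc j) (real R) (P (Suc j) 0)" using R P_n j by metis
  define L where "L = c * zf 1 (P 1 0) * (\<Prod>i=2..j. K i) * (\<Prod>i=3..j. Gamma (Y i) * rGamma (X (i - 1) 0)) * rGamma (X j 0)"
  have L: "((\<lambda>t. rGamma (st t n) * zf j (P j t)) \<longlongrightarrow> L) (at 0)"
    unfolding L_def by (rule iterated_limit) (use n3 j in auto)
  \<comment> \<open>No merging has taken place yet, so the rGamma of this step is the factor carried
    through the induction. The regular part of this step is not multiplied by it and
    survives.\<close>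
  have Xn: "X n t = st t n" for t by (simp add: X_def tail_def)
  have "\<forall>\<^sub>F t in at 0. K n * Gamma (X n t - 1 / of_nat (d n)) * (rGamma (st t n) * zf j (P j t)) + reg j R t = zf n (st t)"
    using path_recursion[OF m R'] unfolding j[symmetric] P_n by eventually_elim (simp add: Xn mult_ac)
  moreover have "((\<lambda>t. K n * Gamma (X n t - 1 / of_nat (d n)) * (rGamma (st t n) * zf j (P j t)) + reg j R t) \<longlongrightarrow>
      K n * Gamma (Y n) * L + reg j R 0) (at 0)"
    unfolding Y_def
    by (intro tendsto_add tendsto_mult tendsto_const tendsto_Gamma' tendsto_diff tendsto_X reg_tendsto[OF m R'] L
        Y_nonpole[unfolded Y_def]) (use n3 in auto)
  ultimately have "((\<lambda>t. zf n (st t)) \<longlongrightarrow> K n * Gamma (Y n) * L + reg j R 0) (at 0)"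
    by (rule Lim_transform_eventually[rotated])
  moreover have "K n * Gamma (Y n) * L = c * zf 1 (P 1 0) * (\<Prod>i=2..n. K i) *
     (\<Prod>i=3..n. Gamma (Y i) * rGamma (X (i - 1) 0))"
    using n3 by (simp add: L_def mult_ac j)
  moreover have "n - 1 = j" using j by simp
  ultimately show ?thesis by simp
qed

section \<open>Evaluation of the limit\<close>

text \<open>The tail of reciprocals in X (i - 1) is the full sum subtracted in Y i, so the two
  arguments differ by N (i - 1). The quotient is a Pochhammer symbol, written as a product over
  integers u.\<close>

lemma Gamma_quotient:
  assumes i: "i \<in> {3..n}"
  shows "Gamma (Y i) * rGamma (X (i - 1) 0) =
     (\<Prod>u\<in>{- (\<Sum>k=i-1..n. int (N k)) .. - (\<Sum>k=i..n. int (N k)) - 1}. of_int u - (\<Sum>k=i..n. 1 / of_nat (d k)))"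
proof -
  define S where "S = (\<Sum>k=i..n. int (N k))"
  define T where "T = (\<Sum>k=i..n. 1 / of_nat (d k) :: complex)"
  obtain j where j: "i = Suc j" using i by (cases i) auto
  have Sj: "(\<Sum>k=j..n. int (N k)) = int (N j) + S"
    unfolding S_def using i j by (subst sum.atLeast_Suc_atMost) auto
  have stS: "(\<Sum>k=l..n. st 0 k) = - of_int (\<Sum>k=l..n. int (N k))" for l
    unfolding sum_st by simp
  have "T = 1 / of_nat (d i) + tail i"
    unfolding T_def tail_def using i by (subst sum.atLeast_Suc_atMost) auto
  then have Y: "Y i = - of_int S - T" unfolding Y_def X_def stS S_def by simp
  have X: "X j 0 = - of_int (int (N j) + S) - T"
    unfolding X_def stS Sj by (simp add: tail_def T_def j)
  have XY: "X j 0 + of_nat (N j) = Y i" unfolding X Y by simp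
  have "rGamma (X j 0) = pochhammer (X j 0) (N j) * rGamma (Y i)"
    using pochhammer_rGamma[of "X j 0" "N j"] unfolding XY .
  moreover have "rGamma (Y i) \<noteq> 0" using Y_nonpole[of i] i by (simp add: rGamma_eq_zero_iff)
  ultimately have "Gamma (Y i) * rGamma (X j 0) = pochhammer (X j 0) (N j)" by (simp add: Gamma_def)
  also have "\<dots> = (\<Prod>q<N j. of_int (int q - (int (N j) + S)) - T)"
    unfolding pochhammer_prod X by (intro prod.cong) auto
  also have "\<dots> = (\<Prod>u\<in>{- (int (N j) + S) .. - S - 1}. of_int u - T)"
    by (rule prod.reindex_bij_witness[of _ "\<lambda>u. nat (u + (int (N j) + S))" "\<lambda>q. int q - (int (N j) + S)"]) auto
  finally show ?thesis unfolding S_def[symmetric] T_def[symmetric] using Sj j by simp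
qed

lemma main_value:
  "c * zf 1 (P 1 0) * (\<Prod>i=2..n. K i) * (\<Prod>i=3..n. Gamma (Y i) * rGamma (X (i - 1) 0)) =
   C_coeff n d b N * bernoulli (d 1 * ((\<Sum>j=1..n. N j) + b) + 1) *
              (\<gamma> 1 ^ ((\<Sum>j=1..n. N j) + b) * (\<Prod>j=2..n. \<gamma> j powr (- (1 / of_nat (d j))))) *
              (\<theta> n / (\<Sum>j=2..n. \<theta> j)) *
              (\<Prod>j=2..n. Gamma (1 / of_nat (d j)))"
proof -
  define M1 where "M1 = (\<Sum>j=1..n. N j) + b"
  define p where "p = d 1 * M1 + 1"
  define A where "A = (\<Sum>k=2..n-1. N k) + b"
  \<comment> \<open>Positivity of b gives p >= 2, where the two conventions for Bernoulli numbers
    coincide.\<close>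
  have "real b > 0" unfolding b_eq
    using n3 d_ge_1 by (intro sum_pos) (auto simp: Suc_le_eq)
  then have p2: "p \<ge> 2" using d_ge_1[of 1] n3 by (simp add: p_def M1_def)
  have MA: "M = A + N n"
  proof -
    have "{2..n} = insert n {2..n-1}" using n3 by auto
    moreover have "n \<notin> {2..n-1}" using n3 by auto
    ultimately have "(\<Sum>k=2..n. N k) = N n + (\<Sum>k=2..n-1. N k)" by (metis sum.insert finite_atLeastAtMost)
    then show ?thesis by (simp add: M_def A_def)
  qed
  have "P 1 0 1 = X 1 0" using n3 by (intro P_last) auto
  then have "P 1 0 1 = - of_nat M1" unfolding M1_def by (simp only: X_1)
  moreover have "Dn 1 (P 1 0) \<noteq> 0"
    using Y_nonpole[of 1] n3 by (simp add: P_last rGamma_eq_zero_iff Y_def)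
  ultimately have f1: "zf 1 (P 1 0) = - (\<gamma> 1 ^ M1 * bernoulli_plus p / of_nat p)"
    unfolding p_def using n3 by (intro zf_1_value) auto
  \<comment> \<open>For odd p both sides vanish. For even p the exponent d_1 * M1 is odd, so
    (-1)^(d_1 * M1) is the minus sign of the zeta value.\<close>
  have sign: "- ((-1) ^ N n / (-1) ^ M * bernoulli_plus p) = (-1) ^ (A + d 1 * M1) * bernoulli p"
  proof (cases "even p")
    case False
    then have "bernoulli_plus p = 0" using p2 by (intro bernoulli_plus_odd) auto
    moreover from this have "bernoulli p = 0" using p2 by (simp add: bernoulli_plus_def)
    ultimately show ?thesis by simp
  next
    case True
    then have "odd (d 1 * M1)" by (simp add: p_def)
    then have "(-1 :: complex) ^ (d 1 * M1) = -1" by simp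
    moreover have "(-1 :: complex) ^ N n / (-1) ^ M = (-1) ^ A"
      unfolding MA power_add by (cases "even A"; cases "even (N n)") auto
    ultimately show ?thesis using p2 by (simp add: power_add bernoulli_plus_def)
  qed
  have Kp: "(\<Prod>i=2..n. K i) = (\<Prod>j=2..n. \<gamma> j powr (- (1 / of_nat (d j)))) * (\<Prod>j=2..n. Gamma (1 / of_nat (d j))) / of_nat (\<Prod>j=2..n. d j)"
    by (simp add: main_const_def prod.distrib prod_dividef)
  have Gq: "(\<Prod>i=3..n. Gamma (Y i) * rGamma (X (i - 1) 0)) =
     (\<Prod>j=3..n. \<Prod>u\<in>{- (\<Sum>k=j-1..n. int (N k)) .. - (\<Sum>k=j..n. int (N k)) - 1}. of_int u - (\<Sum>k=j..n. 1 / of_nat (d k)))"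
    by (intro prod.cong refl Gamma_quotient)
  define Q where "Q = (\<Prod>j=3..n. \<Prod>u\<in>{- (\<Sum>k=j-1..n. int (N k)) .. - (\<Sum>k=j..n. int (N k)) - 1}. of_int u - (\<Sum>k=j..n. 1 / of_nat (d k)) :: complex)"
  define G where "G = (\<Prod>j=2..n. Gamma (1 / of_nat (d j)) :: complex)"
  define V where "V = (\<Prod>j=2..n. \<gamma> j powr (- (1 / of_nat (d j))))"
  define D where "D = (of_nat (\<Prod>j=2..n. d j) :: complex)"
  define \<Theta> where "\<Theta> = (\<Sum>j=2..n. \<theta> j)"
  have C: "C_coeff n d b N = Q * ((-1) ^ (A + d 1 * M1) * fact (N n) / (fact M * D * of_nat p))"
    unfolding C_coeff_def Q_def A_def M1_def M_def D_def p_def ..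
  have "c * zf 1 (P 1 0) * (V * G / D) * Q =
      - ((-1) ^ N n / (-1) ^ M * bernoulli_plus p) * (fact (N n) * \<theta> n / (fact M * \<Theta>)) * (\<gamma> 1 ^ M1 / of_nat p) * (V * G / D) * Q"
    unfolding c_def f1 \<Theta>_def[symmetric] by (simp add: mult_ac)
  also have "\<dots> = C_coeff n d b N * bernoulli p * (\<gamma> 1 ^ M1 * V) * (\<theta> n / \<Theta>) * G"
    unfolding sign C by (simp add: mult_ac)
  finally show ?thesis
    unfolding Kp Gq V_def[symmetric] G_def[symmetric] D_def[symmetric] Q_def[symmetric] \<Theta>_def[symmetric] p_def M1_def .
qed

lemma H_point_eq: "merge_last (n - 1) (of_nat i) (st 0) = H_point n N i"
  using n3 by (auto simp: merge_last_def H_point_def st_def fun_eq_iff)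

lemma Dn_H_point: "Dn (n - 1) (H_point n N i) \<noteq> 0"
proof -
  obtain j where j: "n = Suc j" using n3 by (cases n) auto
  then show ?thesis using Dn_merge_P[of j i] n3 P_n[of 0] H_point_eq[of i] by simp
qed

lemma mzeta_H_point:
  "mzeta_regular (n - 1) d \<gamma> (H_point n N i)" "mzeta (n - 1) d \<gamma> (H_point n N i) = zf (n - 1) (H_point n N i)"
  using n3 Dn_H_point by (auto intro!: mzeta_eq_zf)

text \<open>At t = 0 the remainder vanishes and the sum ends at i = N n. The term i = 0 carries B_1
  = 1/2; the terms with d_n * i even and positive vanish, being odd-indexed Bernoulli numbers, and
  the others correspond to k through d_n * i + 1 = 2 * k.\<close>

lemma reg_eq_H_term:
  assumes R: "R \<ge> N n"
  shows "reg (n - 1) R 0 = H_term n d \<gamma> N"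
proof -
  obtain j where j: "n = Suc j" "n - 1 = j" using n3 by (cases n) auto
  have dn: "d n \<ge> 1" using n3 by (intro d_ge_1) auto
  define z where "z i = mzeta (n - 1) d \<gamma> (H_point n N i)" for i
  define e where "e i = bernoulli_plus (d n * i + 1) / of_nat (d n * i + 1) * of_nat (N n choose i) * \<gamma> n ^ i * z i" for i
  have J: "N n < depth j R" using R by (simp add: depth_def)
  have XS: "X n 0 = - of_nat (N n)" by (simp add: X_def tail_def st_def)
  have H: "zf j (merge_last j (of_nat i) (st 0)) = z i" for i
    using H_point_eq mzeta_H_point(2) j(2) by (simp add: z_def)
  have rem0: "rem_sum j (depth j R) (st 0) = 0"
    using J j by (intro rem_sum_eq_0[where N = "N n"]) (auto simp: st_def)
  have "reg (n - 1) R 0 = - (\<Sum>i<depth j R. e i)"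
    unfolding reg_def j(2) j(1)[symmetric] P_n rem0 XS H by (simp add: em_coeff_nat e_def)
  also have "(\<Sum>i<depth j R. e i) = (\<Sum>i\<le>N n. e i)"
    by (rule sum.mono_neutral_right) (use J in \<open>auto simp: e_def binomial_eq_0\<close>)
  also have "\<dots> = e 0 + (\<Sum>i=1..N n. e i)"
  proof -
    have "{..N n} = insert 0 {1..N n}" by auto
    moreover have "sum e (insert 0 {1..N n}) = e 0 + sum e {1..N n}" by (rule sum.insert) auto
    ultimately show ?thesis by metis
  qed
  also have "e 0 = 1 / 2 * z 0" by (simp add: e_def bernoulli_plus_def)
  also have "(\<Sum>i=1..N n. e i) = (\<Sum>i\<in>{i\<in>{1..N n}. odd (d n * i)}. e i)"
  proof (rule sum.mono_neutral_right)
    show "\<forall>i\<in>{1..N n} - {i \<in> {1..N n}. odd (d n * i)}. e i = 0"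
      using dn by (auto simp: e_def bernoulli_plus_odd)
  qed auto
  also have "\<dots> = (\<Sum>k\<in>H_indices n d N. bernoulli (2 * k) / of_nat (2 * k) * of_nat (N n choose ((2 * k - 1) div d n)) *
       \<gamma> n ^ ((2 * k - 1) div d n) * z ((2 * k - 1) div d n))"
  proof (rule sum.reindex_bij_witness[of _ "\<lambda>k. (2 * k - 1) div d n" "\<lambda>i. (d n * i + 1) div 2"])
    fix i assume i: "i \<in> {i\<in>{1..N n}. odd (d n * i)}"
    then have k2: "2 * ((d n * i + 1) div 2) = d n * i + 1" by auto
    then have k1: "2 * ((d n * i + 1) div 2) - 1 = d n * i" by simp
    have di: "d n * i \<ge> 1" "d n * i \<le> d n * N n" using i dn by auto
    show "(2 * ((d n * i + 1) div 2) - 1) div d n = i" unfolding k1 using dn by simp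
    show "(d n * i + 1) div 2 \<in> H_indices n d N"
    proof -
      have "1 \<le> (d n * i + 1) div 2" using k2 di by linarith
      moreover have "(d n * i + 1) div 2 \<le> (1 + d n * N n) div 2" using di by (intro div_le_mono) simp
      ultimately show ?thesis unfolding H_indices_def mem_Collect_eq k1 atLeastAtMost_iff by (intro conjI dvd_triv_left)
    qed
    show "bernoulli (2 * ((d n * i + 1) div 2)) / of_nat (2 * ((d n * i + 1) div 2)) *
        of_nat (N n choose ((2 * ((d n * i + 1) div 2) - 1) div d n)) *
       \<gamma> n ^ ((2 * ((d n * i + 1) div 2) - 1) div d n) * z ((2 * ((d n * i + 1) div 2) - 1) div d n) = e i"
      unfolding k1 unfolding k2 using dn di by (simp add: e_def bernoulli_plus_def)
  next
    fix k assume k: "k \<in> H_indices n d N"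
    then obtain i where i: "2 * k - 1 = d n * i" by (auto simp: H_indices_def)
    have k': "k \<ge> 1" "k \<le> (1 + d n * N n) div 2" using k by (auto simp: H_indices_def)
    then have "2 * k - 1 \<le> d n * N n" by linarith
    then have "i \<le> N n" unfolding i using dn by simp
    moreover have "i \<noteq> 0" using i k' by (intro notI) simp
    moreover have ki: "d n * i + 1 = 2 * k" using i k' by simp
    moreover have "(2 * k - 1) div d n = i" unfolding i using dn by simp
    moreover have "odd (d n * i)" using ki by presburger
    ultimately show "(2 * k - 1) div d n \<in> {i\<in>{1..N n}. odd (d n * i)}"
      "(d n * ((2 * k - 1) div d n) + 1) div 2 = k" by auto
  qed
  finally show ?thesis by (simp add: H_term_def z_def)
qed

lemma H_term_in_rat_adjoin: "H_term n d \<gamma> N \<in> rat_adjoin (\<gamma> ` {1..n})"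
proof -
  let ?K = "rat_adjoin (\<gamma> ` {1..n})"
  note F = subfield_closed[OF is_subfield_rat_adjoin]
  have z: "mzeta (n - 1) d \<gamma> (H_point n N i) \<in> ?K" if "i \<le> N n" for i
    unfolding mzeta_H_point(2)
  proof (rule zf_in_rat_adjoin[where a = "N(n - 1 := N (n - 1) + (N n - i))"])
    show "H_point n N i j = - of_nat ((N(n - 1 := N (n - 1) + (N n - i))) j)" for j
      using that by (simp add: H_point_def of_nat_diff)
  qed (use n3 Dn_H_point in auto)
  have g: "\<gamma> n \<in> ?K" using n3 rat_adjoin_superset[of "\<gamma> ` {1..n}"] by auto
  have dn: "d n \<ge> 1" using n3 by (intro d_ge_1) auto
  \<comment> \<open>The shift (2k - 1) / d_n never exceeds N_n, so all points in H have nonpositive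
    integer coordinates.\<close>
  have le: "(2 * k - 1) div d n \<le> N n" if "k \<in> H_indices n d N" for k
  proof -
    have "k \<le> (1 + d n * N n) div 2" using that by (simp add: H_indices_def)
    then have "2 * k - 1 \<le> d n * N n" by linarith
    then have "(2 * k - 1) div d n \<le> d n * N n div d n" by (rule div_le_mono)
    then show ?thesis using dn by simp
  qed
  show ?thesis
    unfolding H_term_def
    by (intro F subfield_sum[OF is_subfield_rat_adjoin] g z le) (auto intro!: Rats_subset_subfield[OF is_subfield_rat_adjoin] bernoulli_in_Rats simp del: of_nat_mult)
qed

lemma mzeta_limit:
  "((\<lambda>t. mzeta n d \<gamma> (st t)) \<longlongrightarrow>
              C_coeff n d b N * bernoulli (d 1 * ((\<Sum>j=1..n. N j) + b) + 1) *
              (\<gamma> 1 ^ ((\<Sum>j=1..n. N j) + b) * (\<Prod>j=2..n. \<gamma> j powr (- (1 / of_nat (d j))))) *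
              (\<theta> n / (\<Sum>j=2..n. \<theta> j)) *
              (\<Prod>j=2..n. Gamma (1 / of_nat (d j))) + H_term n d \<gamma> N) (at 0)"
proof -
  obtain R where R: "R \<ge> N n" "region n (real R) (st 0)" using exists_region by blast
  have "\<forall>\<^sub>F t in at 0. zf n (st t) = mzeta n d \<gamma> (st t)"
    using Dn_path by eventually_elim (use n3 in \<open>simp add: mzeta_eq_zf\<close>)
  with path_limit[OF R(2)] show ?thesis
    unfolding main_value reg_eq_H_term[OF R(1)] by (rule Lim_transform_eventually)
qed

end

text \<open>\<open>mzeta\<close> is unspecified at non-regular points; the regularity clauses
  therefore give the limit and the terms of H their meaning. Membership of b in the natural numbers
  comes from the hypothesis for j = 2 with all entries 1.\<close>

theorem theorem2:
  fixes n :: nat and d N :: "nat \<Rightarrow> nat" and \<gamma> \<theta> :: "nat \<Rightarrow> complex"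
  assumes "n \<ge> 3"
    and "\<And>j. j \<in> {1..n} \<Longrightarrow> Re (\<gamma> j) > 0"
    and "\<And>j. j \<in> {1..n} \<Longrightarrow> d j \<ge> 1"
    and "\<And>j (\<epsilon> :: nat \<Rightarrow> nat). j \<in> {1..n} \<Longrightarrow> (\<forall>k\<in>{j+1..n}. \<epsilon> k \<in> {0, 1}) \<Longrightarrow>
           (1 / real (d j) + (\<Sum>k=j+1..n. real (\<epsilon> k) / real (d k)) \<in> \<nat>
              \<longleftrightarrow> j = 2 \<and> (\<forall>k\<in>{3..n}. \<epsilon> k = 1))"
    and "(\<Sum>j=2..n. \<theta> j) \<noteq> 0"
    and "\<theta> n \<noteq> 0"
  shows "\<exists>b::nat. b \<ge> 1 \<and> real b = (\<Sum>k=2..n. 1 / real (d k)) \<and>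
           (\<forall>\<^sub>F t in at 0. mzeta_regular n d \<gamma> (\<lambda>j. - of_nat (N j) + t * \<theta> j)) \<and>
           mzeta_regular (n - 1) d \<gamma> (H_point n N 0) \<and>
           (\<forall>k\<in>H_indices n d N. mzeta_regular (n - 1) d \<gamma> (H_point n N ((2 * k - 1) div d n))) \<and>
           ((\<lambda>t. mzeta n d \<gamma> (\<lambda>j. - of_nat (N j) + t * \<theta> j)) \<longlongrightarrow>
              C_coeff n d b N * bernoulli (d 1 * ((\<Sum>j=1..n. N j) + b) + 1) *
              (\<gamma> 1 ^ ((\<Sum>j=1..n. N j) + b) * (\<Prod>j=2..n. \<gamma> j powr (- (1 / of_nat (d j))))) *
              (\<theta> n / (\<Sum>j=2..n. \<theta> j)) *
              (\<Prod>j=2..n. Gamma (1 / of_nat (d j))) + H_term n d \<gamma> N) (at 0) \<and>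
           C_coeff n d b N \<in> \<rat> - {0} \<and>
           H_term n d \<gamma> N \<in> rat_adjoin (\<gamma> ` {1..n})"
proof -
  interpret multizeta d \<gamma> n
    using assms(2,3) by unfold_locales
  have nonint: "1 / real (d j) + (\<Sum>k\<in>E. 1 / real (d k)) \<in> \<nat> \<longleftrightarrow> j = 2 \<and> E = {3..n}"
    if j: "j \<in> {1..n}" and E: "E \<subseteq> {j+1..n}" for j E
  proof -
    \<comment> \<open>The indicator of E translates the hypothesis on 0-1 vectors into the form with
      sets.\<close>
    define \<epsilon> :: "nat \<Rightarrow> nat" where "\<epsilon> k = (if k \<in> E then 1 else 0)" for k
    have "(\<Sum>k=j+1..n. real (\<epsilon> k) / real (d k)) = (\<Sum>k\<in>E. 1 / real (d k))"
      by (rule sum.mono_neutral_cong_right) (use E in \<open>auto simp: \<epsilon>_def\<close>)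
    moreover have "(j = 2 \<and> (\<forall>k\<in>{3..n}. \<epsilon> k = 1)) \<longleftrightarrow> (j = 2 \<and> E = {3..n})"
      using E by (auto simp: \<epsilon>_def split: if_splits)
    moreover have "\<forall>k\<in>{j+1..n}. \<epsilon> k \<in> {0, 1}" by (simp add: \<epsilon>_def)
    ultimately show ?thesis using assms(4)[of j \<epsilon>] j by simp
  qed
  have "1 / real (d 2) + (\<Sum>k\<in>{3..n}. 1 / real (d k)) \<in> \<nat>"
    using nonint[of 2 "{3..n}"] assms(1) by simp
  moreover have "(\<Sum>k=2..n. 1 / real (d k)) = 1 / real (d 2) + (\<Sum>k\<in>{3..n}. 1 / real (d k))"
    using assms(1) by (subst sum.atLeast_Suc_atMost) auto
  ultimately obtain b :: nat where b: "real b = (\<Sum>k=2..n. 1 / real (d k))"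
    by (metis Nats_cases)
  have "(\<Sum>k=2..n. 1 / real (d k)) > 0"
    using assms(1,3) by (intro sum_pos) (auto simp: Suc_le_eq)
  then have "b \<ge> 1" using b by linarith
  interpret multizeta_point d \<gamma> n N \<theta> b
    using assms(1,5,6) nonint b by unfold_locales
  have "\<forall>\<^sub>F t in at 0. mzeta_regular n d \<gamma> (st t)"
    using Dn_path by eventually_elim (use assms(1) in \<open>auto intro!: mzeta_eq_zf\<close>)
  then show ?thesis
    using \<open>b \<ge> 1\<close> b mzeta_limit mzeta_H_point(1) H_term_in_rat_adjoin C_coeff_in_Rats[of n d b N]
      C_coeff_nonzero[where n = n and d = d and b = b and N = N, OF assms(1,3)]
    unfolding st_def by blast
qed

end
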